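(* Let $X$ be a geodesic surface, let $D>0$, let $\alpha\subset X$ be a $DC(D)$ isolated geodesic circle, and let $G$ be an abelian group. Then for every $k\ge 2$ the persistence $\{H_k(\operatorname{Rips}(\alpha,r),G)\}_{0<r\le D}$ is a direct summand of the persistence $\{H_k(\operatorname{Rips}(X,r),G)\}_{0<r\le D}$ via the map induced by the inclusion $\alpha\hookrightarrow X$.
   Context: A metric space $X$ is geodesic if any two distinct points $x,y$ are joined by an isometric embedding $[0,d(x,y)]\to X$ (a geodesic); a geodesic surface is a surface with a geodesic metric. A geodesic circle in $X$ is an isometrically embedded circle carrying a geodesic metric. It is assumed throughout that $\alpha$ has some orientable subsurface of $X$ as a neighborhood. Subsets of $X$ carry the restricted metric. For a metric space $Y$ and $r>0$, $\operatorname{Rips}(Y,r)$ is the (open) Vietoris-Rips complex: the simplicial complex with vertex set $Y$ whose simplices are the finite nonempty subsets $\sigma\subset Y$ with $\operatorname{Diam}(\sigma)<r$. $N(A,r)$ is the open $r$-neighborhood of $A$ in $X$. For a metric space $Y$ and $A\subset Y$, a deformation contraction $Y\xrightarrow{DC}A$ is a continuous map $F:Y\times[0,1]\to Y$ with (i) $F(x,0)=x$, $F(x,1)\in A$, $F(a,t)=a$ for all $x\in Y$, $a\in A$, $t\in[0,1]$; and (ii) $d(F(x,t'),F(y,t'))\le d(F(x,t),F(y,t))$ for all $x,y\in Y$ and $t'>t$. For $0<D_1\le D_2$, a loop $\alpha\subset X$ is $DC(D_1,D_2)$ isolated if there are closed nested neighborhoods $N_1\subset N_2$ of $\alpha$ such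 that: (1) $N_1$ and $N_2$ are homeomorphic to $S^1\times[0,1]$; (2) $N_2\supset N(N_1,D_2)$; (3) $\partial N_1$ consists of two loops $\alpha_1,\alpha_2$ which are at least $D_1$ apart from each other; (4) $\operatorname{Rips}(\alpha_i,r)\simeq S^1$ for $i=1,2$ and all $0<r<D_1$; (5) $N_2\setminus\operatorname{Int}(N_1)\xrightarrow{DC}\partial N_1$ and $N_1\xrightarrow{DC}\alpha$. $DC(D)$ isolated means $DC(D,D)$ isolated. A persistence is the family of homology groups indexed by $r$ together with the maps induced by the inclusions $\operatorname{Rips}(Y,p)\hookrightarrow\operatorname{Rips}(Y,q)$, $p<q$. Direct sums and isomorphisms of persistences are level-wise and commute with these bonding maps. *)

theory Defs
  imports
    "HOL-Analysis.Analysis"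
    "HOL-Algebra.Coset"
    "HOL-Combinatorics.Permutations"
begin

section \<open>Geodesic surfaces and geodesic circles\<close>

text \<open>Subsets of a metric space carry the restricted metric, so geodesics in \<open>S\<close> have to stay in \<open>S\<close>.\<close>

definition geodesic_space :: "'a::metric_space set \<Rightarrow> bool" where
  "geodesic_space S \<longleftrightarrow>
     (\<forall>x\<in>S. \<forall>y\<in>S. x \<noteq> y \<longrightarrow>
        (\<exists>\<gamma> :: real \<Rightarrow> 'a. \<gamma> ` {0..dist x y} \<subseteq> S \<and> \<gamma> 0 = x \<and> \<gamma> (dist x y) = y \<and>
           (\<forall>s\<in>{0..dist x y}. \<forall>t\<in>{0..dist x y}. dist (\<gamma> s) (\<gamma> t) = \<bar>s - t\<bar>)))"

text \<open>
  Surfaces may have a boundary. Second countability is not listed: a connected metrizable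
  locally Euclidean space has a countable base, and geodesic spaces are connected.
\<close>

definition surface :: "'a::metric_space set \<Rightarrow> bool" where
  "surface S \<longleftrightarrow>
     (\<forall>x\<in>S. \<exists>U. openin (top_of_set S) U \<and> x \<in> U \<and>
        (U homeomorphic (UNIV :: complex set) \<or> U homeomorphic {z :: complex. 0 \<le> Im z}))"

text \<open>Interior and boundary in the sense of manifolds.\<close>

definition surface_interior :: "'a::metric_space set \<Rightarrow> 'a set" where
  "surface_interior S =
     {x \<in> S. \<exists>U. openin (top_of_set S) U \<and> x \<in> U \<and> U homeomorphic (UNIV :: complex set)}"

definition surface_boundary :: "'a::metric_space set \<Rightarrow> 'a set" where
  "surface_boundary S = S - surface_interior S"

definition topological_circle :: "'a::metric_space set \<Rightarrow> bool" where
  "topological_circle C \<longleftrightarrow> C homeomorphic sphere (0::complex) 1"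

definition geodesic_circle :: "'a::metric_space set \<Rightarrow> bool" where
  "geodesic_circle C \<longleftrightarrow> topological_circle C \<and> geodesic_space C"


section \<open>Simplicial complexes\<close>

text \<open>A simplicial complex is given by the set of its simplices, which are finite nonempty sets of vertices.\<close>

definition Rips :: "'a::metric_space set \<Rightarrow> real \<Rightarrow> 'a set set" where
  "Rips Y r = {\<sigma>. finite \<sigma> \<and> \<sigma> \<noteq> {} \<and> \<sigma> \<subseteq> Y \<and> diameter \<sigma> < r}"

text \<open>
  Points of the geometric realization are functions of barycentric coordinates. The topology is
  the weak one; on a single closed simplex the product topology is the Euclidean topology.
\<close>

definition closed_simplex :: "'a set \<Rightarrow> ('a \<Rightarrow> real) set" where
  "closed_simplex \<sigma> = {t. (\<forall>v. 0 \<le> t v) \<and> (\<forall>v. v \<notin> \<sigma> \<longrightarrow> t v = 0) \<and> sum t \<sigma> = 1}"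

definition geometric_realization :: "'a set set \<Rightarrow> ('a \<Rightarrow> real) topology" where
  "geometric_realization K =
     topology (\<lambda>U. U \<subseteq> (\<Union>\<sigma>\<in>K. closed_simplex \<sigma>) \<and>
                   (\<forall>\<sigma>\<in>K. openin (top_of_set (closed_simplex \<sigma>)) (closed_simplex \<sigma> \<inter> U)))"

lemma openin_geometric_realization:
  "openin (geometric_realization K) U \<longleftrightarrow>
     U \<subseteq> (\<Union>\<sigma>\<in>K. closed_simplex \<sigma>) \<and>
     (\<forall>\<sigma>\<in>K. openin (top_of_set (closed_simplex \<sigma>)) (closed_simplex \<sigma> \<inter> U))"
proof -
  let ?L = "\<lambda>U. U \<subseteq> (\<Union>\<sigma>\<in>K. closed_simplex \<sigma>) \<and>
                (\<forall>\<sigma>\<in>K. openin (top_of_set (closed_simplex \<sigma>)) (closed_simplex \<sigma> \<inter> U))"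
  have "istopology ?L"
    unfolding istopology_def
  proof (intro conjI allI impI)
    fix S T assume S: "?L S" and T: "?L T"
    show "S \<inter> T \<subseteq> (\<Union>\<sigma>\<in>K. closed_simplex \<sigma>)" using S by blast
    show "\<forall>\<sigma>\<in>K. openin (top_of_set (closed_simplex \<sigma>)) (closed_simplex \<sigma> \<inter> (S \<inter> T))"
    proof
      fix \<sigma> assume "\<sigma> \<in> K"
      then have "openin (top_of_set (closed_simplex \<sigma>))
                   ((closed_simplex \<sigma> \<inter> S) \<inter> (closed_simplex \<sigma> \<inter> T))"
        using S T by (meson openin_Int)
      moreover have "(closed_simplex \<sigma> \<inter> S) \<inter> (closed_simplex \<sigma> \<inter> T) = closed_simplex \<sigma> \<inter> (S \<inter> T)"
        by blast
      ultimately show "openin (top_of_set (closed_simplex \<sigma>)) (closed_simplex \<sigma> \<inter> (S \<inter> T))"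
        by simp
    qed
  next
    fix \<K> assume \<K>: "\<forall>S\<in>\<K>. ?L S"
    show "\<Union>\<K> \<subseteq> (\<Union>\<sigma>\<in>K. closed_simplex \<sigma>)" using \<K> by blast
    show "\<forall>\<sigma>\<in>K. openin (top_of_set (closed_simplex \<sigma>)) (closed_simplex \<sigma> \<inter> \<Union>\<K>)"
    proof
      fix \<sigma> assume "\<sigma> \<in> K"
      then have "\<And>T. T \<in> (\<lambda>S. closed_simplex \<sigma> \<inter> S) ` \<K> \<Longrightarrow>
                   openin (top_of_set (closed_simplex \<sigma>)) T"
        using \<K> by (elim imageE) simp
      then have "openin (top_of_set (closed_simplex \<sigma>)) (\<Union>((\<lambda>S. closed_simplex \<sigma> \<inter> S) ` \<K>))"
        by (rule openin_Union)
      then show "openin (top_of_set (closed_simplex \<sigma>)) (closed_simplex \<sigma> \<inter> \<Union>\<K>)"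
        by (simp only: Int_Union)
    qed
  qed
  then show ?thesis
    unfolding geometric_realization_def by (simp only: topology_inverse')
qed


section \<open>DC isolated loops\<close>

definition deformation_contraction :: "'a::metric_space set \<Rightarrow> 'a set \<Rightarrow> bool" where
  "deformation_contraction Y A \<longleftrightarrow> A \<subseteq> Y \<and>
     (\<exists>F :: 'a \<times> real \<Rightarrow> 'a.
        continuous_on (Y \<times> {0..1}) F \<and> F ` (Y \<times> {0..1}) \<subseteq> Y \<and>
        (\<forall>x\<in>Y. F (x, 0) = x) \<and> (\<forall>x\<in>Y. F (x, 1) \<in> A) \<and>
        (\<forall>a\<in>A. \<forall>t\<in>{0..1}. F (a, t) = a) \<and>
        (\<forall>x\<in>Y. \<forall>y\<in>Y. \<forall>t\<in>{0..1}. \<forall>t'\<in>{0..1}. t < t' \<longrightarrow>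
           dist (F (x, t')) (F (y, t')) \<le> dist (F (x, t)) (F (y, t))))"

text \<open>
  The ambient space \<open>X\<close> is the whole type. That \<open>\<alpha>\<close> has an orientable subsurface of \<open>X\<close>
  as a neighborhood is not a separate condition, because the annulus \<open>N\<^sub>1\<close> is one.
\<close>

definition DC_isolated :: "real \<Rightarrow> real \<Rightarrow> 'a::metric_space set \<Rightarrow> bool" where
  "DC_isolated D\<^sub>1 D\<^sub>2 \<alpha> \<longleftrightarrow> 0 < D\<^sub>1 \<and> D\<^sub>1 \<le> D\<^sub>2 \<and>
     (\<exists>N\<^sub>1 N\<^sub>2. closed N\<^sub>1 \<and> closed N\<^sub>2 \<and> \<alpha> \<subseteq> interior N\<^sub>1 \<and> \<alpha> \<subseteq> interior N\<^sub>2 \<and> N\<^sub>1 \<subseteq> N\<^sub>2 \<and>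
        N\<^sub>1 homeomorphic (sphere (0::complex) 1 \<times> {0..1::real}) \<and>
        N\<^sub>2 homeomorphic (sphere (0::complex) 1 \<times> {0..1::real}) \<and>
        (\<Union>x\<in>N\<^sub>1. ball x D\<^sub>2) \<subseteq> N\<^sub>2 \<and>
        (\<exists>\<alpha>\<^sub>1 \<alpha>\<^sub>2. topological_circle \<alpha>\<^sub>1 \<and> topological_circle \<alpha>\<^sub>2 \<and>
           surface_boundary N\<^sub>1 = \<alpha>\<^sub>1 \<union> \<alpha>\<^sub>2 \<and>
           (\<forall>x\<in>\<alpha>\<^sub>1. \<forall>y\<in>\<alpha>\<^sub>2. D\<^sub>1 \<le> dist x y) \<and>
           (\<forall>r. 0 < r \<and> r < D\<^sub>1 \<longrightarrow>
              geometric_realization (Rips \<alpha>\<^sub>1 r)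
                homotopy_equivalent_space top_of_set (sphere (0::complex) 1) \<and>
              geometric_realization (Rips \<alpha>\<^sub>2 r)
                homotopy_equivalent_space top_of_set (sphere (0::complex) 1))) \<and>
        deformation_contraction (N\<^sub>2 - surface_interior N\<^sub>1) (surface_boundary N\<^sub>1) \<and>
        deformation_contraction N\<^sub>1 \<alpha>)"


section \<open>Simplicial homology with coefficients\<close>

text \<open>
  Oriented simplicial chains with coefficients in the abelian group \<open>'g\<close>: a \<open>k\<close>-chain is a
  finitely supported function on ordered \<open>k\<close>-simplices \<open>(v\<^sub>0, \<dots>, v\<^sub>k)\<close> that changes sign when the
  orientation is reversed. The elementary chain \<open>g \<cdot> [v\<^sub>0, \<dots>, v\<^sub>k]\<close> is \<open>g\<close> on the even
  permutations of \<open>(v\<^sub>0, \<dots>, v\<^sub>k)\<close>, \<open>-g\<close> on the odd ones and \<open>0\<close> elsewhere.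
\<close>

definition chains :: "'g::ab_group_add itself \<Rightarrow> nat \<Rightarrow> 'a set set \<Rightarrow> ('a list \<Rightarrow> 'g) set" where
  "chains G k K = {c. finite {xs. c xs \<noteq> 0} \<and>
     (\<forall>xs. c xs \<noteq> 0 \<longrightarrow> length xs = Suc k \<and> distinct xs \<and> set xs \<in> K) \<and>
     (\<forall>xs p. p permutes {..<length xs} \<longrightarrow>
        c (permute_list p xs) = (if evenperm p then c xs else - c xs))}"

text \<open>
  The usual \<open>\<partial>[v\<^sub>0, \<dots>, v\<^sub>k] = \<Sum>\<^sub>i (-1)\<^sup>i [v\<^sub>0, \<dots>, v\<^sub>i\<^sub>-\<^sub>1, v\<^sub>i\<^sub>+\<^sub>1, \<dots>, v\<^sub>k]\<close> in terms of coefficients: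
  the oriented simplices with \<open>[ys]\<close> in their boundary are the \<open>\<plusminus>[v, ys]\<close>, and in \<open>\<partial>[v, ys]\<close> it
  has sign \<open>+\<close>. The case \<open>ys = []\<close> makes the boundary of a \<open>0\<close>-chain zero (no augmentation).
\<close>

definition chain_boundary :: "('a list \<Rightarrow> 'g::ab_group_add) \<Rightarrow> 'a list \<Rightarrow> 'g" where
  "chain_boundary c ys = (if ys = [] then 0 else \<Sum>v | c (v # ys) \<noteq> 0. c (v # ys))"

definition cycle_group ::
    "'g::ab_group_add itself \<Rightarrow> nat \<Rightarrow> 'a set set \<Rightarrow> ('a list \<Rightarrow> 'g) monoid" where
  "cycle_group G k K =
     \<lparr>carrier = {c \<in> chains G k K. chain_boundary c = (\<lambda>ys. 0)},
      mult = (\<lambda>c d xs. c xs + d xs),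
      one = (\<lambda>xs. 0)\<rparr>"

definition boundaries :: "'g::ab_group_add itself \<Rightarrow> nat \<Rightarrow> 'a set set \<Rightarrow> ('a list \<Rightarrow> 'g) set" where
  "boundaries G k K = chain_boundary ` chains G (Suc k) K"

definition simplicial_homology ::
    "'g::ab_group_add itself \<Rightarrow> nat \<Rightarrow> 'a set set \<Rightarrow> ('a list \<Rightarrow> 'g) set monoid" where
  "simplicial_homology G k K = cycle_group G k K Mod boundaries G k K"

text \<open>
  For a subcomplex \<open>K \<subseteq> L\<close> the inclusion extends chains of \<open>K\<close> by zero, i.e. it leaves them
  unchanged as functions. The class of \<open>z\<close> modulo the boundaries of \<open>K\<close> is thus sent to the class
  of \<open>z\<close> modulo the boundaries of \<open>L\<close>.
\<close>

definition homology_inclusion ::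
    "'g::ab_group_add itself \<Rightarrow> nat \<Rightarrow> 'a set set \<Rightarrow> 'a set set \<Rightarrow>
     ('a list \<Rightarrow> 'g) set \<Rightarrow> ('a list \<Rightarrow> 'g) set" where
  "homology_inclusion G k K L =
     (\<lambda>Z \<in> carrier (simplicial_homology G k K). boundaries G k L <#>\<^bsub>cycle_group G k L\<^esub> Z)"


section \<open>Persistence\<close>

text \<open>A family of groups indexed by the scale, and the bonding map from scale \<open>p\<close> to scale \<open>q\<close>, \<open>p < q\<close>.\<close>

type_synonym 'c persistence = "(real \<Rightarrow> 'c monoid) \<times> (real \<Rightarrow> real \<Rightarrow> 'c \<Rightarrow> 'c)"

definition Rips_persistence ::
    "'g::ab_group_add itself \<Rightarrow> nat \<Rightarrow> 'a::metric_space set \<Rightarrow> ('a list \<Rightarrow> 'g) set persistence" where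
  "Rips_persistence G k Y =
     ((\<lambda>r. simplicial_homology G k (Rips Y r)),
      (\<lambda>p q. homology_inclusion G k (Rips Y p) (Rips Y q)))"

text \<open>
  \<open>f\<close> embeds the persistence \<open>A\<close> as a direct summand of \<open>B\<close> over the scales \<open>I\<close>: \<open>f\<close> commutes with
  the bonding maps and there is a subpersistence \<open>W\<close> of \<open>B\<close> such that \<open>f\<close> and the inclusion of
  \<open>W\<close> yield a levelwise isomorphism from the direct sum of \<open>A\<close> and \<open>W\<close> onto \<open>B\<close>.
\<close>

definition direct_summand_via ::
    "real set \<Rightarrow> 'b persistence \<Rightarrow> 'c persistence \<Rightarrow> (real \<Rightarrow> 'b \<Rightarrow> 'c) \<Rightarrow> bool" where
  "direct_summand_via I A B f \<longleftrightarrow>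
     (\<forall>p\<in>I. \<forall>q\<in>I. p < q \<longrightarrow>
        (\<forall>a \<in> carrier (fst A p). f q (snd A p q a) = snd B p q (f p a))) \<and>
     (\<exists>W. (\<forall>r\<in>I. subgroup (W r) (fst B r)) \<and>
          (\<forall>p\<in>I. \<forall>q\<in>I. p < q \<longrightarrow> snd B p q ` W p \<subseteq> W q) \<and>
          (\<forall>r\<in>I. (\<lambda>(a, w). f r a \<otimes>\<^bsub>fst B r\<^esub> w)
                    \<in> iso (fst A r \<times>\<times> (fst B r)\<lparr>carrier := W r\<rparr>) (fst B r)))"

end

(* Write |K| for the realization of a complex K, N = N_1, N' = N_2. A simplex of Rips(X,r), r <= D,
   lies in N' or outside the interior of N, and the two subcomplexes meet in the Rips complex of the
   collar N' - Int N. The collar contracts to its inner boundary, two circles at distance >= D whose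
   Rips complexes are homotopy equivalent to S^1, so for k >= 3 its homology vanishes in degrees k - 1
   and k. By Mayer-Vietoris the cycles outside Int N complement the cycles in N', and N' contracts to
   alpha: a point of the collar and a point of N are joined by a geodesic through the boundary of N
   (invariance of domain), so moving the first one to the boundary does not increase their distance.
   For k = 2 nothing has to be cut: the second homology of Rips(alpha,r) vanishes at every scale,
   because all triangles winding around a geodesic circle are homologous up to triangles contained
   in short arcs, and those carry no second homology.
   That |K| ~ S^1 implies vanishing homology is shown without singular homology: a cycle is
   subdivided, moved along the homotopy by contiguous vertex maps, and finally rounded to a polygon. *)
theory Submission
  imports Defs "HOL-Library.Poly_Mapping"
begin

section \<open>Alternating chains\<close>

text \<open>The cut uses degree k - 1 of the collar, which looks like two circles: for k = 2 this
  would be first homology, which does not vanish. So degree 2 needs a metric analysis of the circle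
  itself, and there the complement is everything. For k \<ge> 3 the complement consists of classes
  of cycles avoiding Int N, a family given by one formula at all scales and hence stable under the
  bonding maps. The retraction to \<alpha> is available only over N'; it moves cycles into the
  summand and shows that the summand injects, but does not define the complement.

  Homotopies and flows enter only through their effect on finitely many vertices. A finite chain
  with diameters strictly below r leaves some slack; a continuous motion is cut into steps shorter
  than the slack, and consecutive steps are contiguous vertex maps. Where simplices are too large
  for this, they are first replaced by subdivided fillings. Both constructions are one recursion
  over simplices that starts at the empty simplex; therefore the boundary is augmented and chains
  are indexed by list length, one more than the dimension.\<close>

abbreviation lookup where "lookup \<equiv> Poly_Mapping.lookup"
abbreviation keys where "keys \<equiv> Poly_Mapping.keys"
abbreviation single where "single \<equiv> Poly_Mapping.single"

text \<open>The coefficient group is not a ring, so a map on generators takes the coefficient as a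
  second argument; the lemmas below ask it to be additive there, or at least to send 0 to 0.\<close>

definition linear_extension :: "('x \<Rightarrow> 'g::ab_group_add \<Rightarrow> 'b::ab_group_add) \<Rightarrow> ('x \<Rightarrow>\<^sub>0 'g) \<Rightarrow> 'b" where
  "linear_extension \<phi> c = (\<Sum>x\<in>keys c. \<phi> x (lookup c x))"

lemma linear_extension_superset:
  assumes "\<And>x. \<phi> x 0 = 0" "finite A" "keys c \<subseteq> A"
  shows "linear_extension \<phi> c = (\<Sum>x\<in>A. \<phi> x (lookup c x))"
  unfolding linear_extension_def
  by (rule sum.mono_neutral_left) (use assms in \<open>auto simp: in_keys_iff\<close>)

lemma additive_imp_zero:
  fixes \<phi> :: "'g::ab_group_add \<Rightarrow> 'b::ab_group_add"
  assumes "\<And>a b. \<phi> (a + b) = \<phi> a + \<phi> b"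
  shows "\<phi> 0 = 0"
  using assms[of 0 0] by simp

lemma additive_imp_uminus:
  fixes \<phi> :: "'g::ab_group_add \<Rightarrow> 'b::ab_group_add"
  assumes "\<And>a b. \<phi> (a + b) = \<phi> a + \<phi> b"
  shows "\<phi> (- a) = - \<phi> a"
  using assms[of a "- a"] additive_imp_zero[of \<phi>, OF assms] by (simp add: minus_unique)

lemma additive_imp_diff:
  fixes \<phi> :: "'g::ab_group_add \<Rightarrow> 'b::ab_group_add"
  assumes "\<And>a b. \<phi> (a + b) = \<phi> a + \<phi> b"
  shows "\<phi> (a - b) = \<phi> a - \<phi> b"
  using assms[of a "- b"] additive_imp_uminus[of \<phi>, OF assms] by simp

lemma additive_imp_sum:
  fixes \<phi> :: "'g::ab_group_add \<Rightarrow> 'b::ab_group_add"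
  assumes "\<And>a b. \<phi> (a + b) = \<phi> a + \<phi> b"
  shows "\<phi> (sum f A) = (\<Sum>x\<in>A. \<phi> (f x))"
  by (induction A rule: infinite_finite_induct)
     (simp_all add: assms additive_imp_zero[of \<phi>, OF assms])

lemma keys_sum_subset: "keys (sum f A) \<subseteq> (\<Union>i\<in>A. keys (f i :: 'x \<Rightarrow>\<^sub>0 'g::ab_group_add))"
  by (auto simp: in_keys_iff lookup_sum intro: ccontr elim!: sum.not_neutral_contains_not_neutral)

lemma linear_extension_add:
  assumes "\<And>x a b. \<phi> x (a + b) = \<phi> x a + \<phi> x b"
  shows "linear_extension \<phi> (c + d) = linear_extension \<phi> c + linear_extension \<phi> d"
proof -
  have z: "\<phi> x 0 = 0" for x by (rule additive_imp_zero) (rule assms)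
  let ?A = "keys c \<union> keys d"
  have "linear_extension \<phi> e = (\<Sum>x\<in>?A. \<phi> x (lookup e x))" if "keys e \<subseteq> ?A" for e
    by (rule linear_extension_superset) (use z that in auto)
  then show ?thesis
    using keys_add[of c d] by (simp add: lookup_add assms sum.distrib)
qed

lemma linear_extension_single:
  assumes "\<And>x. \<phi> x 0 = 0"
  shows "linear_extension \<phi> (single x g) = \<phi> x g"
  using linear_extension_superset[of \<phi> "{x}" "single x g"] assms by simp

lemma poly_mapping_eq_sum_single: "c = (\<Sum>x\<in>keys c. single x (lookup c x))"
  by (rule poly_mapping_eqI)
     (auto simp: lookup_sum lookup_single when_def in_keys_iff sum.delta' if_distrib cong: if_cong)

text \<open>A chain is a finite sum of \<open>single\<close> terms, so additive operators are
  determined by them. Formal identities such as \<open>bd_push_map\<close>, \<open>bd_cone\<close>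
  and \<open>cone_anticommute\<close> are reduced to generators in this way.\<close>

lemma additive_eqI:
  fixes F :: "('x \<Rightarrow>\<^sub>0 'g::ab_group_add) \<Rightarrow> 'b::ab_group_add"
  assumes "\<And>a b. F (a + b) = F a + F b" "\<And>a b. F' (a + b) = F' a + F' b"
    and "\<And>x g. F (single x g) = F' (single x g)"
  shows "F c = F' c"
  by (subst (1 2) poly_mapping_eq_sum_single)
     (simp add: additive_imp_sum[of F] additive_imp_sum[of F'] assms)

section \<open>Pushforward along maps of generators\<close>

definition push :: "('x \<Rightarrow> 'y) \<Rightarrow> ('x \<Rightarrow>\<^sub>0 'g::ab_group_add) \<Rightarrow> ('y \<Rightarrow>\<^sub>0 'g)" where
  "push h = linear_extension (\<lambda>x. single (h x))"

lemma push_add: "push h (a + b) = push h a + push h b"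
  unfolding push_def by (rule linear_extension_add) (rule single_add)

lemma push_single [simp]: "push h (single x g) = single (h x) g"
  unfolding push_def by (rule linear_extension_single) simp

lemmas push_zero [simp] = additive_imp_zero[of "push h" for h, OF push_add]
  and push_diff = additive_imp_diff[of "push h" for h, OF push_add]

lemma push_push: "push h (push h' c) = push (\<lambda>x. h (h' x)) c"
  by (rule additive_eqI) (simp_all add: push_add)

lemma push_cong: "(\<And>x. x \<in> keys c \<Longrightarrow> h x = h' x) \<Longrightarrow> push h c = push h' c"
  unfolding push_def linear_extension_def by (rule sum.cong) auto

lemma push_id [simp]: "push (\<lambda>x. x) c = c"
  by (rule additive_eqI) (simp_all add: push_add)

lemma lookup_push:
  assumes "finite A" "keys c \<subseteq> A"
  shows "lookup (push h c) y = (\<Sum>x\<in>A. if h x = y then lookup c x else 0)"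
  unfolding push_def
  by (subst linear_extension_superset[OF _ assms])
     (auto simp: lookup_sum lookup_single when_def intro!: sum.cong)

lemma keys_push_subset: "keys (push h c) \<subseteq> h ` keys c"
  by (auto simp: in_keys_iff lookup_push[OF finite_keys subset_refl]
      elim!: sum.not_neutral_contains_not_neutral split: if_splits)

text \<open>
  On alternating chains it suffices to drop the head of each list, without the alternating sum over
  all faces. The boundary is augmented: it maps chains on singletons to chains on the empty list.
\<close>

definition bd :: "('a list \<Rightarrow>\<^sub>0 'g::ab_group_add) \<Rightarrow> ('a list \<Rightarrow>\<^sub>0 'g)" where
  "bd = linear_extension (\<lambda>xs g. case xs of [] \<Rightarrow> 0 | x # ys \<Rightarrow> single ys g)"

lemma bd_add: "bd (a + b) = bd a + bd b"
  unfolding bd_def by (rule linear_extension_add) (auto simp: single_add split: list.split)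

lemma bd_single_Nil [simp]: "bd (single [] g) = 0"
  and bd_single_Cons [simp]: "bd (single (x # xs) g) = single xs g"
  unfolding bd_def by (simp_all add: linear_extension_single split: list.split)

lemmas bd_zero [simp] = additive_imp_zero[of bd, OF bd_add]
  and bd_uminus = additive_imp_uminus[of bd, OF bd_add]
  and bd_diff = additive_imp_diff[of bd, OF bd_add]
  and bd_sum = additive_imp_sum[of bd, OF bd_add]

lemma bd_eq_push_tl: "[] \<notin> keys c \<Longrightarrow> bd c = push tl c"
  unfolding bd_def push_def linear_extension_def
  by (rule sum.cong) (auto split: list.split)

lemma bd_push_map:
  fixes f :: "'a \<Rightarrow> 'c" and c :: "'a list \<Rightarrow>\<^sub>0 'b::ab_group_add"
  shows "bd (push (map f) c) = push (map f) (bd c)"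
proof (rule additive_eqI[where c = c])
  fix x :: "'a list" and g :: 'b
  show "bd (push (map f) (single x g)) = push (map f) (bd (single x g))" by (cases x) simp_all
qed (simp_all add: push_add bd_add)

text \<open>Inserts b at every position, with alternating signs. Prefixing b alone would destroy
  antisymmetry; the signed sum of insertions is the cone over an oriented simplex written out for
  alternating chains.\<close>

primrec cone_list :: "'a \<Rightarrow> 'a list \<Rightarrow> 'g::ab_group_add \<Rightarrow> ('a list \<Rightarrow>\<^sub>0 'g)" where
  "cone_list b [] g = single [b] g"
| "cone_list b (x # xs) g = single (b # x # xs) g - push (Cons x) (cone_list b xs g)"

definition chain_cone :: "'a \<Rightarrow> ('a list \<Rightarrow>\<^sub>0 'g::ab_group_add) \<Rightarrow> ('a list \<Rightarrow>\<^sub>0 'g)" where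
  "chain_cone b = linear_extension (cone_list b)"

lemma cone_list_add: "cone_list b xs (g + h) = cone_list b xs g + cone_list b xs h"
  by (induction xs) (simp_all add: single_add push_add)

lemma cone_add: "chain_cone b (c + d) = chain_cone b c + chain_cone b d"
  unfolding chain_cone_def by (rule linear_extension_add) (rule cone_list_add)

lemmas cone_zero [simp] = additive_imp_zero[of "chain_cone b" for b, OF cone_add]
  and cone_uminus = additive_imp_uminus[of "chain_cone b" for b, OF cone_add]
  and cone_diff = additive_imp_diff[of "chain_cone b" for b, OF cone_add]

lemma cone_list_zero [simp]: "cone_list b xs 0 = 0"
  by (rule additive_imp_zero) (rule cone_list_add)

lemma cone_single [simp]: "chain_cone b (single xs g) = cone_list b xs g"
  unfolding chain_cone_def by (simp add: linear_extension_single)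

lemma bd_push_Cons: "bd (push (Cons x) c) = c"
  by (rule additive_eqI[where c = c]) (simp_all add: push_add bd_add)

text \<open>Dropping the head removes b from the first insertion and an old vertex from all others;
  the latter terms form minus the cone over the boundary. As the boundary is augmented, this also
  covers a single vertex and the empty list, so the cone over a cycle fills it in every
  degree.\<close>

lemma bd_cone: "bd (chain_cone b c) = c - chain_cone b (bd c)"
proof (rule additive_eqI[where c = c])
  fix xs :: "'a list" and g :: 'b
  show "bd (chain_cone b (single xs g)) = single xs g - chain_cone b (bd (single xs g))"
    by (cases xs) (simp_all add: bd_diff bd_push_Cons)
qed (simp_all add: cone_add bd_add)

section \<open>Restricting a chain to some of its simplices\<close>

definition filter_chain :: "('x \<Rightarrow> bool) \<Rightarrow> ('x \<Rightarrow>\<^sub>0 'g::ab_group_add) \<Rightarrow> ('x \<Rightarrow>\<^sub>0 'g)" where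
  "filter_chain P = linear_extension (\<lambda>x g. if P x then single x g else 0)"

lemma filter_chain_add: "filter_chain P (a + b) = filter_chain P a + filter_chain P b"
  unfolding filter_chain_def by (rule linear_extension_add) (simp add: single_add)

lemma lookup_filter_chain: "lookup (filter_chain P c) x = (if P x then lookup c x else 0)"
proof -
  have "lookup (filter_chain P c) x = (\<Sum>y\<in>keys c. if y = x then (if P x then lookup c x else 0) else 0)"
    unfolding filter_chain_def linear_extension_def lookup_sum
    by (rule sum.cong) (simp_all add: lookup_single when_def)
  then show ?thesis by (simp add: in_keys_iff)
qed

lemma keys_filter_chain: "keys (filter_chain P c) = {x \<in> keys c. P x}"
  by (simp add: set_eq_iff in_keys_iff lookup_filter_chain)

text \<open>For an alternating chain on lists of length \<open>card S\<close> this is one oriented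
  simplex with a coefficient. Constructions that proceed simplex by simplex are applied to these
  components.\<close>

definition part :: "'a set \<Rightarrow> ('a list \<Rightarrow>\<^sub>0 'g::ab_group_add) \<Rightarrow> ('a list \<Rightarrow>\<^sub>0 'g)" where
  "part S = filter_chain (\<lambda>xs. set xs = S)"

lemma part_add: "part S (a + b) = part S a + part S b"
  unfolding part_def by (rule filter_chain_add)

lemma lookup_part: "lookup (part S c) xs = (if set xs = S then lookup c xs else 0)"
  unfolding part_def by (rule lookup_filter_chain)

lemma sum_part:
  assumes "finite \<S>" "set ` keys c \<subseteq> \<S>"
  shows "(\<Sum>S\<in>\<S>. part S c) = c"
  by (rule poly_mapping_eqI)
     (use assms in \<open>auto simp: lookup_sum lookup_part in_keys_iff image_subset_iff sum.delta\<close>)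

section \<open>Antisymmetry under adjacent transpositions\<close>

primrec swap_at :: "nat \<Rightarrow> 'a list \<Rightarrow> 'a list" where
  "swap_at n [] = []"
| "swap_at n (x # xs) = (case n of 0 \<Rightarrow> (case xs of [] \<Rightarrow> [x] | y # ys \<Rightarrow> y # x # ys)
                                 | Suc m \<Rightarrow> x # swap_at m xs)"

lemma length_swap_at [simp]: "length (swap_at n xs) = length xs"
  by (induction xs arbitrary: n) (auto split: nat.split list.split)

lemma set_swap_at [simp]: "set (swap_at n xs) = set xs"
  by (induction xs arbitrary: n) (auto split: nat.split list.split)

lemma swap_at_swap_at [simp]: "swap_at n (swap_at n xs) = xs"
  by (induction xs arbitrary: n) (auto split: nat.split list.split)

lemma map_swap_at: "map f (swap_at n xs) = swap_at n (map f xs)"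
  by (induction xs arbitrary: n) (auto split: nat.split list.split)

lemma swap_at_append: "swap_at (length P) (P @ x # y # Q) = P @ y # x # Q"
  by (induction P) auto

text \<open>Adjacent transpositions generate all permutations, so they suffice for the sign rule.
  Distinctness is demanded separately: for a repeated entry the sign rule only yields g = - g, which
  does not force g = 0 in a group with 2-torsion.\<close>

definition alt :: "('a list \<Rightarrow>\<^sub>0 'g::ab_group_add) \<Rightarrow> bool" where
  "alt c \<longleftrightarrow> (\<forall>n xs. Suc n < length xs \<longrightarrow> lookup c (swap_at n xs) = - lookup c xs)
     \<and> (\<forall>xs\<in>keys c. distinct xs)"

lemma alt_swapD: "alt c \<Longrightarrow> Suc n < length xs \<Longrightarrow> lookup c (swap_at n xs) = - lookup c xs"
  and alt_distinctD: "alt c \<Longrightarrow> xs \<in> keys c \<Longrightarrow> distinct xs"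
  unfolding alt_def by blast+

lemma alt_add: "alt a \<Longrightarrow> alt b \<Longrightarrow> alt (a + b)"
  using keys_add[of a b] by (auto simp: alt_def lookup_add)

lemma alt_uminus: "alt a \<Longrightarrow> alt (- a)"
  by (auto simp: alt_def keys_minus)

lemma alt_zero [simp]: "alt 0"
  by (simp add: alt_def)

text \<open>The terms are removed in pairs x, t x. Comparing the sum with its negative would only
  show that twice the sum vanishes, which is too weak in the presence of 2-torsion.\<close>

lemma sum_involution_zero:
  fixes c :: "'x \<Rightarrow> 'g::ab_group_add"
  assumes "finite A" "\<And>x. x \<in> A \<Longrightarrow> t x \<in> A" "\<And>x. x \<in> A \<Longrightarrow> t (t x) = x"
    "\<And>x. x \<in> A \<Longrightarrow> t x \<noteq> x" "\<And>x. x \<in> A \<Longrightarrow> c (t x) = - c x"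
  shows "sum c A = 0"
  using assms
proof (induction "card A" arbitrary: A rule: less_induct)
  case less
  show ?case
  proof (cases "A = {}")
    case False
    then obtain x where x: "x \<in> A" by blast
    let ?B = "A - {x, t x}"
    have "sum c ?B = 0"
    proof (rule less.hyps)
      show "card ?B < card A" using x less.prems(1) by (intro psubset_card_mono) auto
      show "t y \<in> ?B" if "y \<in> ?B" for y
        using that less.prems(2,3) x by (metis Diff_iff insert_iff empty_iff)
    qed (use less.prems in auto)
    moreover have "sum c A = c x + (c (t x) + sum c ?B)"
      using x less.prems by (simp add: sum.remove[of A x] sum.remove[of "A - {x}" "t x"] Diff_insert2[symmetric] insert_commute)
    ultimately show ?thesis using x less.prems by simp
  qed simp
qed

text \<open>The involution \<tau> covers \<tau>' and therefore exchanges the fibres of h over y and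
  over \<tau>' y. The index set of the sum is enlarged so as to be stable under \<tau>.\<close>

lemma lookup_push_sign:
  assumes "\<And>x. \<tau> (\<tau> x) = x" "\<And>x. h (\<tau> x) = \<tau>' (h x)" "\<tau>' (\<tau>' y) = y"
    and "\<And>x. h x = y \<Longrightarrow> lookup c (\<tau> x) = - lookup c x"
  shows "lookup (push h c) (\<tau>' y) = - lookup (push h c) y"
proof -
  let ?A = "keys c \<union> \<tau> ` keys c"
  have A: "finite ?A" "keys c \<subseteq> ?A" by auto
  have "(\<Sum>x\<in>?A. if h x = \<tau>' y then lookup c x else 0) = (\<Sum>x\<in>?A. - (if h x = y then lookup c x else 0))"
  proof (rule sum.reindex_bij_witness[where i = \<tau> and j = \<tau>])
    fix x assume "x \<in> ?A"
    have "h (\<tau> x) = y \<longleftrightarrow> h x = \<tau>' y" using assms(1-3) by metis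
    moreover have "lookup c x = - lookup c (\<tau> x)" if "h (\<tau> x) = y"
      using assms(4)[OF that] assms(1) by simp
    ultimately show "- (if h (\<tau> x) = y then lookup c (\<tau> x) else 0) = (if h x = \<tau>' y then lookup c x else 0)"
      by simp
  qed (use assms(1) in \<open>auto simp: image_iff\<close>)
  then show ?thesis unfolding lookup_push[OF A] by (simp add: sum_negf)
qed

text \<open>Here \<tau> preserves the fibre over y and moves all generators of c in it, so their
  coefficients cancel in pairs.\<close>

lemma lookup_push_zero:
  assumes "\<And>x. \<tau> (\<tau> x) = x" "\<And>x. h x = y \<Longrightarrow> h (\<tau> x) = y"
    and "\<And>x. h x = y \<Longrightarrow> x \<in> keys c \<Longrightarrow> \<tau> x \<noteq> x"
    and "\<And>x. h x = y \<Longrightarrow> lookup c (\<tau> x) = - lookup c x"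
  shows "lookup (push h c) y = 0"
proof -
  have "lookup (push h c) y = (\<Sum>x\<in>{x\<in>keys c. h x = y}. lookup c x)"
    unfolding lookup_push[OF finite_keys subset_refl] by (rule sum.inter_filter[symmetric]) simp
  also have "\<dots> = 0"
    by (rule sum_involution_zero[where t = \<tau>]) (use assms in \<open>auto simp: in_keys_iff\<close>)
  finally show ?thesis .
qed

text \<open>Moving the second of two equal entries next to the first one only changes the sign.\<close>

lemma lookup_not_distinct_zero:
  assumes sw: "\<And>n xs. Suc n < length xs \<Longrightarrow> lookup c (swap_at n xs) = - lookup c xs"
    and adj: "\<And>P y Q. lookup c (P @ y # y # Q) = (0::'g::ab_group_add)"
    and "\<not> distinct xs"
  shows "lookup c xs = 0"
proof -
  obtain P B Q y where xs: "xs = P @ [y] @ B @ [y] @ Q"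
    using not_distinct_decomp[OF assms(3)] by blast
  have "lookup c (P @ y # B @ y # Q) = 0" for B Q
  proof (induction B arbitrary: Q rule: rev_induct)
    case Nil
    then show ?case using adj by simp
  next
    case (snoc b B)
    have "lookup c (swap_at (length (P @ y # B)) ((P @ y # B) @ y # b # Q)) = - lookup c ((P @ y # B) @ y # b # Q)"
      by (rule sw) simp
    then show ?case unfolding swap_at_append using snoc by simp
  qed
  then show ?thesis unfolding xs by simp
qed

text \<open>Only degenerate images need an argument: if f identifies two neighbouring entries,
  exchanging them stays in the fibre, moves the distinct list and changes the sign. Equal entries
  further apart are brought together by \<open>lookup_not_distinct_zero\<close>.\<close>

lemma alt_push_map:
  assumes "alt c"
  shows "alt (push (map f) c)"
proof -
  have sw: "lookup (push (map f) c) (swap_at n xs) = - lookup (push (map f) c) xs" if "Suc n < length xs" for n xs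
    by (rule lookup_push_sign[where \<tau> = "swap_at n"])
       (use that assms in \<open>auto simp: map_swap_at intro: alt_swapD\<close>)
  have adj: "lookup (push (map f) c) (P @ y # y # Q) = 0" for P y Q
  proof (rule lookup_push_zero[where \<tau> = "swap_at (length P)"])
    fix xs assume xs: "map f xs = P @ y # y # Q"
    then have "length xs = length (P @ y # y # Q)" by (metis length_map)
    then show "lookup c (swap_at (length P) xs) = - lookup c xs"
      by (intro alt_swapD[OF assms]) simp
    show "map f (swap_at (length P) xs) = P @ y # y # Q"
      by (simp add: map_swap_at xs swap_at_append)
    assume "xs \<in> keys c"
    then have "distinct xs" using alt_distinctD[OF assms] by blast
    moreover obtain P' a b Q' where "xs = P' @ a # b # Q'" "length P' = length P"
      using xs by (auto simp: map_eq_append_conv map_eq_Cons_conv)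
    ultimately show "swap_at (length P) xs \<noteq> xs"
      by (metis swap_at_append append_same_eq same_append_eq distinct_append distinct.simps(2) list.inject list.set_intros(1))
  qed simp
  show ?thesis unfolding alt_def
    using sw lookup_not_distinct_zero[of "push (map f) c", OF sw adj] by (auto simp: in_keys_iff)
qed

text \<open>The hypothesis on keys excludes the junk case that \<open>bd\<close> forgets chains on the empty list.\<close>

lemma alt_bd:
  assumes "alt c" "[] \<notin> keys c"
  shows "alt (bd c)"
proof -
  have eq: "lookup (bd c) ys = lookup (push tl (filter_chain (\<lambda>xs. xs \<noteq> []) c)) ys" for ys
  proof -
    have "filter_chain (\<lambda>xs. xs \<noteq> []) c = c"
      by (rule poly_mapping_eqI) (use assms(2) in \<open>auto simp: lookup_filter_chain in_keys_iff\<close>)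
    then show ?thesis by (simp add: bd_eq_push_tl assms(2))
  qed
  define sw where "sw n xs = (case xs of [] \<Rightarrow> [] | x # ys \<Rightarrow> x # swap_at n ys)" for n and xs :: "'a list"
  have [simp]: "sw n (sw n xs) = xs" "tl (sw n xs) = swap_at n (tl xs)" for n xs
    by (auto simp: sw_def split: list.split)
  have "lookup (bd c) (swap_at n xs) = - lookup (bd c) xs" if "Suc n < length xs" for n xs
    unfolding eq
  proof (rule lookup_push_sign[where \<tau> = "sw n"])
    fix ys assume ys: "tl ys = xs"
    with that obtain y where y: "ys = y # xs" by (cases ys) auto
    then have "sw n ys = swap_at (Suc n) ys" by (simp add: sw_def)
    then show "lookup (filter_chain (\<lambda>xs. xs \<noteq> []) c) (sw n ys) = - lookup (filter_chain (\<lambda>xs. xs \<noteq> []) c) ys"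
      using y that alt_swapD[OF assms(1), of "Suc n" ys] by (auto simp: lookup_filter_chain)
  qed auto
  moreover have "distinct ys" if "ys \<in> keys (bd c)" for ys
    using that keys_push_subset[where h = tl and c = c] alt_distinctD[OF assms(1)] distinct_tl
    by (auto simp: bd_eq_push_tl[OF assms(2)])
  ultimately show ?thesis unfolding alt_def by blast
qed


text \<open>The cone seen from the target: the coefficient at a list is a signed sum over the
  occurrences of b in it, each time evaluating f on the list with that occurrence deleted.
  Antisymmetry of cones is an induction in this form, with f arbitrary so that a prefix can be
  absorbed.\<close>

primrec coefficient_cone :: "'a \<Rightarrow> 'a list \<Rightarrow> ('a list \<Rightarrow> 'g::ab_group_add) \<Rightarrow> 'g" where
  "coefficient_cone b [] f = 0"
| "coefficient_cone b (z # zs) f = (if z = b then f zs else 0) - coefficient_cone b zs (\<lambda>ys. f (z # ys))"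

lemma coefficient_cone_add:
  "coefficient_cone b zs (\<lambda>ys. f ys + h ys) = coefficient_cone b zs f + coefficient_cone b zs h"
  by (induction zs arbitrary: f h) auto

lemma coefficient_cone_zero [simp]: "coefficient_cone b zs (\<lambda>ys. 0) = 0"
  by (induction zs) auto

lemma coefficient_cone_uminus:
  "coefficient_cone b zs (\<lambda>ys. - f ys) = - coefficient_cone b zs f"
  by (induction zs arbitrary: f) auto

lemma lookup_push_Cons: "lookup (push (Cons x) c) zs = (case zs of [] \<Rightarrow> 0 | z # ys \<Rightarrow> if z = x then lookup c ys else 0)"
proof -
  have "lookup (push (Cons x) c) zs = (\<Sum>ys\<in>keys c. if x # ys = zs then lookup c ys else 0)"
    by (rule lookup_push) auto
  also have "\<dots> = (case zs of [] \<Rightarrow> 0 | z # ys \<Rightarrow> if z = x then lookup c ys else 0)"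
    by (cases zs) (auto simp: in_keys_iff)
  finally show ?thesis .
qed

lemma lookup_cone_list: "lookup (cone_list b xs g) zs = coefficient_cone b zs (lookup (single xs g))"
proof (induction zs arbitrary: xs)
  case Nil
  then show ?case by (cases xs) (auto simp: lookup_minus lookup_push_Cons lookup_single)
next
  case (Cons z zs)
  show ?case
  proof (cases xs)
    case Nil
    then show ?thesis by (auto simp: lookup_single when_def)
  next
    case (Cons x xs')
    have "(\<lambda>ys. lookup (single (x # xs') g) (z # ys)) = (\<lambda>ys. if z = x then lookup (single xs' g) ys else 0)"
      by (auto simp: lookup_single when_def)
    then have "coefficient_cone b zs (\<lambda>ys. lookup (single (x # xs') g) (z # ys)) =
      (if z = x then lookup (cone_list b xs' g) zs else 0)"
      by (simp add: Cons.IH)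
    then show ?thesis using Cons by (auto simp: lookup_minus lookup_push_Cons lookup_single when_def)
  qed
qed

lemma lookup_cone:
  fixes c :: "'a list \<Rightarrow>\<^sub>0 'b::ab_group_add"
  shows "lookup (chain_cone b c) zs = coefficient_cone b zs (lookup c)"
proof (rule additive_eqI[where c = c])
  show "coefficient_cone b zs (lookup (c + d)) = coefficient_cone b zs (lookup c) + coefficient_cone b zs (lookup d)"
    for c d :: "'a list \<Rightarrow>\<^sub>0 'b"
    using coefficient_cone_add[of b zs "lookup c" "lookup d"] by (simp add: lookup_add[abs_def])
qed (simp_all add: cone_add lookup_add lookup_cone_list)

lemma coefficient_cone_swap:
  assumes "\<And>P x y Q. f (P @ x # y # Q) = - f (P @ y # x # Q)"
  shows "coefficient_cone b (P @ x # y # Q) f = - coefficient_cone b (P @ y # x # Q) f"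
  using assms
proof (induction P arbitrary: f)
  case Nil
  have "(\<lambda>ys. f (x # y # ys)) = (\<lambda>ys. - f (y # x # ys))"
    using Nil[of "[]" x y] by (intro ext) simp
  then show ?case by (simp add: coefficient_cone_uminus)
next
  case (Cons a P)
  have "coefficient_cone b (P @ x # y # Q) (\<lambda>ys. f (a # ys)) = - coefficient_cone b (P @ y # x # Q) (\<lambda>ys. f (a # ys))"
  proof (rule Cons.IH)
    show "f (a # P @ x # y # Q) = - f (a # P @ y # x # Q)" for P x y Q
      using Cons.prems[of "a # P" x y Q] by simp
  qed
  then show ?case using Cons.prems[of P x y Q] by simp
qed

lemma coefficient_cone_repeated:
  assumes "\<And>P y Q. f (P @ y # y # Q) = 0"
  shows "coefficient_cone b (P @ y # y # Q) f = 0"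
  using assms
proof (induction P arbitrary: f)
  case Nil
  have "(\<lambda>ys. f (y # y # ys)) = (\<lambda>ys. 0)"
    using Nil[of "[]" y] by simp
  then show ?case by simp
next
  case (Cons a P)
  have "coefficient_cone b (P @ y # y # Q) (\<lambda>ys. f (a # ys)) = 0"
  proof (rule Cons.IH)
    show "f (a # P @ y # y # Q) = 0" for P y Q
      using Cons.prems[of "a # P" y Q] by simp
  qed
  then show ?case using Cons.prems[of P y Q] by simp
qed

lemma ex_split_at:
  assumes "Suc n < length xs"
  obtains P x y Q where "xs = P @ x # y # Q" "length P = n"
proof
  show "xs = take n xs @ xs ! n # xs ! Suc n # drop (Suc (Suc n)) xs"
    using assms by (metis Cons_nth_drop_Suc Suc_lessD id_take_nth_drop)
qed (use assms in simp)

lemma alt_cone: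
  assumes "alt c"
  shows "alt (chain_cone b c)"
proof -
  have f: "lookup c (P @ x # y # Q) = - lookup c (P @ y # x # Q)" for P x y Q
    using alt_swapD[OF assms, of "length P" "P @ y # x # Q"] by (simp add: swap_at_append)
  have z: "lookup c (P @ y # y # Q) = 0" for P y Q
    using alt_distinctD[OF assms, of "P @ y # y # Q"] by (auto simp: in_keys_iff)
  have sw: "lookup (chain_cone b c) (swap_at n xs) = - lookup (chain_cone b c) xs" if n: "Suc n < length xs" for n xs
  proof -
    obtain P x y Q where xs: "xs = P @ x # y # Q" "length P = n"
      using ex_split_at[OF n] .
    show ?thesis
      using coefficient_cone_swap[of "lookup c" b P y x Q, OF f] unfolding xs(1) xs(2)[symmetric] swap_at_append lookup_cone .
  qed
  have adj: "lookup (chain_cone b c) (P @ y # y # Q) = 0" for P y Q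
    unfolding lookup_cone by (rule coefficient_cone_repeated) (rule z)
  show ?thesis unfolding alt_def
    using sw lookup_not_distinct_zero[of "chain_cone b c", OF sw adj] by (auto simp: in_keys_iff)
qed

lemma keys_cone_list:
  assumes "zs \<in> keys (cone_list b xs g)"
  shows "length zs = Suc (length xs) \<and> set zs = insert b (set xs)"
  using assms
proof (induction xs arbitrary: zs)
  case (Cons x xs)
  have "lookup (single (b # x # xs) g) zs \<noteq> 0 \<or> lookup (push (Cons x) (cone_list b xs g)) zs \<noteq> 0"
    using Cons.prems by (auto simp: in_keys_iff lookup_minus)
  then show ?case
  proof
    assume "lookup (single (b # x # xs) g) zs \<noteq> 0"
    then have "zs = b # x # xs" by (auto simp: lookup_single when_def split: if_splits)
    then show ?thesis by simp
  next
    assume "lookup (push (Cons x) (cone_list b xs g)) zs \<noteq> 0"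
    then obtain ys where "zs = x # ys" "ys \<in> keys (cone_list b xs g)"
      using keys_push_subset[where h = "Cons x" and c = "cone_list b xs g"]
      unfolding in_keys_iff[symmetric] by blast
    then show ?thesis using Cons.IH[of ys] by auto
  qed
qed (auto split: if_splits)

lemma keys_cone:
  assumes "zs \<in> keys (chain_cone b c)"
  obtains xs where "xs \<in> keys c" "length zs = Suc (length xs)" "set zs = insert b (set xs)"
proof -
  have "zs \<in> (\<Union>xs\<in>keys c. keys (cone_list b xs (lookup c xs)))"
    using assms keys_sum_subset unfolding chain_cone_def linear_extension_def by (rule set_rev_mp)
  then obtain xs where xs: "xs \<in> keys c" "zs \<in> keys (cone_list b xs (lookup c xs))" by (rule UN_E)
  show ?thesis using that[OF xs(1)] keys_cone_list[OF xs(2)] by blast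
qed

lemma alt_part: "alt c \<Longrightarrow> alt (part S c)"
  by (auto simp: alt_def part_def lookup_filter_chain keys_filter_chain)

text \<open>The index counts vertices. Degree 0 is the augmentation: its chains live on the empty
  list and can be nonzero only if K contains the empty set.\<close>

definition alt_chains :: "nat \<Rightarrow> 'a set set \<Rightarrow> ('a list \<Rightarrow>\<^sub>0 'g::ab_group_add) set" where
  "alt_chains n K = {c. alt c \<and> (\<forall>xs\<in>keys c. length xs = n \<and> set xs \<in> K)}"

lemma alt_chains_mono: "K \<subseteq> L \<Longrightarrow> alt_chains n K \<subseteq> alt_chains n L"
  by (auto simp: alt_chains_def)

lemma alt_chains_zero [simp]: "0 \<in> alt_chains n K"
  by (simp add: alt_chains_def)

lemma alt_chains_add: "a \<in> alt_chains n K \<Longrightarrow> b \<in> alt_chains n K \<Longrightarrow> a + b \<in> alt_chains n K"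
  using keys_add[of a b] by (auto simp: alt_chains_def intro: alt_add)

lemma alt_chains_uminus: "a \<in> alt_chains n K \<Longrightarrow> - a \<in> alt_chains n K"
  by (auto simp: alt_chains_def keys_minus intro: alt_uminus)

lemma alt_chains_diff: "a \<in> alt_chains n K \<Longrightarrow> b \<in> alt_chains n K \<Longrightarrow> a - b \<in> alt_chains n K"
  using alt_chains_add[of a n K "- b"] alt_chains_uminus[of b n K] by simp

lemma alt_chains_sum: "(\<And>x. x \<in> A \<Longrightarrow> f x \<in> alt_chains n K) \<Longrightarrow> sum f A \<in> alt_chains n K"
  by (induction A rule: infinite_finite_induct) (auto intro: alt_chains_add)

lemma alt_chains_bd:
  assumes "c \<in> alt_chains (Suc n) K" "\<And>S T. S \<in> K \<Longrightarrow> T \<subseteq> S \<Longrightarrow> T \<in> K"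
  shows "bd c \<in> alt_chains n K"
proof -
  have N: "[] \<notin> keys c" using assms(1) by (auto simp: alt_chains_def)
  have "length ys = n \<and> set ys \<in> K" if ys: "ys \<in> keys (bd c)" for ys
  proof -
    obtain xs where "xs \<in> keys c" "ys = tl xs"
      using ys keys_push_subset[where h = tl and c = c] by (auto simp: bd_eq_push_tl[OF N])
    moreover from this(1) have "length xs = Suc n" "set xs \<in> K"
      using assms(1) by (auto simp: alt_chains_def)
    ultimately show ?thesis using assms(2)[of "set xs" "set ys"] by (cases xs) auto
  qed
  moreover have "alt (bd c)" using assms(1) N by (auto simp: alt_chains_def intro: alt_bd)
  ultimately show ?thesis by (simp add: alt_chains_def)
qed

lemma alt_chains_bd_zero: "c \<in> alt_chains 0 K \<Longrightarrow> bd c = 0"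
  unfolding bd_def linear_extension_def
  by (rule sum.neutral) (auto simp: alt_chains_def split: list.split)

text \<open>Two boundaries drop the first two entries, and exchanging these is a sign changing
  involution without fixed points on each fibre. With fewer than two entries nothing is left after
  two boundaries.\<close>

lemma bd_bd:
  assumes "c \<in> alt_chains n K"
  shows "bd (bd c) = 0"
proof (cases n)
  case 0
  then have "bd c = 0" using assms by (intro alt_chains_bd_zero[of c K]) simp
  then show ?thesis by simp
next
  case (Suc m)
  show ?thesis
  proof (cases m)
    case 0
    then have "c \<in> alt_chains (Suc 0) UNIV" using assms Suc by (auto simp: alt_chains_def)
    then have "bd c \<in> alt_chains 0 UNIV" by (rule alt_chains_bd) auto
    then show ?thesis by (rule alt_chains_bd_zero)
  next
    case (Suc l)
    have len: "length xs = Suc (Suc l)" if "xs \<in> keys c" for xs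
      using that assms Suc \<open>n = Suc m\<close> by (auto simp: alt_chains_def)
    have N: "[] \<notin> keys c" using len[of "[]"] by auto
    have N': "[] \<notin> keys (push tl c)"
    proof
      assume "[] \<in> keys (push tl c)"
      then obtain xs where "xs \<in> keys c" "[] = tl xs"
        using keys_push_subset[where h = tl and c = c] by blast
      then show False using len[of xs] by (cases xs) auto
    qed
    have alt: "alt c" using assms by (simp add: alt_chains_def)
    have "bd (bd c) = push (\<lambda>xs. tl (tl xs)) c"
      using N N' by (simp add: bd_eq_push_tl push_push)
    also have "\<dots> = 0"
    proof (rule poly_mapping_eqI)
      fix ys :: "'a list"
      define t where "t xs = (if length xs = Suc (Suc l) then swap_at 0 xs else xs)" for xs :: "'a list"
      have nz: "lookup c xs = 0" if "length xs \<noteq> Suc (Suc l)" for xs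
        using len that by (auto simp: in_keys_iff)
      have "lookup (push (\<lambda>xs. tl (tl xs)) c) ys = 0"
      proof (rule lookup_push_zero[where \<tau> = t])
        show "t xs \<noteq> xs" if "xs \<in> keys c" for xs
          using len[OF that] alt_distinctD[OF alt that] by (auto simp: t_def length_Suc_conv)
        show "lookup c (t xs) = - lookup c xs" for xs
          using alt_swapD[OF alt, of 0 xs] nz by (auto simp: t_def)
        show "tl (tl (t xs)) = ys" if "tl (tl xs) = ys" for xs
          using that by (auto simp: t_def length_Suc_conv)
      qed (auto simp: t_def)
      then show "lookup (push (\<lambda>xs. tl (tl xs)) c) ys = lookup 0 ys" by simp
    qed
    finally show ?thesis .
  qed
qed

lemma alt_chains_push:
  assumes "c \<in> alt_chains n K" "\<And>S. S \<in> K \<Longrightarrow> f ` S \<in> L"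
  shows "push (map f) c \<in> alt_chains n L"
  using assms keys_push_subset[where h = "map f" and c = c]
  by (auto simp: alt_chains_def intro: alt_push_map)

lemma alt_chains_cone:
  assumes "c \<in> alt_chains n K" "\<And>S. S \<in> K \<Longrightarrow> insert b S \<in> L"
  shows "chain_cone b c \<in> alt_chains (Suc n) L"
  using assms by (auto simp: alt_chains_def intro: alt_cone elim!: keys_cone)

lemma alt_chains_part:
  assumes "c \<in> alt_chains n K"
  shows "part S c \<in> alt_chains n {T \<in> K. T = S}"
  using assms by (auto simp: alt_chains_def part_def keys_filter_chain alt_part[unfolded part_def])

text \<open>Entries of an alternating chain are distinct, so each list uses a simplex with exactly n
  vertices. This is what finally kills cycles: after rounding to a polygon the simplices have at
  most two vertices, while n is at least 3.\<close>

lemma alt_chains_eq_zero: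
  assumes "c \<in> alt_chains n K" "\<And>S. S \<in> K \<Longrightarrow> card S \<noteq> n"
  shows "c = 0"
proof -
  have "xs \<notin> keys c" for xs
    using assms distinct_card[of xs] by (auto simp: alt_chains_def dest: alt_distinctD)
  then show ?thesis by (simp add: poly_mapping_eqI in_keys_iff)
qed


section \<open>Acyclic carriers\<close>

text \<open>Induction over skeleta as a recursion: on each simplex S of the chain, F extends over S
  what has already been built on the boundary of the component at S. Chain homotopies and
  subdivisions are both instances; B prescribes the value on the empty simplex.\<close>

primrec glue :: "(nat \<Rightarrow> 'a set \<Rightarrow> ('a list \<Rightarrow>\<^sub>0 'g::ab_group_add) \<Rightarrow> 'd \<Rightarrow> 'd::ab_group_add)
    \<Rightarrow> (('a list \<Rightarrow>\<^sub>0 'g) \<Rightarrow> 'd) \<Rightarrow> nat \<Rightarrow> ('a list \<Rightarrow>\<^sub>0 'g) \<Rightarrow> 'd" where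
  "glue F B 0 c = B c"
| "glue F B (Suc n) c = (\<Sum>S\<in>set ` keys c. F n S (part S c) (glue F B n (bd (part S c))))"

lemma part_eq_zero: "S \<notin> set ` keys c \<Longrightarrow> part S c = 0"
  by (rule poly_mapping_eqI) (auto simp: lookup_part in_keys_iff image_iff)

lemma glue_add:
  assumes F: "\<And>n S a a' b b'. F n S (a + a') (b + b') = F n S a b + F n S a' b'"
    and B: "\<And>a b. B (a + b) = B a + B b"
  shows "glue F B n (c + d) = glue F B n c + glue F B n d"
proof (induction n arbitrary: c d)
  case (Suc n)
  have F0: "F n S 0 0 = 0" for S using F[of n S 0 0 0 0] by simp
  have z: "glue F B n 0 = 0" using Suc[of 0 0] by simp
  let ?A = "set ` keys c \<union> set ` keys d"
  have *: "glue F B (Suc n) e = (\<Sum>S\<in>?A. F n S (part S e) (glue F B n (bd (part S e))))"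
    if "keys e \<subseteq> keys c \<union> keys d" for e
    unfolding glue.simps
    by (rule sum.mono_neutral_left) (use that in \<open>auto simp: part_eq_zero z F0\<close>)
  have "glue F B (Suc n) (c + d) = (\<Sum>S\<in>?A. F n S (part S (c + d)) (glue F B n (bd (part S (c + d)))))"
    by (rule *) (rule keys_add)
  also have "\<dots> = (\<Sum>S\<in>?A. F n S (part S c) (glue F B n (bd (part S c)))
      + F n S (part S d) (glue F B n (bd (part S d))))"
    by (simp only: part_add bd_add Suc F)
  also have "\<dots> = glue F B (Suc n) c + glue F B (Suc n) d"
    by (simp only: sum.distrib *[of c] *[of d] Un_upper1 Un_upper2)
  finally show ?case .
qed (simp add: B)

lemma alt_chains_part_Pow: "c \<in> alt_chains n K \<Longrightarrow> part S c \<in> alt_chains n (Pow S)"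
  by (rule subsetD[OF alt_chains_mono alt_chains_part]) auto

lemma alt_chains_bd_Pow: "c \<in> alt_chains (Suc n) (Pow S) \<Longrightarrow> bd c \<in> alt_chains n (Pow S)"
  by (rule alt_chains_bd) auto

lemma in_set_keys_alt_chains:
  assumes "c \<in> alt_chains n K" "S \<in> set ` keys c"
  shows "S \<in> K" "0 < n \<Longrightarrow> S \<noteq> {}" "finite S"
  using assms by (auto simp: alt_chains_def)

text \<open>The acyclic carrier theorem in its simplest form: the carrier of S is the full simplex
  on \<open>Car S\<close>, contracted by coning from its vertex \<open>p S\<close>.
  \<open>start\<close> says that both chain maps treat the augmentation in the same way.\<close>

locale carried_maps =
  fixes \<Theta>\<^sub>1 \<Theta>\<^sub>2 :: "nat \<Rightarrow> ('a list \<Rightarrow>\<^sub>0 'g::ab_group_add) \<Rightarrow> ('b list \<Rightarrow>\<^sub>0 'g)"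
    and K :: "'a set set" and Car :: "'a set \<Rightarrow> 'b set" and p :: "'a set \<Rightarrow> 'b"
  assumes add1: "\<Theta>\<^sub>1 n (a + b) = \<Theta>\<^sub>1 n a + \<Theta>\<^sub>1 n b"
    and add2: "\<Theta>\<^sub>2 n (a + b) = \<Theta>\<^sub>2 n a + \<Theta>\<^sub>2 n b"
    and bd1: "c \<in> alt_chains (Suc n) K \<Longrightarrow> bd (\<Theta>\<^sub>1 (Suc n) c) = \<Theta>\<^sub>1 n (bd c)"
    and bd2: "c \<in> alt_chains (Suc n) K \<Longrightarrow> bd (\<Theta>\<^sub>2 (Suc n) c) = \<Theta>\<^sub>2 n (bd c)"
    and start: "c \<in> alt_chains 0 K \<Longrightarrow> \<Theta>\<^sub>1 0 c = \<Theta>\<^sub>2 0 c"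
    and carried1: "S \<in> K \<Longrightarrow> c \<in> alt_chains n (Pow S) \<Longrightarrow> \<Theta>\<^sub>1 n c \<in> alt_chains n (Pow (Car S))"
    and carried2: "S \<in> K \<Longrightarrow> c \<in> alt_chains n (Pow S) \<Longrightarrow> \<Theta>\<^sub>2 n c \<in> alt_chains n (Pow (Car S))"
    and down: "S \<in> K \<Longrightarrow> T \<subseteq> S \<Longrightarrow> T \<in> K"
    and Car_mono: "S \<in> K \<Longrightarrow> T \<subseteq> S \<Longrightarrow> Car T \<subseteq> Car S"
    and apex: "S \<in> K \<Longrightarrow> S \<noteq> {} \<Longrightarrow> p S \<in> Car S"
begin

text \<open>On each simplex, \<open>\<Theta>\<^sub>1\<close> - \<open>\<Theta>\<^sub>2\<close> minus
  the homotopy already built on the boundary is a cycle in the carrier, and the cone fills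
  it.\<close>

definition homotopy :: "nat \<Rightarrow> ('a list \<Rightarrow>\<^sub>0 'g) \<Rightarrow> ('b list \<Rightarrow>\<^sub>0 'g)" where
  "homotopy = glue (\<lambda>n S a b. chain_cone (p S) (\<Theta>\<^sub>1 (Suc n) a - \<Theta>\<^sub>2 (Suc n) a - b)) (\<lambda>c. 0)"

lemma homotopy_add: "homotopy n (c + d) = homotopy n c + homotopy n d"
  unfolding homotopy_def
  by (rule glue_add) (simp_all add: add1 add2 cone_add cone_diff)

lemma homotopy_0 [simp]: "homotopy 0 c = 0"
  by (simp add: homotopy_def)

lemma homotopy_Suc:
  "homotopy (Suc n) c = (\<Sum>S\<in>set ` keys c. chain_cone (p S)
     (\<Theta>\<^sub>1 (Suc n) (part S c) - \<Theta>\<^sub>2 (Suc n) (part S c) - homotopy n (bd (part S c))))"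
  by (simp add: homotopy_def)

lemma homotopy_carried:
  assumes "S \<in> K" "c \<in> alt_chains n (Pow S)"
  shows "homotopy n c \<in> alt_chains (Suc n) (Pow (Car S))"
  using assms
proof (induction n arbitrary: S c)
  case (Suc n)
  show ?case unfolding homotopy_Suc
  proof (rule alt_chains_sum)
    fix T assume "T \<in> set ` keys c"
    from in_set_keys_alt_chains[OF Suc.prems(2) this]
    have T: "T \<subseteq> S" "T \<noteq> {}" by auto
    then have TK: "T \<in> K" using down[OF Suc.prems(1)] by simp
    have c: "part T c \<in> alt_chains (Suc n) (Pow T)" using Suc.prems(2) by (rule alt_chains_part_Pow)
    have "\<Theta>\<^sub>1 (Suc n) (part T c) - \<Theta>\<^sub>2 (Suc n) (part T c) - homotopy n (bd (part T c)) \<in> alt_chains (Suc n) (Pow (Car T))"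
      using TK c by (intro alt_chains_diff carried1 carried2 Suc.IH alt_chains_bd_Pow)
    then show "chain_cone (p T) (\<Theta>\<^sub>1 (Suc n) (part T c) - \<Theta>\<^sub>2 (Suc n) (part T c) - homotopy n (bd (part T c)))
      \<in> alt_chains (Suc (Suc n)) (Pow (Car S))"
      by (rule alt_chains_cone) (use Car_mono[OF Suc.prems(1) T(1)] apex[OF TK T(2)] in auto)
  qed
qed simp

lemma homotopy_in_chains:
  assumes "c \<in> alt_chains n K"
  shows "homotopy n c \<in> alt_chains (Suc n) {T. \<exists>S\<in>K. T \<subseteq> Car S}"
proof -
  have "homotopy n c = (\<Sum>S\<in>set ` keys c. homotopy n (part S c))"
    by (subst sum_part[symmetric, of "set ` keys c" c])
       (simp_all add: additive_imp_sum[of "homotopy n", OF homotopy_add])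
  also have "\<dots> \<in> alt_chains (Suc n) {T. \<exists>S\<in>K. T \<subseteq> Car S}"
  proof (rule alt_chains_sum)
    fix S assume "S \<in> set ` keys c"
    then have S: "S \<in> K" using in_set_keys_alt_chains[OF assms] by blast
    show "homotopy n (part S c) \<in> alt_chains (Suc n) {T. \<exists>S\<in>K. T \<subseteq> Car S}"
      by (rule subsetD[OF alt_chains_mono homotopy_carried[OF S alt_chains_part_Pow[OF assms]]]) (use S in auto)
  qed
  finally show ?thesis .
qed

lemma bd_homotopy:
  assumes "c \<in> alt_chains (Suc n) K"
  shows "bd (homotopy (Suc n) c) = \<Theta>\<^sub>1 (Suc n) c - \<Theta>\<^sub>2 (Suc n) c - homotopy n (bd c)"
  using assms
proof (induction n arbitrary: c)
  \<comment> \<open>Once the chain to be coned is a cycle on every simplex, the cone formula gives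
    the claim. The two cases of the induction only supply this: the lowest degree from
    \<open>start\<close>, the others from \<open>bd_bd\<close> and the induction hypothesis.\<close>
  have main: "bd (homotopy (Suc n) c) = \<Theta>\<^sub>1 (Suc n) c - \<Theta>\<^sub>2 (Suc n) c - homotopy n (bd c)"
    if c: "c \<in> alt_chains (Suc n) K"
    and z: "\<And>S. bd (\<Theta>\<^sub>1 (Suc n) (part S c) - \<Theta>\<^sub>2 (Suc n) (part S c) - homotopy n (bd (part S c))) = 0" for n c
  proof -
    let ?w = "\<lambda>e. \<Theta>\<^sub>1 (Suc n) e - \<Theta>\<^sub>2 (Suc n) e - homotopy n (bd e)"
    have "bd (homotopy (Suc n) c) = (\<Sum>S\<in>set ` keys c. ?w (part S c))"
      unfolding homotopy_Suc bd_sum bd_cone z by simp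
    also have "\<dots> = ?w (\<Sum>S\<in>set ` keys c. part S c)"
      by (rule additive_imp_sum[of ?w, symmetric]) (simp add: add1 add2 bd_add homotopy_add algebra_simps)
    finally show ?thesis by (simp add: sum_part)
  qed
  have pK: "part S c \<in> alt_chains (Suc n) K" if "c \<in> alt_chains (Suc n) K" for n S c
    by (rule subsetD[OF alt_chains_mono alt_chains_part[OF that]]) auto
  have bK: "bd c \<in> alt_chains n K" if "c \<in> alt_chains (Suc n) K" for n c
    using that by (rule alt_chains_bd) (rule down)
  {
    case 0
    show ?case
    proof (rule main[OF 0])
      fix S
      show "bd (\<Theta>\<^sub>1 (Suc 0) (part S c) - \<Theta>\<^sub>2 (Suc 0) (part S c) - homotopy 0 (bd (part S c))) = 0"
        by (simp add: bd_diff bd1[OF pK[OF 0]] bd2[OF pK[OF 0]] start[OF bK[OF pK[OF 0]]])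
    qed
  next
    case (Suc n)
    show ?case
    proof (rule main[OF Suc.prems])
      fix S
      have b: "bd (part S c) \<in> alt_chains (Suc n) K" using pK[OF Suc.prems] by (rule bK)
      have "homotopy n 0 = 0" by (rule additive_imp_zero) (rule homotopy_add)
      then have "bd (homotopy (Suc n) (bd (part S c))) =
          \<Theta>\<^sub>1 (Suc n) (bd (part S c)) - \<Theta>\<^sub>2 (Suc n) (bd (part S c))"
        using Suc.IH[OF b] bd_bd[OF pK[OF Suc.prems]] by simp
      then show "bd (\<Theta>\<^sub>1 (Suc (Suc n)) (part S c) - \<Theta>\<^sub>2 (Suc (Suc n)) (part S c)
          - homotopy (Suc n) (bd (part S c))) = 0"
        by (simp add: bd_diff bd1[OF pK[OF Suc.prems]] bd2[OF pK[OF Suc.prems]])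
    qed
  }
qed

lemma bd_homotopy_cycle:
  assumes "c \<in> alt_chains n K" "bd c = 0"
  shows "bd (homotopy n c) = \<Theta>\<^sub>1 n c - \<Theta>\<^sub>2 n c"
proof (cases n)
  case 0
  then show ?thesis using start assms(1) by simp
next
  case (Suc m)
  have "homotopy m 0 = 0" by (rule additive_imp_zero) (rule homotopy_add)
  then show ?thesis using bd_homotopy[of c m] assms Suc by simp
qed

theorem carried_maps_homologous:
  assumes "c \<in> alt_chains n K" "bd c = 0"
  obtains y where "y \<in> alt_chains (Suc n) {T. \<exists>S\<in>K. T \<subseteq> Car S}" "bd y = \<Theta>\<^sub>1 n c - \<Theta>\<^sub>2 n c"
  by (rule that[OF homotopy_in_chains[OF assms(1)] bd_homotopy_cycle[OF assms]])

end

section \<open>Contiguous vertex maps and prisms\<close>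

lemma push_map_alt_chains_0: "c \<in> alt_chains 0 K \<Longrightarrow> push (map f) c = push (map g) c"
  by (rule push_cong) (auto simp: alt_chains_def)

lemma carried_maps_push:
  assumes "\<And>S T. S \<in> K \<Longrightarrow> T \<subseteq> S \<Longrightarrow> T \<in> K"
  shows "carried_maps (\<lambda>n. push (map g)) (\<lambda>n. push (map f)) K (\<lambda>S. f ` S \<union> g ` S) (\<lambda>S. f (SOME v. v \<in> S))"
proof
  show "f (SOME v. v \<in> S) \<in> f ` S \<union> g ` S" if "S \<noteq> {}" for S
    using that some_in_eq by blast
  show "push (map g) c \<in> alt_chains n (Pow (f ` S \<union> g ` S))" if "c \<in> alt_chains n (Pow S)" for S c n
    by (rule alt_chains_push[OF that]) auto
  show "push (map f) c \<in> alt_chains n (Pow (f ` S \<union> g ` S))" if "c \<in> alt_chains n (Pow S)" for S c n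
    by (rule alt_chains_push[OF that]) auto
  show "T \<in> K" if "S \<in> K" "T \<subseteq> S" for S T by (rule assms) fact+
qed (auto simp: push_add bd_push_map intro: push_map_alt_chains_0)

text \<open>Defined through the locale constant, which involves neither the complex nor the
  carriers. So one chain homotopy serves for all complexes: its formal properties come from the
  instance with \<open>UNIV\<close>, its support from the instance with K.\<close>

definition prism :: "nat \<Rightarrow> ('a \<Rightarrow> 'b) \<Rightarrow> ('a \<Rightarrow> 'b) \<Rightarrow> ('a list \<Rightarrow>\<^sub>0 'g::ab_group_add) \<Rightarrow> ('b list \<Rightarrow>\<^sub>0 'g)" where
  "prism n f g = carried_maps.homotopy (\<lambda>n. push (map g)) (\<lambda>n. push (map f)) (\<lambda>S. f (SOME v. v \<in> S)) n"

lemma prism_add: "prism n f g (c + d) = prism n f g c + prism n f g d"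
  unfolding prism_def
  by (rule carried_maps.homotopy_add[OF carried_maps_push[of UNIV]]) auto

lemma bd_prism_cycle:
  assumes "c \<in> alt_chains n K" "bd c = 0"
  shows "bd (prism n f g c) = push (map g) c - push (map f) c"
proof -
  have c: "c \<in> alt_chains n UNIV" by (rule subsetD[OF alt_chains_mono assms(1)]) simp
  show ?thesis unfolding prism_def
    by (rule carried_maps.bd_homotopy_cycle[OF carried_maps_push[of UNIV] c assms(2)]) simp
qed

lemma prism_in_chains:
  assumes "c \<in> alt_chains n K" "\<And>S T. S \<in> K \<Longrightarrow> T \<subseteq> S \<Longrightarrow> T \<in> K"
    "\<And>S T. S \<in> K \<Longrightarrow> T \<subseteq> f ` S \<union> g ` S \<Longrightarrow> T \<in> L"
  shows "prism n f g c \<in> alt_chains (Suc n) L"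
proof -
  have "prism n f g c \<in> alt_chains (Suc n) {T. \<exists>S\<in>K. T \<subseteq> f ` S \<union> g ` S}"
    unfolding prism_def
    by (rule carried_maps.homotopy_in_chains[OF carried_maps_push[of K]]) (fact assms)+
  moreover have "{T. \<exists>S\<in>K. T \<subseteq> f ` S \<union> g ` S} \<subseteq> L" using assms(3) by blast
  ultimately show ?thesis by (rule rev_subsetD[OF _ alt_chains_mono])
qed

theorem contiguous_homologous:
  assumes "c \<in> alt_chains n K" "bd c = 0" "\<And>S T. S \<in> K \<Longrightarrow> T \<subseteq> S \<Longrightarrow> T \<in> K"
    "\<And>S T. S \<in> K \<Longrightarrow> T \<subseteq> f ` S \<union> g ` S \<Longrightarrow> T \<in> L"
  obtains y where "y \<in> alt_chains (Suc n) L" "bd y = push (map g) c - push (map f) c"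
proof
  show "prism n f g c \<in> alt_chains (Suc n) L" by (rule prism_in_chains[OF assms(1)]) (fact assms)+
  show "bd (prism n f g c) = push (map g) c - push (map f) c" by (rule bd_prism_cycle[OF assms(1,2)])
qed

text \<open>
  The simplices \<open>S\<close> are replaced by contractible sets \<open>C S\<close>, each contracted in \<open>M\<close> steps without
  increasing distances by more than \<open>\<eta>\<close>. The relation \<open>close a\<close> stands for being at distance at most \<open>a\<close>.
\<close>

locale contracted_carriers =
  fixes K :: "'a set set" and C :: "'a set \<Rightarrow> 'y set" and m :: "'a set \<Rightarrow> nat \<Rightarrow> 'y \<Rightarrow> 'y"
    and M :: nat and b :: "'a set \<Rightarrow> 'y" and close :: "real \<Rightarrow> 'y \<Rightarrow> 'y \<Rightarrow> bool" and \<eta> :: real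
  assumes eta: "0 \<le> \<eta>"
    and down: "S \<in> K \<Longrightarrow> T \<subseteq> S \<Longrightarrow> T \<in> K"
    and C_mono: "S \<in> K \<Longrightarrow> T \<subseteq> S \<Longrightarrow> C T \<subseteq> C S"
    and m_in: "S \<in> K \<Longrightarrow> S \<noteq> {} \<Longrightarrow> i \<le> M \<Longrightarrow> x \<in> C S \<Longrightarrow> m S i x \<in> C S"
    and m_start: "S \<in> K \<Longrightarrow> S \<noteq> {} \<Longrightarrow> x \<in> C S \<Longrightarrow> m S 0 x = x"
    and m_end: "S \<in> K \<Longrightarrow> S \<noteq> {} \<Longrightarrow> x \<in> C S \<Longrightarrow> m S M x = b S"
    and b_in: "S \<in> K \<Longrightarrow> S \<noteq> {} \<Longrightarrow> b S \<in> C S"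
    and close_refl: "0 \<le> a \<Longrightarrow> close a x x"
    and close_m: "S \<in> K \<Longrightarrow> S \<noteq> {} \<Longrightarrow> x \<in> C S \<Longrightarrow> y \<in> C S \<Longrightarrow> i \<le> M \<Longrightarrow> j \<le> M \<Longrightarrow> i \<le> Suc j \<Longrightarrow> j \<le> Suc i
        \<Longrightarrow> 0 \<le> a \<Longrightarrow> close a x y \<Longrightarrow> close (a + \<eta>) (m S i x) (m S j y)"
begin

text \<open>A cycle in \<open>C S\<close> is filled by its own trace: prisms run through the
  contraction from the identity to a constant map and keep the simplices small, which a single cone
  from \<open>b S\<close> would not do. The cone term contributes only for n = 0, where it creates
  the vertex \<open>b S\<close>; a cycle on longer lists vanishes when pushed to one point.\<close>

definition filling :: "nat \<Rightarrow> 'a set \<Rightarrow> ('y list \<Rightarrow>\<^sub>0 'g::ab_group_add) \<Rightarrow> ('y list \<Rightarrow>\<^sub>0 'g)" where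
  "filling n S d = chain_cone (b S) (push (map (m S M)) d) - (\<Sum>i<M. prism n (m S i) (m S (Suc i)) d)"

definition subdivision :: "nat \<Rightarrow> ('a list \<Rightarrow>\<^sub>0 'g::ab_group_add) \<Rightarrow> ('y list \<Rightarrow>\<^sub>0 'g)" where
  "subdivision = glue (\<lambda>n S a d. filling n S d) (\<lambda>c. single [] (lookup c []))"

definition small :: "real \<Rightarrow> 'y set \<Rightarrow> bool" where
  "small a T \<longleftrightarrow> (\<forall>x\<in>T. \<forall>y\<in>T. close a x y)"

lemma filling_add: "filling n S (c + d) = filling n S c + filling n S d"
  by (simp add: filling_def cone_add push_add prism_add sum.distrib)

lemma subdivision_add: "subdivision n (c + d) = subdivision n c + subdivision n d"
  unfolding subdivision_def by (rule glue_add) (simp_all add: filling_add lookup_add single_add)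

lemma subdivision_0: "subdivision 0 c = single [] (lookup c [])"
  by (simp add: subdivision_def)

lemma subdivision_Suc:
  "subdivision (Suc n) c = (\<Sum>S\<in>set ` keys c. filling n S (subdivision n (bd (part S c))))"
  by (simp add: subdivision_def)

lemma bd_filling:
  assumes S: "S \<in> K" "S \<noteq> {}" and d: "d \<in> alt_chains n (Pow (C S))" "bd d = 0"
  shows "bd (filling n S d) = d"
proof -
  have "bd (filling n S d) = push (map (m S M)) d - (\<Sum>i<M. push (map (m S (Suc i))) d - push (map (m S i)) d)"
    by (simp add: filling_def bd_diff bd_cone bd_push_map d(2) bd_sum bd_prism_cycle[OF d])
  also have "\<dots> = push (map (m S 0)) d"
    using sum_lessThan_telescope[of "\<lambda>i. push (map (m S i)) d" M] by simp
  also have "\<dots> = push (\<lambda>xs. xs) d"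
    by (rule push_cong) (use d S in \<open>auto simp: alt_chains_def m_start map_idI subset_iff\<close>)
  finally show ?thesis by simp
qed

lemma filling_in_chains:
  assumes S: "S \<in> K" "S \<noteq> {}" and a: "0 \<le> a" and d: "d \<in> alt_chains n {T. T \<subseteq> C S \<and> small a T}"
  shows "filling n S d \<in> alt_chains (Suc n) {T. T \<subseteq> C S \<and> small (a + \<eta>) T}"
  unfolding filling_def
proof (intro alt_chains_diff alt_chains_sum)
  have "push (map (m S M)) d \<in> alt_chains n (Pow {b S})"
    by (rule alt_chains_push[OF d]) (use m_end[OF S] in auto)
  then show "chain_cone (b S) (push (map (m S M)) d) \<in> alt_chains (Suc n) {T. T \<subseteq> C S \<and> small (a + \<eta>) T}"
  proof (rule alt_chains_cone)
    fix T assume "T \<in> Pow {b S}"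
    then have T: "insert (b S) T = {b S}" by auto
    show "insert (b S) T \<in> {T. T \<subseteq> C S \<and> small (a + \<eta>) T}"
      unfolding T using b_in[OF S] close_refl[of "a + \<eta>"] a eta by (simp add: small_def)
  qed
next
  fix i assume i: "i \<in> {..<M}"
  show "prism n (m S i) (m S (Suc i)) d \<in> alt_chains (Suc n) {T. T \<subseteq> C S \<and> small (a + \<eta>) T}"
  proof (rule prism_in_chains[OF d])
    fix T U assume T: "T \<in> {T. T \<subseteq> C S \<and> small a T}" and U: "U \<subseteq> m S i ` T \<union> m S (Suc i) ` T"
    have T': "x \<in> C S" "y \<in> T \<Longrightarrow> close a x y" if "x \<in> T" for x y
      using T that by (auto simp: small_def)
    have U': "\<exists>x\<in>T. \<exists>j. u = m S j x \<and> i \<le> j \<and> j \<le> Suc i" if "u \<in> U" for u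
      using U that by fastforce
    have "close (a + \<eta>) u v" if uv: "u \<in> U" "v \<in> U" for u v
    proof -
      obtain x j where x: "x \<in> T" "u = m S j x" "i \<le> j" "j \<le> Suc i" using U'[OF uv(1)] by blast
      obtain y l where y: "y \<in> T" "v = m S l y" "i \<le> l" "l \<le> Suc i" using U'[OF uv(2)] by blast
      have "close (a + \<eta>) (m S j x) (m S l y)"
        using i x(3,4) y(3,4) by (intro close_m S T'(1) x(1) y(1) a T'(2)) auto
      then show ?thesis using x(2) y(2) by simp
    qed
    moreover have "u \<in> C S" if u: "u \<in> U" for u
    proof -
      obtain x j where x: "x \<in> T" "u = m S j x" "i \<le> j" "j \<le> Suc i" using U'[OF u] by blast
      show ?thesis unfolding x(2) using i x(4) by (intro m_in S T'(1) x(1)) auto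
    qed
    ultimately show "U \<in> {T. T \<subseteq> C S \<and> small (a + \<eta>) T}" by (auto simp: small_def)
  next
    fix T U assume "T \<in> {T. T \<subseteq> C S \<and> small a T}" "U \<subseteq> T"
    then show "U \<in> {T. T \<subseteq> C S \<and> small a T}" unfolding small_def by blast
  qed
qed

text \<open>The two statements need each other: \<open>bd_filling\<close> applies only to cycles
  inside \<open>C S\<close>, which takes the support statement in the same degree and the boundary
  formula one degree lower. Each new dimension is filled by prisms over chains of the previous mesh
  and costs another \<eta>, whence the factor n.\<close>

lemma subdivision_properties:
  "(\<forall>S\<in>K. \<forall>c\<in>alt_chains n (Pow S). (subdivision n c :: 'y list \<Rightarrow>\<^sub>0 'g::ab_group_add)
      \<in> alt_chains n {T. T \<subseteq> C S \<and> small (real n * \<eta>) T})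
   \<and> (\<forall>c\<in>alt_chains (Suc n) K. bd (subdivision (Suc n) c :: 'y list \<Rightarrow>\<^sub>0 'g) = subdivision n (bd c))"
   (is "?A n \<and> ?B n")
proof -
  have part_in: "part T c \<in> alt_chains n (Pow T)" if "c \<in> alt_chains n L" for T c L and n :: nat
    using that by (rule alt_chains_part_Pow)
  have stepB: "bd (subdivision (Suc n) c) = subdivision n (bd c)"
    if A: "?A n"
    and cyc: "\<And>S. S \<in> K \<Longrightarrow> bd (subdivision n (bd (part S c))) = 0"
    and c: "c \<in> alt_chains (Suc n) K" for n and c :: "'a list \<Rightarrow>\<^sub>0 'g"
  proof -
    have "bd (filling n S (subdivision n (bd (part S c)))) = subdivision n (bd (part S c))"
      if "S \<in> set ` keys c" for S
    proof (rule bd_filling)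
      show S: "S \<in> K" "S \<noteq> {}" using in_set_keys_alt_chains[OF c that] by auto
      have "subdivision n (bd (part S c)) \<in> alt_chains n {T. T \<subseteq> C S \<and> small (real n * \<eta>) T}"
        using alt_chains_bd_Pow[OF part_in[OF c, of S]] by (rule A[rule_format, OF S(1)])
      then show "subdivision n (bd (part S c)) \<in> alt_chains n (Pow (C S))"
        by (rule rev_subsetD[OF _ alt_chains_mono]) auto
    qed (rule cyc[OF in_set_keys_alt_chains(1)[OF c that]])
    then have "bd (subdivision (Suc n) c) = (\<Sum>S\<in>set ` keys c. subdivision n (bd (part S c)))"
      by (simp add: subdivision_Suc bd_sum)
    also have "\<dots> = subdivision n (bd (\<Sum>S\<in>set ` keys c. part S c))"
      by (simp add: bd_sum additive_imp_sum[of "subdivision n", OF subdivision_add])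
    finally show ?thesis by (simp add: sum_part)
  qed
  have A0: "?A 0"
  proof -
    have "alt (single [] (lookup c []) :: 'y list \<Rightarrow>\<^sub>0 'g)" for c :: "'a list \<Rightarrow>\<^sub>0 'g"
      unfolding alt_def
    proof (intro conjI allI impI)
      fix n and xs :: "'y list" assume "Suc n < length xs"
      then have "length xs \<noteq> 0" "length (swap_at n xs) \<noteq> 0" by auto
      then have "xs \<noteq> []" "swap_at n xs \<noteq> []" by (metis list.size(3))+
      then show "lookup (single [] (lookup c [])) (swap_at n xs) = - lookup (single [] (lookup c [])) xs"
        by (simp add: lookup_single)
    qed simp
    then show ?thesis by (auto simp: subdivision_0 alt_chains_def small_def)
  qed
  show ?thesis
  proof (induction n)
    case 0
    have "?B 0"
    proof
      fix c :: "'a list \<Rightarrow>\<^sub>0 'g" assume c: "c \<in> alt_chains (Suc 0) K"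
      show "bd (subdivision (Suc 0) c) = subdivision 0 (bd c)"
        by (rule stepB[OF A0 _ c]) (simp add: subdivision_0)
    qed
    with A0 show ?case by (rule conjI)
  next
    case (Suc n)
    have A: "?A (Suc n)"
    proof (intro ballI)
      fix S and c :: "'a list \<Rightarrow>\<^sub>0 'g"
      assume S: "S \<in> K" and c: "c \<in> alt_chains (Suc n) (Pow S)"
      show "subdivision (Suc n) c \<in> alt_chains (Suc n) {U. U \<subseteq> C S \<and> small (real (Suc n) * \<eta>) U}"
        unfolding subdivision_Suc
      proof (rule alt_chains_sum)
        fix T assume "T \<in> set ` keys c"
        from in_set_keys_alt_chains[OF c this] have T: "T \<subseteq> S" "T \<noteq> {}" by auto
        have TK: "T \<in> K" using down S T by blast
        have "subdivision n (bd (part T c)) \<in> alt_chains n {U. U \<subseteq> C T \<and> small (real n * \<eta>) U}"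
          using alt_chains_bd_Pow[OF part_in[OF c, of T]] by (rule Suc.IH[THEN conjunct1, rule_format, OF TK])
        then have "filling n T (subdivision n (bd (part T c))) \<in> alt_chains (Suc n) {U. U \<subseteq> C T \<and> small (real n * \<eta> + \<eta>) U}"
          using eta by (intro filling_in_chains TK T) auto
        moreover have "{U. U \<subseteq> C T \<and> small (real n * \<eta> + \<eta>) U} \<subseteq> {U. U \<subseteq> C S \<and> small (real (Suc n) * \<eta>) U}"
        proof -
          have "real (Suc n) * \<eta> = real n * \<eta> + \<eta>" by (simp add: algebra_simps)
          then show ?thesis using C_mono[OF S T(1)] by auto
        qed
        ultimately show "filling n T (subdivision n (bd (part T c))) \<in> alt_chains (Suc n) {U. U \<subseteq> C S \<and> small (real (Suc n) * \<eta>) U}"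
          by (rule rev_subsetD[OF _ alt_chains_mono])
      qed
    qed
    have "?B (Suc n)"
    proof
      fix c :: "'a list \<Rightarrow>\<^sub>0 'g" assume c: "c \<in> alt_chains (Suc (Suc n)) K"
      show "bd (subdivision (Suc (Suc n)) c) = subdivision (Suc n) (bd c)"
      proof (rule stepB[OF A _ c])
        fix S assume S: "S \<in> K"
        have "part S c \<in> alt_chains (Suc (Suc n)) (Pow S)" using c by (rule part_in)
        then have b: "bd (part S c) \<in> alt_chains (Suc n) (Pow S)" "bd (bd (part S c)) = 0"
          by (rule alt_chains_bd_Pow, rule bd_bd)
        have "Pow S \<subseteq> K" using S down by blast
        from subsetD[OF alt_chains_mono[OF this] b(1)]
        have "bd (part S c) \<in> alt_chains (Suc n) K" .
        then have "bd (subdivision (Suc n) (bd (part S c))) = subdivision n 0"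
          using Suc.IH[THEN conjunct2, rule_format] b(2) by simp
        then show "bd (subdivision (Suc n) (bd (part S c))) = 0"
          using additive_imp_zero[of "subdivision n", OF subdivision_add] by simp
      qed
    qed
    with A show ?case by (rule conjI)
  qed
qed

lemma subdivision_carried:
  "S \<in> K \<Longrightarrow> c \<in> alt_chains n (Pow S) \<Longrightarrow> subdivision n c \<in> alt_chains n {T. T \<subseteq> C S \<and> small (real n * \<eta>) T}"
  by (rule subdivision_properties[THEN conjunct1, rule_format])

lemma bd_subdivision: "c \<in> alt_chains (Suc n) K \<Longrightarrow> bd (subdivision (Suc n) c) = subdivision n (bd c)"
  by (rule subdivision_properties[THEN conjunct2, rule_format])

lemma subdivision_in_chains:
  assumes c: "c \<in> alt_chains n K"
  shows "subdivision n c \<in> alt_chains n {T. (\<exists>S\<in>K. T \<subseteq> C S) \<and> small (real n * \<eta>) T}"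
proof -
  have "subdivision n c = (\<Sum>S\<in>set ` keys c. subdivision n (part S c))"
    by (subst sum_part[symmetric, of "set ` keys c" c])
       (simp_all add: additive_imp_sum[of "subdivision n", OF subdivision_add])
  also have "\<dots> \<in> alt_chains n {T. (\<exists>S\<in>K. T \<subseteq> C S) \<and> small (real n * \<eta>) T}"
  proof (rule alt_chains_sum)
    fix S assume "S \<in> set ` keys c"
    then have S: "S \<in> K" using in_set_keys_alt_chains[OF c] by blast
    show "subdivision n (part S c) \<in> alt_chains n {T. (\<exists>S\<in>K. T \<subseteq> C S) \<and> small (real n * \<eta>) T}"
      by (rule subsetD[OF alt_chains_mono subdivision_carried[OF S alt_chains_part_Pow[OF c]]]) (use S in auto)
  qed
  finally show ?thesis .
qed

lemma bd_subdivision_cycle: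
  assumes "c \<in> alt_chains n K" "bd c = 0"
  shows "bd (subdivision n c) = 0"
proof (cases n)
  case (Suc k)
  then show ?thesis using bd_subdivision[of c k] assms
    additive_imp_zero[of "subdivision k", OF subdivision_add] by simp
qed (simp add: subdivision_0)

text \<open>The map \<phi> undoes the subdivision up to homology: the image of the subdivided
  simplex and the original one both lie in the full simplex on \<open>Car S\<close>, so the carrier
  theorem applies.\<close>

lemma push_subdivision_homologous:
  fixes c :: "'a list \<Rightarrow>\<^sub>0 'g::ab_group_add"
  assumes c: "c \<in> alt_chains n K" "bd c = 0"
    and Car: "\<And>S. S \<in> K \<Longrightarrow> \<phi> ` C S \<subseteq> Car S" "\<And>S. S \<in> K \<Longrightarrow> S \<subseteq> Car S"
      "\<And>S T. S \<in> K \<Longrightarrow> T \<subseteq> S \<Longrightarrow> Car T \<subseteq> Car S"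
  obtains y where "y \<in> alt_chains (Suc n) {T. \<exists>S\<in>K. T \<subseteq> Car S}"
    "bd y = push (map \<phi>) (subdivision n c) - c"
proof -
  interpret h: carried_maps "\<lambda>n (c :: 'a list \<Rightarrow>\<^sub>0 'g). push (map \<phi>) (subdivision n c)" "\<lambda>n c. c" K Car "\<lambda>S. SOME v. v \<in> S"
  proof
    show "push (map \<phi>) (subdivision n c) \<in> alt_chains n (Pow (Car S))"
      if "S \<in> K" "c \<in> alt_chains n (Pow S)" for S n and c :: "'a list \<Rightarrow>\<^sub>0 'g"
      by (rule alt_chains_push[OF subdivision_carried[OF that]]) (use Car(1)[OF that(1)] in auto)
    show "c \<in> alt_chains n (Pow (Car S))" if "S \<in> K" "c \<in> alt_chains n (Pow S)" for S n and c :: "'a list \<Rightarrow>\<^sub>0 'g"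
      by (rule subsetD[OF alt_chains_mono that(2)]) (use Car(2)[OF that(1)] in auto)
    show "push (map \<phi>) (subdivision 0 c) = c" if "c \<in> alt_chains 0 K" for c :: "'a list \<Rightarrow>\<^sub>0 'g"
    proof -
      have "lookup c xs = 0" if "xs \<noteq> []" for xs
        using that \<open>c \<in> alt_chains 0 K\<close> by (auto simp: alt_chains_def in_keys_iff)
      then have "single [] (lookup c []) = c"
        by (intro poly_mapping_eqI) (simp add: lookup_single when_def)
      then show ?thesis by (simp add: subdivision_0)
    qed
    show "(SOME v. v \<in> S) \<in> Car S" if "S \<in> K" "S \<noteq> {}" for S
      using that Car(2) some_in_eq by blast
    show "T \<in> K" if "S \<in> K" "T \<subseteq> S" for S T using that by (rule down)
    show "Car T \<subseteq> Car S" if "S \<in> K" "T \<subseteq> S" for S T using that by (rule Car(3))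
  qed (simp_all add: push_add subdivision_add bd_push_map bd_subdivision)
  show ?thesis by (rule h.carried_maps_homologous[OF c]) (rule that)
qed

end


section \<open>Homology groups and direct summands\<close>

lemma nth_swap_at:
  "Suc n < length xs \<Longrightarrow> i < length xs \<Longrightarrow> swap_at n xs ! i = xs ! Transposition.transpose n (Suc n) i"
proof (induction xs arbitrary: n i)
  case (Cons x xs)
  show ?case
  proof (cases n)
    case 0
    then obtain y ys where "xs = y # ys" using Cons.prems by (cases xs) auto
    then show ?thesis using 0 by (auto simp: Transposition.transpose_def nth_Cons split: nat.split)
  next
    case (Suc m)
    show ?thesis
    proof (cases i)
      case (Suc j)
      have "Transposition.transpose (Suc m) (Suc (Suc m)) (Suc j) = Suc (Transposition.transpose m (Suc m) j)"
        by (simp add: Transposition.transpose_def)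
      then show ?thesis using Suc \<open>n = Suc m\<close> Cons.IH[of m j] Cons.prems by simp
    qed (use Suc in \<open>simp add: Transposition.transpose_def\<close>)
  qed
qed simp

lemma permute_list_transpose_adjacent:
  assumes "Suc n < length xs"
  shows "permute_list (Transposition.transpose n (Suc n)) xs = swap_at n xs"
  by (rule nth_equalityI) (use assms in \<open>simp_all add: permute_list_def nth_swap_at\<close>)

text \<open>Induction on j through (i, j+1) = (j, j+1)(i, j)(j, j+1): conjugating by an adjacent
  transposition adds two sign changes, which cancel.\<close>

lemma alt_transpose:
  assumes "alt c" "i < j" "j < length xs"
  shows "lookup c (permute_list (Transposition.transpose i j) xs) = - lookup c xs"
  using assms(2,3)
proof (induction j arbitrary: xs)
  case (Suc j)
  let ?t = "Transposition.transpose j (Suc j)"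
  have adj: "lookup c (permute_list ?t ys) = - lookup c ys" if "length ys = length xs" for ys
    using alt_swapD[OF assms(1), of j ys] permute_list_transpose_adjacent[of j ys] that Suc.prems by simp
  have perm: "?t permutes {..<length xs}" using Suc.prems by (intro permutes_swap_id) auto
  show ?case
  proof (cases "i = j")
    case True
    then show ?thesis using adj[of xs] by simp
  next
    case False
    then have ij: "i < j" using Suc.prems by simp
    have permij: "Transposition.transpose i j permutes {..<length xs}" using Suc.prems ij by (intro permutes_swap_id) auto
    have eq: "Transposition.transpose i (Suc j) = ?t \<circ> (Transposition.transpose i j \<circ> ?t)"
      using ij by (auto simp: fun_eq_iff Transposition.transpose_def)
    have perm': "Transposition.transpose i j \<circ> ?t permutes {..<length xs}"
      using permutes_compose[OF perm permij] .
    have "lookup c (permute_list (Transposition.transpose i (Suc j)) xs)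
        = lookup c (permute_list ?t (permute_list (Transposition.transpose i j) (permute_list ?t xs)))"
      unfolding eq using perm perm' permij by (subst permute_list_compose, simp, subst permute_list_compose) auto
    also have "\<dots> = - lookup c xs"
      using adj[of "permute_list (Transposition.transpose i j) (permute_list ?t xs)"] adj[of xs]
        Suc.IH[of "permute_list ?t xs"] ij Suc.prems by simp
    finally show ?thesis .
  qed
qed simp

lemma alt_permute:
  assumes "alt c" "p permutes {..<length xs}"
  shows "lookup c (permute_list p xs) = (if evenperm p then lookup c xs else - lookup c xs)"
proof -
  have "\<forall>ys. length ys = length xs \<longrightarrow>
      lookup c (permute_list p ys) = (if evenperm p then lookup c ys else - lookup c ys)"
    using assms(2) finite_lessThan[of "length xs"]
  proof (induction p rule: permutes_induct)
    case (swap a b p)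
    have t: "Transposition.transpose a b permutes {..<length xs}" using swap by (intro permutes_swap_id) auto
    have "permutation (Transposition.transpose a b)" "permutation p"
      using permutation_permutes t swap.hyps(4) finite_lessThan by blast+
    then have ev: "evenperm (Transposition.transpose a b \<circ> p) \<longleftrightarrow> \<not> evenperm p"
      using swap(3) by (simp add: evenperm_comp evenperm_swap)
    have tr: "lookup c (permute_list (Transposition.transpose a b) ys) = - lookup c ys" if "length ys = length xs" for ys
      using alt_transpose[OF assms(1), of a b ys] alt_transpose[OF assms(1), of b a ys] swap(1-3) that
      by (cases "a < b") (auto simp: transpose_commute)
    show ?case
    proof (intro allI impI)
      fix ys :: "'a list" assume ys: "length ys = length xs"
      have "permute_list (Transposition.transpose a b \<circ> p) ys = permute_list p (permute_list (Transposition.transpose a b) ys)"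
        by (rule permute_list_compose) (use swap.hyps ys in simp)
      then show "lookup c (permute_list (Transposition.transpose a b \<circ> p) ys) =
          (if evenperm (Transposition.transpose a b \<circ> p) then lookup c ys else - lookup c ys)"
        using swap.IH tr[OF ys] ys by (simp add: ev)
    qed
  qed simp
  then show ?thesis by blast
qed

lemma lookup_in_chains_iff: "lookup c \<in> chains G k K \<longleftrightarrow> c \<in> alt_chains (Suc k) K"
proof
  assume c: "lookup c \<in> chains G k K"
  have "lookup c (swap_at n xs) = - lookup c xs" if n: "Suc n < length xs" for n xs
  proof -
    have "Transposition.transpose n (Suc n) permutes {..<length xs}" using n by (intro permutes_swap_id) auto
    then have "lookup c (permute_list (Transposition.transpose n (Suc n)) xs) = - lookup c xs"
      using c by (auto simp: chains_def evenperm_swap)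
    then show ?thesis using permute_list_transpose_adjacent[OF n] by simp
  qed
  then show "c \<in> alt_chains (Suc k) K"
    using c by (auto simp: chains_def alt_chains_def alt_def in_keys_iff)
next
  assume "c \<in> alt_chains (Suc k) K"
  then show "lookup c \<in> chains G k K"
    by (auto simp: chains_def alt_chains_def in_keys_iff alt_permute dest: alt_distinctD)
qed

lemma chains_eq: "chains G k K = lookup ` alt_chains (Suc k) K"
proof -
  have "f \<in> lookup ` alt_chains (Suc k) K" if f: "f \<in> chains G k K" for f
  proof -
    have "f = lookup (Abs_poly_mapping f)" using f by (simp add: chains_def)
    then show ?thesis using f lookup_in_chains_iff by (metis image_eqI)
  qed
  then show ?thesis by (auto simp: lookup_in_chains_iff)
qed

text \<open>The dimension is at least one: on 0-chains \<open>bd\<close> is the augmentation while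
  \<open>chain_boundary\<close> is zero. For the same reason groups of cycles are compared only for
  k \<ge> 1.\<close>

lemma chain_boundary_lookup:
  assumes "c \<in> alt_chains (Suc (Suc k)) K"
  shows "chain_boundary (lookup c) = lookup (bd c)"
proof
  fix ys
  have len: "length xs = Suc (Suc k)" if "xs \<in> keys c" for xs
    using assms that by (auto simp: alt_chains_def)
  have N: "[] \<notin> keys c" using len[of "[]"] by auto
  show "chain_boundary (lookup c) ys = lookup (bd c) ys"
  proof (cases "ys = []")
    case True
    have "[] \<notin> keys (bd c)"
    proof
      assume "[] \<in> keys (bd c)"
      then obtain xs where "xs \<in> keys c" "[] = tl xs"
        using keys_push_subset[where h = tl and c = c] unfolding bd_eq_push_tl[OF N] by blast
      then show False using len[of xs] by (cases xs) auto
    qed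
    then show ?thesis using True by (simp add: chain_boundary_def in_keys_iff)
  next
    case False
    have "lookup (bd c) ys = (\<Sum>xs\<in>{xs\<in>keys c. tl xs = ys}. lookup c xs)"
      unfolding bd_eq_push_tl[OF N] lookup_push[OF finite_keys subset_refl]
      by (rule sum.inter_filter[symmetric]) simp
    also have "{xs\<in>keys c. tl xs = ys} = (\<lambda>v. v # ys) ` {v. lookup c (v # ys) \<noteq> 0}"
    proof (intro equalityI subsetI)
      fix xs assume "xs \<in> {xs\<in>keys c. tl xs = ys}"
      then show "xs \<in> (\<lambda>v. v # ys) ` {v. lookup c (v # ys) \<noteq> 0}"
        using False by (cases xs) (auto simp: in_keys_iff)
    qed (auto simp: in_keys_iff)
    also have "(\<Sum>xs\<in>(\<lambda>v. v # ys) ` {v. lookup c (v # ys) \<noteq> 0}. lookup c xs) = chain_boundary (lookup c) ys"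
      using False by (subst sum.reindex) (auto simp: inj_on_def chain_boundary_def)
    finally show ?thesis ..
  qed
qed

lemma boundaries_eq: "boundaries G k K = lookup ` bd ` alt_chains (Suc (Suc k)) K"
  unfolding boundaries_def chains_eq image_image
  by (rule image_cong) (auto simp: chain_boundary_lookup)

definition cycles :: "nat \<Rightarrow> 'a set set \<Rightarrow> ('a list \<Rightarrow>\<^sub>0 'g::ab_group_add) set" where
  "cycles n K = {c \<in> alt_chains n K. bd c = 0}"

lemma carrier_cycle_group:
  assumes "1 \<le> k"
  shows "carrier (cycle_group G k K) = lookup ` cycles (Suc k) K"
proof -
  obtain j where k: "k = Suc j" using assms by (cases k) auto
  have "chain_boundary (lookup c) = (\<lambda>ys. 0) \<longleftrightarrow> bd c = 0" if "c \<in> alt_chains (Suc k) K" for c :: "'a list \<Rightarrow>\<^sub>0 'b"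
    using chain_boundary_lookup[of c j K] that k by (simp add: poly_mapping_eq_iff fun_eq_iff)
  then show ?thesis by (auto simp: cycle_group_def chains_eq cycles_def)
qed

lemma mult_cycle_group: "lookup c \<otimes>\<^bsub>cycle_group G k K\<^esub> lookup d = lookup (c + d)"
  by (simp add: cycle_group_def lookup_add fun_eq_iff)

lemma one_cycle_group: "\<one>\<^bsub>cycle_group G k K\<^esub> = lookup 0"
  by (simp add: cycle_group_def fun_eq_iff)

lemma zero_in_cycles [simp]: "0 \<in> cycles n K"
  by (simp add: cycles_def)

lemma cycles_add: "a \<in> cycles n K \<Longrightarrow> b \<in> cycles n K \<Longrightarrow> a + b \<in> cycles n K"
  by (simp add: cycles_def alt_chains_add bd_add)

lemma cycles_uminus: "a \<in> cycles n K \<Longrightarrow> - a \<in> cycles n K"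
  by (simp add: cycles_def alt_chains_uminus bd_uminus)

lemma comm_group_cycle_group:
  assumes "1 \<le> k"
  shows "comm_group (cycle_group G k K)"
proof (rule comm_groupI)
  fix x assume "x \<in> carrier (cycle_group G k K)"
  then obtain c where c: "c \<in> cycles (Suc k) K" "x = lookup c" using carrier_cycle_group[OF assms] by blast
  show "\<exists>y\<in>carrier (cycle_group G k K). y \<otimes>\<^bsub>cycle_group G k K\<^esub> x = \<one>\<^bsub>cycle_group G k K\<^esub>"
    unfolding carrier_cycle_group[OF assms] c(2)
  proof (rule bexI)
    show "lookup (- c) \<otimes>\<^bsub>cycle_group G k K\<^esub> lookup c = \<one>\<^bsub>cycle_group G k K\<^esub>"
      unfolding mult_cycle_group one_cycle_group by simp
    show "lookup (- c) \<in> lookup ` cycles (Suc k) K" using cycles_uminus[OF c(1)] by (rule imageI)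
  qed
qed (auto simp: carrier_cycle_group[OF assms] mult_cycle_group one_cycle_group add.assoc add.commute intro: cycles_add)

text \<open>Only nonempty simplices occur in \<open>K\<close>, whereas chains on the empty list live on the empty simplex.\<close>

definition simplicial_complex :: "'a set set \<Rightarrow> bool" where
  "simplicial_complex K \<longleftrightarrow> (\<forall>S\<in>K. \<forall>T\<subseteq>S. T \<noteq> {} \<longrightarrow> T \<in> K)"

lemma simplicial_complexD: "simplicial_complex K \<Longrightarrow> S \<in> insert {} K \<Longrightarrow> T \<subseteq> S \<Longrightarrow> T \<in> insert {} K"
  unfolding simplicial_complex_def by blast

lemma alt_chains_insert_empty: "alt_chains (Suc n) (insert {} K) = alt_chains (Suc n) K"
  by (auto simp: alt_chains_def)

lemma bd_in_cycles:
  assumes "simplicial_complex K" "c \<in> alt_chains (Suc (Suc n)) K"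
  shows "bd c \<in> cycles (Suc n) K"
proof -
  have c: "c \<in> alt_chains (Suc (Suc n)) (insert {} K)" using assms(2) by (simp add: alt_chains_insert_empty)
  then have "bd c \<in> alt_chains (Suc n) (insert {} K)"
    by (rule alt_chains_bd) (rule simplicial_complexD[OF assms(1)])
  then show ?thesis using bd_bd[OF c] by (simp add: cycles_def alt_chains_insert_empty)
qed

lemma subgroup_cycle_group:
  assumes "1 \<le> k" "A \<subseteq> cycles (Suc k) K" "0 \<in> A" "\<And>a b. a \<in> A \<Longrightarrow> b \<in> A \<Longrightarrow> a + b \<in> A" "\<And>a. a \<in> A \<Longrightarrow> - a \<in> A"
  shows "subgroup (lookup ` A) (cycle_group G k K)"
proof -
  interpret comm_group "cycle_group G k K" by (rule comm_group_cycle_group) fact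
  show ?thesis
  proof (rule subgroupI)
    show "lookup ` A \<subseteq> carrier (cycle_group G k K)" unfolding carrier_cycle_group[OF assms(1)] using assms(2) by blast
    fix x assume "x \<in> lookup ` A"
    then obtain a where a: "a \<in> A" "x = lookup a" by blast
    have "inv\<^bsub>cycle_group G k K\<^esub> (lookup a) = lookup (- a)"
    proof (rule inv_equality)
      show "lookup (- a) \<otimes>\<^bsub>cycle_group G k K\<^esub> lookup a = \<one>\<^bsub>cycle_group G k K\<^esub>"
        unfolding mult_cycle_group one_cycle_group by simp
      have "a \<in> cycles (Suc k) K" using a assms(2) by blast
      then show "lookup a \<in> carrier (cycle_group G k K)" "lookup (- a) \<in> carrier (cycle_group G k K)"
        unfolding carrier_cycle_group[OF assms(1)] using cycles_uminus by blast+
    qed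
    then show "inv\<^bsub>cycle_group G k K\<^esub> x \<in> lookup ` A" using a assms(5) by simp
    fix y assume "y \<in> lookup ` A"
    then show "x \<otimes>\<^bsub>cycle_group G k K\<^esub> y \<in> lookup ` A" using a assms(4) by (auto simp: mult_cycle_group)
  qed (use assms(3) in blast)
qed

lemma normal_boundaries:
  assumes "1 \<le> k" "simplicial_complex K"
  shows "boundaries G k K \<lhd> cycle_group G k K"
proof -
  interpret comm_group "cycle_group G k K" by (rule comm_group_cycle_group) fact
  have "subgroup (boundaries G k K) (cycle_group G k K)"
    unfolding boundaries_eq
  proof (rule subgroup_cycle_group[OF assms(1)])
    show "bd ` alt_chains (Suc (Suc k)) K \<subseteq> cycles (Suc k) K"
      using bd_in_cycles[OF assms(2)] by blast
    show "0 \<in> bd ` alt_chains (Suc (Suc k)) K" by (rule image_eqI[of _ _ 0]) auto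
    show "a + b \<in> bd ` alt_chains (Suc (Suc k)) K"
      if ab: "a \<in> bd ` alt_chains (Suc (Suc k)) K" "b \<in> bd ` alt_chains (Suc (Suc k)) K" for a b :: "'a list \<Rightarrow>\<^sub>0 'b"
    proof -
      obtain c d where "a = bd c" "b = bd d" "c \<in> alt_chains (Suc (Suc k)) K" "d \<in> alt_chains (Suc (Suc k)) K"
        using ab by blast
      then show ?thesis by (intro image_eqI[of _ _ "c + d"]) (auto simp: bd_add alt_chains_add)
    qed
    show "- a \<in> bd ` alt_chains (Suc (Suc k)) K" if a: "a \<in> bd ` alt_chains (Suc (Suc k)) K" for a :: "'a list \<Rightarrow>\<^sub>0 'b"
    proof -
      obtain c where "a = bd c" "c \<in> alt_chains (Suc (Suc k)) K"
        using a by blast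
      then show ?thesis by (intro image_eqI[of _ _ "- c"]) (auto simp: bd_uminus alt_chains_uminus)
    qed
  qed
  then show ?thesis by (rule subgroup_imp_normal)
qed

section \<open>Homology classes as cosets of boundaries\<close>

definition homology_class :: "nat \<Rightarrow> 'a set set \<Rightarrow> ('a list \<Rightarrow>\<^sub>0 'g::ab_group_add) \<Rightarrow> ('a list \<Rightarrow> 'g) set" where
  "homology_class k K c = {lookup (bd y + c) | y. y \<in> alt_chains (Suc (Suc k)) K}"

lemma homology_class_eq_coset:
  "homology_class k K c = boundaries G k K #>\<^bsub>cycle_group G k K\<^esub> lookup c"
  by (auto simp: homology_class_def r_coset_def boundaries_eq mult_cycle_group)

lemma carrier_simplicial_homology:
  assumes "1 \<le> k"
  shows "carrier (simplicial_homology G k K) = homology_class k K ` cycles (Suc k) K"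
  by (auto simp: simplicial_homology_def FactGroup_def RCOSETS_def carrier_cycle_group[OF assms]
      homology_class_eq_coset[where G = G])

lemma mult_simplicial_homology:
  assumes "1 \<le> k" "simplicial_complex K" "c \<in> cycles (Suc k) K" "d \<in> cycles (Suc k) K"
  shows "homology_class k K c \<otimes>\<^bsub>simplicial_homology G k K\<^esub> homology_class k K d = homology_class k K (c + d)"
proof -
  interpret normal "boundaries G k K" "cycle_group G k K" by (rule normal_boundaries) fact+
  show ?thesis
    unfolding homology_class_eq_coset[where G = G] simplicial_homology_def FactGroup_def
    using assms(3,4) by (simp add: rcos_sum carrier_cycle_group[OF assms(1)] mult_cycle_group)
qed

lemma group_simplicial_homology:
  assumes "1 \<le> k" "simplicial_complex K"
  shows "group (simplicial_homology G k K)"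
  unfolding simplicial_homology_def
  by (rule normal.factorgroup_is_group) (rule normal_boundaries[OF assms])

lemma homology_class_eq_iff:
  "homology_class k K c = homology_class k K d \<longleftrightarrow> (\<exists>y\<in>alt_chains (Suc (Suc k)) K. c - d = bd y)"
proof
  assume "homology_class k K c = homology_class k K d"
  moreover have "lookup c \<in> homology_class k K c"
    unfolding homology_class_def by (intro CollectI exI[of _ 0]) simp
  ultimately obtain y where y: "y \<in> alt_chains (Suc (Suc k)) K" "lookup c = lookup (bd y + d)"
    unfolding homology_class_def by blast
  then have "c - d = bd y" by (simp add: poly_mapping_eq_iff[symmetric])
  then show "\<exists>y\<in>alt_chains (Suc (Suc k)) K. c - d = bd y" using y(1) by blast
next
  assume "\<exists>y\<in>alt_chains (Suc (Suc k)) K. c - d = bd y"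
  then obtain y where y: "y \<in> alt_chains (Suc (Suc k)) K" "c = d + bd y" by (auto simp: algebra_simps)
  have "lookup (bd x + c) \<in> homology_class k K d" if "x \<in> alt_chains (Suc (Suc k)) K" for x
    unfolding homology_class_def
    by (intro CollectI exI[of _ "x + y"]) (use y that in \<open>simp add: bd_add alt_chains_add algebra_simps\<close>)
  moreover have "lookup (bd x + d) \<in> homology_class k K c" if "x \<in> alt_chains (Suc (Suc k)) K" for x
    unfolding homology_class_def
    by (intro CollectI exI[of _ "x - y"]) (use y that in \<open>simp add: bd_diff alt_chains_diff algebra_simps\<close>)
  ultimately show "homology_class k K c = homology_class k K d"
    unfolding homology_class_def[of k K c] homology_class_def[of k K d]
    unfolding homology_class_def by blast
qed

lemma homology_inclusion_class:
  assumes "1 \<le> k" "K \<subseteq> L" "c \<in> cycles (Suc k) K"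
  shows "homology_inclusion G k K L (homology_class k K c) = homology_class k L c"
proof -
  have "homology_class k K c \<in> carrier (simplicial_homology G k K)"
    using assms(3) by (simp add: carrier_simplicial_homology[OF assms(1)])
  moreover have "boundaries G k L <#>\<^bsub>cycle_group G k L\<^esub> homology_class k K c = homology_class k L c"
  proof (intro equalityI subsetI)
    fix x assume "x \<in> boundaries G k L <#>\<^bsub>cycle_group G k L\<^esub> homology_class k K c"
    then obtain u y where u: "u \<in> alt_chains (Suc (Suc k)) L" and y: "y \<in> alt_chains (Suc (Suc k)) K"
      and x: "x = lookup (bd u + (bd y + c))"
      by (auto simp: set_mult_def boundaries_eq homology_class_def mult_cycle_group)
    have "y \<in> alt_chains (Suc (Suc k)) L" by (rule subsetD[OF alt_chains_mono[OF assms(2)] y])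
    then show "x \<in> homology_class k L c"
      unfolding homology_class_def
      by (intro CollectI exI[of _ "u + y"]) (simp add: x u alt_chains_add bd_add add.assoc)
  next
    fix x assume "x \<in> homology_class k L c"
    then obtain u where u: "u \<in> alt_chains (Suc (Suc k)) L" "x = lookup (bd u + c)"
      by (auto simp: homology_class_def)
    have "lookup c \<in> homology_class k K c"
      unfolding homology_class_def by (intro CollectI exI[of _ 0]) simp
    then show "x \<in> boundaries G k L <#>\<^bsub>cycle_group G k L\<^esub> homology_class k K c"
      unfolding set_mult_def boundaries_eq using u
      by (auto simp: mult_cycle_group intro!: bexI[of _ "lookup c"] bexI[of _ u])
  qed
  ultimately show ?thesis by (simp add: homology_inclusion_def)
qed

lemma cycles_mono: "K \<subseteq> L \<Longrightarrow> cycles n K \<subseteq> cycles n L"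
  using alt_chains_mono[of K L n] by (auto simp: cycles_def)

text \<open>Turns the decomposition of homology into two statements about cycles.
  \<open>trivial\<close> yields injectivity of the sum map: it makes a a boundary in K, and then w =
  bd y - a is a boundary in L. The complement is the image of V, and it is a subpersistence because
  V grows with the scale.\<close>

theorem direct_summand_viaI:
  fixes K L :: "real \<Rightarrow> 'a set set" and V :: "real \<Rightarrow> ('a list \<Rightarrow>\<^sub>0 'g::ab_group_add) set"
    and G :: "'g itself"
  assumes k: "1 \<le> k"
    and cK: "\<And>r. r \<in> I \<Longrightarrow> simplicial_complex (K r)" and cL: "\<And>r. r \<in> I \<Longrightarrow> simplicial_complex (L r)"
    and KL: "\<And>r. r \<in> I \<Longrightarrow> K r \<subseteq> L r"
    and monoK: "\<And>p q. p < q \<Longrightarrow> K p \<subseteq> K q" and monoL: "\<And>p q. p < q \<Longrightarrow> L p \<subseteq> L q"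
    and V: "\<And>r. r \<in> I \<Longrightarrow> V r \<subseteq> cycles (Suc k) (L r)" "\<And>r. 0 \<in> V r"
      "\<And>r a b. a \<in> V r \<Longrightarrow> b \<in> V r \<Longrightarrow> a + b \<in> V r" "\<And>r a. a \<in> V r \<Longrightarrow> - a \<in> V r"
    and monoV: "\<And>p q. p < q \<Longrightarrow> V p \<subseteq> V q"
    and spans: "\<And>r z. r \<in> I \<Longrightarrow> z \<in> cycles (Suc k) (L r) \<Longrightarrow>
      \<exists>a\<in>cycles (Suc k) (K r). \<exists>w\<in>V r. \<exists>y\<in>alt_chains (Suc (Suc k)) (L r). z = a + w + bd y"
    and trivial: "\<And>r a w y. r \<in> I \<Longrightarrow> a \<in> cycles (Suc k) (K r) \<Longrightarrow> w \<in> V r \<Longrightarrow> y \<in> alt_chains (Suc (Suc k)) (L r)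
      \<Longrightarrow> a + w = bd y \<Longrightarrow> a \<in> bd ` alt_chains (Suc (Suc k)) (K r)"
  shows "direct_summand_via I
     ((\<lambda>r. simplicial_homology G k (K r)), (\<lambda>p q. homology_inclusion G k (K p) (K q)))
     ((\<lambda>r. simplicial_homology G k (L r)), (\<lambda>p q. homology_inclusion G k (L p) (L q)))
     (\<lambda>r. homology_inclusion G k (K r) (L r))"
proof -
  note car = carrier_simplicial_homology[OF k, where G = G]
  note inc = homology_inclusion_class[OF k, where G = G]
  define W where "W r = homology_class k (L r) ` V r" for r
  have toL: "a \<in> cycles (Suc k) (L r)" if "r \<in> I" "a \<in> cycles (Suc k) (K r)" for r and a :: "'a list \<Rightarrow>\<^sub>0 'g"
    by (rule subsetD[OF cycles_mono[OF KL] that(2)]) fact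
  have natural: "homology_inclusion G k (K q) (L q) (homology_inclusion G k (K p) (K q) a) =
      homology_inclusion G k (L p) (L q) (homology_inclusion G k (K p) (L p) a)"
    if pq: "p \<in> I" "q \<in> I" "p < q" and a: "a \<in> carrier (simplicial_homology G k (K p))" for p q a
  proof -
    obtain c where c: "c \<in> cycles (Suc k) (K p)" "a = homology_class k (K p) c" using a car by blast
    have "c \<in> cycles (Suc k) (K q)" by (rule subsetD[OF cycles_mono[OF monoK[OF pq(3)]] c(1)])
    then show ?thesis
      using c toL[OF pq(1) c(1)] by (simp add: inc KL pq monoK monoL)
  qed
  have sub: "subgroup (W r) (simplicial_homology G k (L r))" if r: "r \<in> I" for r
  proof -
    interpret group "simplicial_homology G k (L r)" by (rule group_simplicial_homology[OF k cL[OF r]])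
    note mult = mult_simplicial_homology[OF k cL[OF r], where G = G]
    have in_L: "c \<in> cycles (Suc k) (L r)" if "c \<in> V r" for c using V(1)[OF r] that by blast
    have one: "homology_class k (L r) 0 = \<one>\<^bsub>simplicial_homology G k (L r)\<^esub>"
    proof -
      have "homology_class k (L r) 0 \<in> carrier (simplicial_homology G k (L r))" by (simp add: car)
      then show ?thesis using mult[of 0 0] l_cancel_one by (metis add.right_neutral zero_in_cycles)
    qed
    show ?thesis
    proof (rule subgroupI)
      show "W r \<subseteq> carrier (simplicial_homology G k (L r))" using V(1)[OF r] by (auto simp: W_def car)
      show "W r \<noteq> {}" using V(2) by (auto simp: W_def)
      fix x assume "x \<in> W r"
      then obtain c where c: "c \<in> V r" "x = homology_class k (L r) c" by (auto simp: W_def)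
      have "inv\<^bsub>simplicial_homology G k (L r)\<^esub> x = homology_class k (L r) (- c)"
      proof (rule inv_equality)
        show "homology_class k (L r) (- c) \<otimes>\<^bsub>simplicial_homology G k (L r)\<^esub> x = \<one>\<^bsub>simplicial_homology G k (L r)\<^esub>"
          using mult[OF in_L[OF V(4)[OF c(1)]] in_L[OF c(1)]] one by (simp add: c(2))
      qed (use in_L[OF V(4)[OF c(1)]] in_L[OF c(1)] in \<open>auto simp: c(2) car\<close>)
      then show "inv\<^bsub>simplicial_homology G k (L r)\<^esub> x \<in> W r" using V(4)[OF c(1)] by (auto simp: W_def)
      fix y assume "y \<in> W r"
      then obtain d where d: "d \<in> V r" "y = homology_class k (L r) d" by (auto simp: W_def)
      show "x \<otimes>\<^bsub>simplicial_homology G k (L r)\<^esub> y \<in> W r"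
        using mult[OF in_L[OF c(1)] in_L[OF d(1)]] V(3)[OF c(1) d(1)] by (auto simp: W_def c d)
    qed
  qed
  have stable: "homology_inclusion G k (L p) (L q) ` W p \<subseteq> W q" if pq: "p \<in> I" "q \<in> I" "p < q" for p q
  proof
    fix x assume "x \<in> homology_inclusion G k (L p) (L q) ` W p"
    then obtain c where c: "c \<in> V p" "x = homology_inclusion G k (L p) (L q) (homology_class k (L p) c)"
      by (auto simp: W_def)
    then have "x = homology_class k (L q) c"
      using inc[OF monoL[OF pq(3)]] V(1)[OF pq(1)] by auto
    then show "x \<in> W q" using c monoV[OF pq(3)] by (auto simp: W_def)
  qed
  have iso: "(\<lambda>(a, w). homology_inclusion G k (K r) (L r) a \<otimes>\<^bsub>simplicial_homology G k (L r)\<^esub> w)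
      \<in> iso (simplicial_homology G k (K r) \<times>\<times> (simplicial_homology G k (L r))\<lparr>carrier := W r\<rparr>) (simplicial_homology G k (L r))"
    (is "?h \<in> iso ?A ?B") if r: "r \<in> I" for r
  proof -
    note multL = mult_simplicial_homology[OF k cL[OF r], where G = G]
    note multK = mult_simplicial_homology[OF k cK[OF r], where G = G]
    have in_L: "c \<in> cycles (Suc k) (L r)" if "c \<in> V r" for c using V(1)[OF r] that by blast
    have h: "?h (homology_class k (K r) a, homology_class k (L r) w) = homology_class k (L r) (a + w)"
      if "a \<in> cycles (Suc k) (K r)" "w \<in> V r" for a w
      using that by (simp add: inc KL r multL toL in_L)
    have carA: "x \<in> carrier ?A \<longleftrightarrow> (\<exists>a\<in>cycles (Suc k) (K r). \<exists>w\<in>V r. x = (homology_class k (K r) a, homology_class k (L r) w))" for x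
      by (cases x) (auto simp: DirProd_def car W_def)
    have "?h \<in> hom ?A ?B"
    proof (rule homI)
      fix x assume "x \<in> carrier ?A"
      then obtain a w where x: "a \<in> cycles (Suc k) (K r)" "w \<in> V r" "x = (homology_class k (K r) a, homology_class k (L r) w)"
        using carA by blast
      then show "?h x \<in> carrier ?B"
        unfolding x(3) h[OF x(1,2)] car using cycles_add[OF toL[OF r x(1)] in_L[OF x(2)]] by blast
      fix y assume "y \<in> carrier ?A"
      then obtain a' w' where y: "a' \<in> cycles (Suc k) (K r)" "w' \<in> V r" "y = (homology_class k (K r) a', homology_class k (L r) w')"
        using carA by blast
      have "x \<otimes>\<^bsub>?A\<^esub> y = (homology_class k (K r) (a + a'), homology_class k (L r) (w + w'))"
        using x y by (simp add: DirProd_def multK multL in_L)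
      then have "?h (x \<otimes>\<^bsub>?A\<^esub> y) = homology_class k (L r) ((a + a') + (w + w'))"
        using h[OF cycles_add[OF x(1) y(1)] V(3)[OF x(2) y(2)]] by simp
      also have "\<dots> = homology_class k (L r) ((a + w) + (a' + w'))" by (simp add: algebra_simps)
      also have "\<dots> = ?h x \<otimes>\<^bsub>?B\<^esub> ?h y"
        unfolding x(3) y(3) h[OF x(1,2)] h[OF y(1,2)]
        using x y by (intro multL[symmetric] cycles_add toL in_L r)
      finally show "?h (x \<otimes>\<^bsub>?A\<^esub> y) = ?h x \<otimes>\<^bsub>?B\<^esub> ?h y" .
    qed
    moreover have "bij_betw ?h (carrier ?A) (carrier ?B)"
    proof (rule bij_betwI')
      fix x y assume "x \<in> carrier ?A" "y \<in> carrier ?A"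
      then obtain a w a' w' where x: "a \<in> cycles (Suc k) (K r)" "w \<in> V r" "x = (homology_class k (K r) a, homology_class k (L r) w)"
        and y: "a' \<in> cycles (Suc k) (K r)" "w' \<in> V r" "y = (homology_class k (K r) a', homology_class k (L r) w')"
        using carA by metis
      show "?h x = ?h y \<longleftrightarrow> x = y"
      proof
        assume "?h x = ?h y"
        then have "homology_class k (L r) (a + w) = homology_class k (L r) (a' + w')"
          unfolding x(3) y(3) h[OF x(1,2)] h[OF y(1,2)] .
        then obtain u where u: "u \<in> alt_chains (Suc (Suc k)) (L r)" "(a + w) - (a' + w') = bd u"
          unfolding homology_class_eq_iff by blast
        have sum: "(a + - a') + (w + - w') = bd u" using u(2) by (simp add: algebra_simps)
        have "a + - a' \<in> bd ` alt_chains (Suc (Suc k)) (K r)"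
          by (rule trivial[OF r cycles_add[OF x(1) cycles_uminus[OF y(1)]] V(3)[OF x(2) V(4)[OF y(2)]] u(1) sum])
        then obtain v where v: "v \<in> alt_chains (Suc (Suc k)) (K r)" "a - a' = bd v" by auto
        have v': "v \<in> alt_chains (Suc (Suc k)) (L r)" by (rule subsetD[OF alt_chains_mono[OF KL[OF r]] v(1)])
        have "w - w' = bd (u - v)" using sum v(2) by (simp add: bd_diff algebra_simps)
        then have "homology_class k (L r) w = homology_class k (L r) w'"
          unfolding homology_class_eq_iff using alt_chains_diff[OF u(1) v'] by blast
        moreover have "homology_class k (K r) a = homology_class k (K r) a'"
          unfolding homology_class_eq_iff using v by blast
        ultimately show "x = y" by (simp add: x y)
      qed simp
    next
      fix x assume "x \<in> carrier ?A"
      then obtain a w where x: "a \<in> cycles (Suc k) (K r)" "w \<in> V r" "x = (homology_class k (K r) a, homology_class k (L r) w)"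
        using carA by blast
      then show "?h x \<in> carrier ?B"
        unfolding x(3) h[OF x(1,2)] car using cycles_add[OF toL[OF r x(1)] in_L[OF x(2)]] by blast
    next
      fix z assume "z \<in> carrier ?B"
      then obtain c where c: "c \<in> cycles (Suc k) (L r)" "z = homology_class k (L r) c" using car by blast
      from spans[OF r c(1)] obtain a w y where d: "a \<in> cycles (Suc k) (K r)" "w \<in> V r"
        "y \<in> alt_chains (Suc (Suc k)) (L r)" "c = a + w + bd y" by blast
      have "z = homology_class k (L r) (a + w)"
        unfolding c(2) homology_class_eq_iff using d(3,4) by (intro bexI[of _ y]) auto
      then have "z = ?h (homology_class k (K r) a, homology_class k (L r) w)" using h[OF d(1,2)] by simp
      then show "\<exists>x\<in>carrier ?A. z = ?h x" using carA d by blast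
    qed
    ultimately show ?thesis by (simp add: iso_def)
  qed
  show ?thesis
    unfolding direct_summand_via_def fst_conv snd_conv
  proof (intro conjI exI[of _ W])
    show "\<forall>p\<in>I. \<forall>q\<in>I. p < q \<longrightarrow> (\<forall>a\<in>carrier (simplicial_homology G k (K p)).
        homology_inclusion G k (K q) (L q) (homology_inclusion G k (K p) (K q) a) =
        homology_inclusion G k (L p) (L q) (homology_inclusion G k (K p) (L p) a))"
      using natural by blast
    show "\<forall>r\<in>I. subgroup (W r) (simplicial_homology G k (L r))" using sub by blast
    show "\<forall>p\<in>I. \<forall>q\<in>I. p < q \<longrightarrow> homology_inclusion G k (L p) (L q) ` W p \<subseteq> W q" using stable by blast
    show "\<forall>r\<in>I. (\<lambda>(a, w). homology_inclusion G k (K r) (L r) a \<otimes>\<^bsub>simplicial_homology G k (L r)\<^esub> w)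
      \<in> iso (simplicial_homology G k (K r) \<times>\<times> (simplicial_homology G k (L r))\<lparr>carrier := W r\<rparr>) (simplicial_homology G k (L r))"
      using iso by blast
  qed
qed


section \<open>Small covers and open stars\<close>

text \<open>The Lebesgue number lemma for a relation \<open>near\<close> in place of a metric. It is
  meant for simplices in a space of functions on an arbitrary vertex set, whose product topology
  need not be metrizable.\<close>

lemma uniform_cover:
  fixes near :: "real \<Rightarrow> 'p::topological_space \<Rightarrow> 'p \<Rightarrow> bool"
  assumes "compact \<Delta>"
    and into: "\<And>U x. open U \<Longrightarrow> x \<in> U \<Longrightarrow> x \<in> \<Delta> \<Longrightarrow> \<exists>\<epsilon>>0. \<forall>y\<in>\<Delta>. near \<epsilon> x y \<longrightarrow> y \<in> U"
    and nbhd: "\<And>x \<epsilon>. x \<in> \<Delta> \<Longrightarrow> 0 < \<epsilon> \<Longrightarrow> \<exists>W. open W \<and> x \<in> W \<and> (\<forall>y\<in>W \<inter> \<Delta>. near \<epsilon> x y)"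
    and tri: "\<And>x y z a b. near a x y \<Longrightarrow> near b y z \<Longrightarrow> near (a + b) x z"
    and mono: "\<And>x y a b. near a x y \<Longrightarrow> a \<le> b \<Longrightarrow> near b x y"
    and cover: "\<And>C. C \<in> \<C> \<Longrightarrow> open C" "\<Delta> \<subseteq> \<Union>\<C>"
  shows "\<exists>\<delta>>0. \<forall>A\<subseteq>\<Delta>. A \<noteq> {} \<longrightarrow> (\<forall>x\<in>A. \<forall>y\<in>A. near \<delta> x y) \<longrightarrow> (\<exists>C\<in>\<C>. A \<subseteq> C)"
proof -
  have "\<exists>C \<epsilon> W. C \<in> \<C> \<and> \<epsilon> > 0 \<and> (\<forall>y\<in>\<Delta>. near \<epsilon> x y \<longrightarrow> y \<in> C) \<and> open W \<and> x \<in> W \<and> (\<forall>y\<in>W \<inter> \<Delta>. near (\<epsilon>/2) x y)"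
    if x: "x \<in> \<Delta>" for x
  proof -
    obtain C where C: "C \<in> \<C>" "x \<in> C" using cover(2) x by blast
    obtain \<epsilon> where e: "\<epsilon> > 0" "\<forall>y\<in>\<Delta>. near \<epsilon> x y \<longrightarrow> y \<in> C" using into[OF cover(1)[OF C(1)] C(2) x] by blast
    obtain W where "open W" "x \<in> W" "\<forall>y\<in>W \<inter> \<Delta>. near (\<epsilon>/2) x y" using nbhd[OF x, of "\<epsilon>/2"] e by auto
    then show ?thesis using C e by blast
  qed
  then obtain C \<epsilon> W where P: "\<And>x. x \<in> \<Delta> \<Longrightarrow> C x \<in> \<C> \<and> \<epsilon> x > 0 \<and> (\<forall>y\<in>\<Delta>. near (\<epsilon> x) x y \<longrightarrow> y \<in> C x)
      \<and> open (W x) \<and> x \<in> W x \<and> (\<forall>y\<in>W x \<inter> \<Delta>. near (\<epsilon> x/2) x y)"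
    by metis
  have "\<Delta> \<subseteq> (\<Union>x\<in>\<Delta>. W x)" using P by blast
  then obtain X where X: "X \<subseteq> \<Delta>" "finite X" "\<Delta> \<subseteq> (\<Union>x\<in>X. W x)"
    using compactE_image[OF assms(1), of \<Delta> W] P by blast
  \<comment> \<open>One half of \<epsilon> x leads from x to some member of A, the other half from
    there to all of A. The element 1 covers the case of an empty X.\<close>
  define \<delta> where "\<delta> = Min (insert 1 ((\<lambda>x. \<epsilon> x / 2) ` X))"
  have d: "\<delta> > 0" using X P unfolding \<delta>_def by (auto simp: subset_iff)
  have d2: "\<delta> \<le> \<epsilon> x / 2" if "x \<in> X" for x
    unfolding \<delta>_def by (rule Min_le) (use that X in auto)
  have "\<exists>C\<in>\<C>. A \<subseteq> C" if A: "A \<subseteq> \<Delta>" "A \<noteq> {}" "\<forall>x\<in>A. \<forall>y\<in>A. near \<delta> x y" for A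
  proof -
    obtain a where a: "a \<in> A" using A by blast
    then obtain x where x: "x \<in> X" "a \<in> W x" using X A by blast
    have xD: "x \<in> \<Delta>" using x X by blast
    have xa: "near (\<epsilon> x / 2) x a" using P[OF xD] x a A by blast
    have "y \<in> C x" if y: "y \<in> A" for y
    proof -
      have "near \<delta> a y" using A a y by blast
      then have "near (\<epsilon> x / 2) a y" using mono d2[OF x(1)] by blast
      then have "near (\<epsilon> x) x y" using tri[OF xa] by fastforce
      then show ?thesis using P[OF xD] y A by blast
    qed
    then show ?thesis using P[OF xD] by blast
  qed
  then show ?thesis using d by blast
qed

section \<open>Closed simplices and the cylinders over them\<close>

lemma compact_closed_simplex:
  assumes "finite \<sigma>"
  shows "compact (closed_simplex \<sigma>)"
proof -
  let ?B = "\<lambda>v. if v \<in> \<sigma> then {0..1::real} else {0}"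
  have "compactin (product_topology (\<lambda>v. euclidean) UNIV) (\<Pi>\<^sub>E v\<in>UNIV. ?B v)"
    unfolding compactin_PiE by simp
  then have c: "compact (\<Pi>\<^sub>E v\<in>UNIV. ?B v)"
    unfolding euclidean_product_topology by simp
  have "continuous_on UNIV (\<lambda>t::'a \<Rightarrow> real. sum t \<sigma>)"
    by (intro continuous_on_sum continuous_on_product_coordinates)
  then have "closed ((\<lambda>t::'a \<Rightarrow> real. sum t \<sigma>) -` {1})"
    by (intro closed_vimage) auto
  then have "compact ((\<Pi>\<^sub>E v\<in>UNIV. ?B v) \<inter> (\<lambda>t. sum t \<sigma>) -` {1})"
    by (rule compact_Int_closed[OF c])
  also have "(\<Pi>\<^sub>E v\<in>UNIV. ?B v) \<inter> (\<lambda>t. sum t \<sigma>) -` {1} = closed_simplex \<sigma>"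
  proof (intro equalityI subsetI)
    fix t assume t: "t \<in> closed_simplex \<sigma>"
    have "t v \<le> 1" if "v \<in> \<sigma>" for v
      using member_le_sum[OF that, of t] t assms by (auto simp: closed_simplex_def)
    then show "t \<in> (\<Pi>\<^sub>E v\<in>UNIV. ?B v) \<inter> (\<lambda>t. sum t \<sigma>) -` {1}"
      using t by (auto simp: closed_simplex_def PiE_iff)
  next
    fix t assume t: "t \<in> (\<Pi>\<^sub>E v\<in>UNIV. ?B v) \<inter> (\<lambda>t. sum t \<sigma>) -` {1}"
    then have "t v \<in> ?B v" for v by blast
    then have "0 \<le> t v \<and> (v \<notin> \<sigma> \<longrightarrow> t v = 0)" for v
      by (metis atLeastAtMost_iff empty_iff insert_iff order_refl)
    then show "t \<in> closed_simplex \<sigma>" using t by (auto simp: closed_simplex_def)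
  qed
  finally show ?thesis .
qed

definition near_point :: "real \<Rightarrow> real \<times> ('a \<Rightarrow> real) \<Rightarrow> real \<times> ('a \<Rightarrow> real) \<Rightarrow> bool" where
  "near_point a p q \<longleftrightarrow> \<bar>fst p - fst q\<bar> \<le> a \<and> (\<forall>v. \<bar>snd p v - snd q v\<bar> \<le> a)"

text \<open>Meant for a homotopy on the cylinder over one simplex: sets small both in time and in
  barycentric coordinates are sent into one member of the cover. Only finitely many coordinates vary
  on the simplex, so uniform closeness of all coordinates describes the product topology
  there.\<close>

lemma closed_simplex_cylinder_cover:
  fixes \<sigma> :: "'a set"
  assumes \<sigma>: "finite \<sigma>"
    and H: "continuous_map (top_of_set ({0..1} \<times> closed_simplex \<sigma>)) Z H"
    and V: "\<And>V. V \<in> \<V> \<Longrightarrow> openin Z V" "topspace Z \<subseteq> \<Union>\<V>"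
  shows "\<exists>\<delta>>0. \<forall>A\<subseteq>{0..1} \<times> closed_simplex \<sigma>. A \<noteq> {} \<longrightarrow> (\<forall>p\<in>A. \<forall>q\<in>A. near_point \<delta> p q)
      \<longrightarrow> (\<exists>V\<in>\<V>. H ` A \<subseteq> V)"
proof -
  let ?D = "{0..1::real} \<times> closed_simplex \<sigma>"
  define \<C> where "\<C> = {C. open C \<and> (\<exists>V\<in>\<V>. H ` (?D \<inter> C) \<subseteq> V)}"
  have D: "compact ?D" by (intro compact_Times compact_closed_simplex \<sigma>) simp
  have cov: "?D \<subseteq> \<Union>\<C>"
  proof
    fix p assume p: "p \<in> ?D"
    then have "H p \<in> topspace Z" using H by (auto simp: continuous_map_def Pi_iff)
    then obtain V where "V \<in> \<V>" "H p \<in> V" using V(2) by blast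
    moreover have "openin (top_of_set ?D) {x \<in> topspace (top_of_set ?D). H x \<in> V}"
      using H V(1)[OF \<open>V \<in> \<V>\<close>] unfolding continuous_map_def by blast
    then obtain C where "open C" "{x \<in> topspace (top_of_set ?D). H x \<in> V} = ?D \<inter> C"
      unfolding openin_open by blast
    ultimately have "C \<in> \<C>" "p \<in> C" using p unfolding \<C>_def by auto
    then show "p \<in> \<Union>\<C>" by blast
  qed
  have "\<exists>\<delta>>0. \<forall>A\<subseteq>?D. A \<noteq> {} \<longrightarrow> (\<forall>x\<in>A. \<forall>y\<in>A. near_point \<delta> x y) \<longrightarrow> (\<exists>C\<in>\<C>. A \<subseteq> C)"
  proof (rule uniform_cover[OF D])
    fix U and p :: "real \<times> ('a \<Rightarrow> real)" assume U: "open U" "p \<in> U" and p: "p \<in> ?D"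
    obtain A B where AB: "open A" "open B" "p \<in> A \<times> B" "A \<times> B \<subseteq> U"
      using open_prod_elim[OF U] by blast
    have "openin (product_topology (\<lambda>i. euclidean) UNIV) B" using AB by (simp add: open_fun_def)
    from product_topology_open_contains_basis[OF this, of "snd p"] AB
    obtain X where X: "snd p \<in> (\<Pi>\<^sub>E i\<in>UNIV. X i)" "\<And>i. openin euclidean (X i)" "(\<Pi>\<^sub>E i\<in>UNIV. X i) \<subseteq> B"
      by auto
    have "\<exists>e>0. cball (snd p v) e \<subseteq> X v" for v
      using X(1) X(2)[of v] open_contains_cball[of "X v"] by (auto simp: PiE_iff)
    then obtain e where e: "\<And>v. e v > 0" "\<And>v. cball (snd p v) (e v) \<subseteq> X v" by metis
    obtain e0 where e0: "e0 > 0" "cball (fst p) e0 \<subseteq> A"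
      using AB open_contains_cball[of A] by (auto simp: mem_Times_iff)
    define \<epsilon> where "\<epsilon> = Min (insert e0 (e ` \<sigma>))"
    have eps: "\<epsilon> > 0" "\<epsilon> \<le> e0" "\<And>v. v \<in> \<sigma> \<Longrightarrow> \<epsilon> \<le> e v"
      using \<sigma> e e0 by (auto simp: \<epsilon>_def)
    have "q \<in> U" if q: "q \<in> ?D" and n: "near_point \<epsilon> p q" for q
    proof -
      have "dist (fst p) (fst q) \<le> e0" using n eps(2) by (auto simp: near_point_def dist_real_def)
      then have "fst q \<in> A" using e0(2) by (auto simp: subset_iff)
      moreover have "snd q v \<in> X v" for v
      proof (cases "v \<in> \<sigma>")
        case True
        have "\<bar>snd p v - snd q v\<bar> \<le> \<epsilon>" using n by (simp add: near_point_def)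
        then have "dist (snd p v) (snd q v) \<le> e v" using eps(3)[OF True] by (simp add: dist_real_def)
        then show ?thesis using e(2)[of v] by (auto simp: subset_iff)
      next
        case False
        then have "snd q v = snd p v" using p q by (auto simp: closed_simplex_def)
        then show ?thesis using X(1) by (auto simp: PiE_iff)
      qed
      then have "snd q \<in> B" using X(3) by (auto simp: PiE_iff)
      ultimately show ?thesis using AB(4) by (auto simp: mem_Times_iff)
    qed
    then show "\<exists>\<epsilon>>0. \<forall>q\<in>?D. near_point \<epsilon> p q \<longrightarrow> q \<in> U" using eps(1) by blast
  next
    fix p :: "real \<times> ('a \<Rightarrow> real)" and \<epsilon> :: real assume p: "p \<in> ?D" and e: "0 < \<epsilon>"
    define B where "B = {y. \<forall>v\<in>\<sigma>. y v \<in> ball (snd p v) \<epsilon>}"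
    have "open B" unfolding B_def using product_topology_basis'[of \<sigma> "\<lambda>v. ball (snd p v) \<epsilon>" "\<lambda>v. v"] \<sigma> by simp
    then have "open (ball (fst p) \<epsilon> \<times> B)" by (intro open_Times) auto
    moreover have "p \<in> ball (fst p) \<epsilon> \<times> B" using e by (simp add: mem_Times_iff B_def)
    moreover have "near_point \<epsilon> p q" if "q \<in> ball (fst p) \<epsilon> \<times> B \<inter> ?D" for q
    proof -
      have "\<bar>snd p v - snd q v\<bar> \<le> \<epsilon>" for v
      proof (cases "v \<in> \<sigma>")
        case True
        then show ?thesis using that by (auto simp: B_def dist_real_def)
      next
        case False
        then show ?thesis using that p e by (auto simp: closed_simplex_def)
      qed
      then show ?thesis using that by (auto simp: near_point_def dist_real_def)
    qed
    ultimately show "\<exists>W. open W \<and> p \<in> W \<and> (\<forall>q\<in>W \<inter> ?D. near_point \<epsilon> p q)" by blast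
  next
    fix p q s :: "real \<times> ('a \<Rightarrow> real)" and a b
    assume pq: "near_point a p q" "near_point b q s"
    have "\<bar>snd p v - snd s v\<bar> \<le> a + b" for v
      using pq[unfolded near_point_def, THEN conjunct2, THEN spec, of v] by linarith
    then show "near_point (a + b) p s" using pq by (auto simp: near_point_def)
  next
    fix p q :: "real \<times> ('a \<Rightarrow> real)" and a b :: real
    assume pq: "near_point a p q" "a \<le> b"
    have "\<bar>snd p v - snd q v\<bar> \<le> b" for v
      using pq(1)[unfolded near_point_def, THEN conjunct2, THEN spec, of v] pq(2) by linarith
    then show "near_point b p q" using pq by (auto simp: near_point_def)
  next
    show "open C" if "C \<in> \<C>" for C using that by (simp add: \<C>_def)
  qed (rule cov)
  then obtain \<delta> where d: "\<delta> > 0" "\<forall>A\<subseteq>?D. A \<noteq> {} \<longrightarrow> (\<forall>x\<in>A. \<forall>y\<in>A. near_point \<delta> x y) \<longrightarrow> (\<exists>C\<in>\<C>. A \<subseteq> C)"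
    by (elim exE conjE)
  have "\<exists>V\<in>\<V>. H ` A \<subseteq> V" if A: "A \<subseteq> ?D" "A \<noteq> {}" "\<forall>x\<in>A. \<forall>y\<in>A. near_point \<delta> x y" for A
  proof -
    obtain C where C: "C \<in> \<C>" "A \<subseteq> C" using d(2)[rule_format, OF A(1,2) A(3)[rule_format]] by blast
    then obtain V where V: "V \<in> \<V>" "H ` (?D \<inter> C) \<subseteq> V" by (auto simp: \<C>_def)
    have "H ` A \<subseteq> H ` (?D \<inter> C)" using C(2) A(1) by (intro image_mono) simp
    then show ?thesis using V by (intro bexI[of _ V]) auto
  qed
  then show ?thesis by (intro exI[of _ \<delta>] conjI d(1) allI impI)
qed

text \<open>The parameter is rounded down to a multiple of 1/n, which is compatible with the period
  1 because n is an integer. On an open parameter interval of length 1/n the product n t ranges over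
  an open interval of length 1, where the floor takes at most two values.\<close>

lemma rounding_exists:
  fixes e :: "real \<Rightarrow> 'y"
  assumes e: "\<And>s t. e s = e t \<longleftrightarrow> s - t \<in> \<int>" and n: "0 < n"
  obtains \<pi> where "\<And>t. \<pi> (e t) = e (real_of_int \<lfloor>real n * t\<rfloor> / real n)"
    "\<And>a. finite (\<pi> ` e ` {a - 1 / (2 * real n)<..<a + 1 / (2 * real n)})"
    "\<And>a. card (\<pi> ` e ` {a - 1 / (2 * real n)<..<a + 1 / (2 * real n)}) \<le> 2"
proof -
  define \<pi> where "\<pi> z = e (real_of_int \<lfloor>real n * (SOME t. e t = z)\<rfloor> / real n)" for z
  have pi: "\<pi> (e t) = e (real_of_int \<lfloor>real n * t\<rfloor> / real n)" for t
  proof -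
    define s where "s = (SOME s. e s = e t)"
    have "e s = e t" unfolding s_def by (rule someI[of _ t]) simp
    then obtain i :: int where i: "s - t = of_int i" using e by (auto elim: Ints_cases)
    have "real n * s = real n * t + of_int (int n * i)" using i by (simp add: algebra_simps)
    then have "\<lfloor>real n * s\<rfloor> = \<lfloor>real n * t\<rfloor> + int n * i" by (metis floor_add_int)
    then have "real_of_int \<lfloor>real n * s\<rfloor> - real_of_int \<lfloor>real n * t\<rfloor> = real n * of_int i" by simp
    then have "real_of_int \<lfloor>real n * s\<rfloor> / real n - real_of_int \<lfloor>real n * t\<rfloor> / real n = of_int i"
      using n by (simp add: diff_divide_distrib[symmetric])
    then have "e (real_of_int \<lfloor>real n * s\<rfloor> / real n) = e (real_of_int \<lfloor>real n * t\<rfloor> / real n)"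
      using e by auto
    then show ?thesis by (simp add: \<pi>_def s_def)
  qed
  have two: "\<pi> ` e ` {a - 1 / (2 * real n)<..<a + 1 / (2 * real n)}
      \<subseteq> {e (real_of_int \<lfloor>real n * a - 1/2\<rfloor> / real n), e (real_of_int (\<lfloor>real n * a - 1/2\<rfloor> + 1) / real n)}" for a
  proof
    fix z assume "z \<in> \<pi> ` e ` {a - 1 / (2 * real n)<..<a + 1 / (2 * real n)}"
    then obtain t where t: "z = \<pi> (e t)" "a - 1 / (2 * real n) < t" "t < a + 1 / (2 * real n)" by auto
    have "real n * a - 1/2 < real n * t" "real n * t < real n * a - 1/2 + 1"
      using t(2,3) n by (simp_all add: field_simps)
    then have "\<lfloor>real n * t\<rfloor> = \<lfloor>real n * a - 1/2\<rfloor> \<or> \<lfloor>real n * t\<rfloor> = \<lfloor>real n * a - 1/2\<rfloor> + 1" by linarith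
    then show "z \<in> {e (real_of_int \<lfloor>real n * a - 1/2\<rfloor> / real n), e (real_of_int (\<lfloor>real n * a - 1/2\<rfloor> + 1) / real n)}"
      using t(1) pi by auto
  qed
  show ?thesis
  proof (rule that[OF pi])
    show "finite (\<pi> ` e ` {a - 1 / (2 * real n)<..<a + 1 / (2 * real n)})" for a
      using two[of a] finite_subset by blast
    show "card (\<pi> ` e ` {a - 1 / (2 * real n)<..<a + 1 / (2 * real n)}) \<le> 2" for a
      using card_mono[OF _ two[of a]] by (simp add: card_insert_if split: if_splits)
  qed
qed

section \<open>Arcs and chords of the unit circle\<close>

lemma norm_cis_minus_1: "norm (cis t - 1) = 2 * \<bar>sin (t / 2)\<bar>"
  using dist_exp_i_1[of t] by (simp add: cis_conv_exp)

lemma norm_cis_diff: "norm (cis s - cis t) = 2 * \<bar>sin ((s - t) / 2)\<bar>"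
proof -
  have "cis s - cis t = cis t * (cis (s - t) - 1)" by (simp add: cis_mult algebra_simps)
  then show ?thesis by (simp add: norm_mult norm_cis_minus_1)
qed

lemma cis_eq_cis_iff: "cis (2 * pi * s) = cis (2 * pi * t) \<longleftrightarrow> s - t \<in> \<int>"
proof -
  have "cis (2 * pi * s) = cis (2 * pi * t) \<longleftrightarrow> (\<exists>n::int. 2 * pi * s = 2 * pi * t + 2 * pi * n)"
    using sin_cos_eq_iff[of "2 * pi * s" "2 * pi * t"] by (auto simp: complex_eq_iff)
  also have "\<dots> \<longleftrightarrow> (\<exists>n::int. s - t = of_int n)"
  proof -
    have "2 * pi * s = 2 * pi * t + 2 * pi * of_int n \<longleftrightarrow> s - t = of_int n" for n
    proof -
      have "2 * pi * s = 2 * pi * t + 2 * pi * of_int n \<longleftrightarrow> 2 * pi * s = 2 * pi * (t + of_int n)"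
        by (simp add: algebra_simps)
      also have "\<dots> \<longleftrightarrow> s = t + of_int n" by simp
      finally show ?thesis by auto
    qed
    then show ?thesis by simp
  qed
  finally show ?thesis by (auto simp: Ints_def)
qed

text \<open>A chord of length 2 sin(pi h) subtends the angle 2 pi h, and up to a half circle the
  chord grows with the angle; hence the bound h \<le> 1/2.\<close>

lemma sphere_near_arc:
  assumes z: "norm z = 1" and d: "dist z (cis (2 * pi * a)) < 2 * sin (pi * h)" and h: "0 < h" "h \<le> 1/2"
  obtains t where "z = cis (2 * pi * t)" "\<bar>t - a\<bar> < h"
proof -
  define w where "w = z * cis (- (2 * pi * a))"
  have w: "norm w = 1" "w \<noteq> 0" using z by (auto simp: w_def norm_mult)
  have z_eq: "z = w * cis (2 * pi * a)" by (simp add: w_def mult.assoc cis_mult)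
  define \<theta> where "\<theta> = Arg w"
  have th: "w = cis \<theta>" "-pi < \<theta>" "\<theta> \<le> pi"
    using cis_Arg[OF w(2)] w(1) Arg_bounded[of w] by (auto simp: \<theta>_def sgn_div_norm)
  have "norm (w - 1) < 2 * sin (pi * h)"
  proof -
    have "z - cis (2 * pi * a) = (w - 1) * cis (2 * pi * a)" by (subst z_eq) (simp add: algebra_simps)
    then show ?thesis using d by (simp add: dist_norm norm_mult)
  qed
  then have "\<bar>sin (\<theta> / 2)\<bar> < sin (pi * h)" unfolding th(1) norm_cis_minus_1 by simp
  then have sin: "sin (\<bar>\<theta>\<bar> / 2) < sin (pi * h)" by (auto simp: abs_if split: if_splits)
  have "\<bar>\<theta>\<bar> / 2 < pi * h"
  proof (rule ccontr)
    assume "\<not> ?thesis"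
    then have "sin (pi * h) \<le> sin (\<bar>\<theta>\<bar> / 2)"
      using th(2,3) h by (intro sin_monotone_2pi_le) (auto intro: order_trans[of _ 0])
    then show False using sin by simp
  qed
  then have "\<bar>\<theta> / (2 * pi)\<bar> < h" by (simp add: field_simps)
  moreover have "z = cis (2 * pi * (a + \<theta> / (2 * pi)))"
    using z_eq th(1) by (simp add: cis_mult distrib_left add.commute)
  ultimately show ?thesis using that[of "a + \<theta> / (2 * pi)"] by simp
qed


section \<open>The relation of being homologous\<close>

definition homologous :: "nat \<Rightarrow> 'a set set \<Rightarrow> ('a list \<Rightarrow>\<^sub>0 'g::ab_group_add) \<Rightarrow> ('a list \<Rightarrow>\<^sub>0 'g) \<Rightarrow> bool" where
  "homologous n K a b \<longleftrightarrow> (\<exists>y\<in>alt_chains (Suc n) K. bd y = a - b)"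

lemma homologous_refl [simp]: "homologous n K a a"
  unfolding homologous_def by (rule bexI[of _ 0]) auto

lemma homologous_trans:
  assumes "homologous n K a b" "homologous n K b c"
  shows "homologous n K a c"
proof -
  obtain y z where "y \<in> alt_chains (Suc n) K" "bd y = a - b" "z \<in> alt_chains (Suc n) K" "bd z = b - c"
    using assms unfolding homologous_def by blast
  then show ?thesis unfolding homologous_def
    by (intro bexI[of _ "y + z"]) (auto simp: bd_add alt_chains_add)
qed

lemma homologous_sym:
  assumes "homologous n K a b"
  shows "homologous n K b a"
proof -
  obtain y where "y \<in> alt_chains (Suc n) K" "bd y = a - b"
    using assms unfolding homologous_def by blast
  then show ?thesis unfolding homologous_def
    by (intro bexI[of _ "- y"]) (auto simp: bd_uminus alt_chains_uminus)
qed

lemma homologous_mono: "homologous n K a b \<Longrightarrow> K \<subseteq> L \<Longrightarrow> homologous n L a b"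
  unfolding homologous_def using subsetD[OF alt_chains_mono[of K L "Suc n"]] by blast

lemma homologous_contiguous:
  assumes "c \<in> alt_chains n K" "bd c = 0" "\<And>S T. S \<in> K \<Longrightarrow> T \<subseteq> S \<Longrightarrow> T \<in> K"
    "\<And>S T. S \<in> K \<Longrightarrow> T \<subseteq> f ` S \<union> g ` S \<Longrightarrow> T \<in> L"
  shows "homologous n L (push (map g) c) (push (map f) c)"
proof -
  obtain y where "y \<in> alt_chains (Suc n) L" "bd y = push (map g) c - push (map f) c"
  proof (rule contiguous_homologous[where L = L and f = f and g = g, OF assms(1,2)])
    show "T \<in> K" if "S \<in> K" "T \<subseteq> S" for S T using assms(3)[OF that] .
    show "T \<in> L" if "S \<in> K" "T \<subseteq> f ` S \<union> g ` S" for S T using assms(4)[OF that] .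
  qed
  then show ?thesis unfolding homologous_def by blast
qed

lemma homologous_chain:
  assumes "\<And>i. i < n \<Longrightarrow> homologous m K (f (Suc i)) (f i)"
  shows "homologous m K (f n) (f 0)"
  using assms
proof (induction n)
  case (Suc n)
  then have "homologous m K (f n) (f 0)" by simp
  then show ?case using Suc.prems[of n] homologous_trans by blast
qed simp

section \<open>Barycentric coordinates, top vertices and open stars\<close>

lemma closed_simplex_mono: "S \<subseteq> T \<Longrightarrow> finite T \<Longrightarrow> closed_simplex S \<subseteq> closed_simplex T"
proof
  fix t assume ST: "S \<subseteq> T" "finite T" and t: "t \<in> closed_simplex S"
  then have "sum t T = sum t S" by (intro sum.mono_neutral_right) (auto simp: closed_simplex_def)
  then show "t \<in> closed_simplex T" using t ST by (auto simp: closed_simplex_def)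
qed

lemma closed_simplex_le_1: "t \<in> closed_simplex S \<Longrightarrow> finite S \<Longrightarrow> t v \<le> 1"
  using member_le_sum[of v S t] by (cases "v \<in> S") (auto simp: closed_simplex_def)

lemma closed_simplex_ex_pos:
  assumes "t \<in> closed_simplex S"
  obtains v where "v \<in> S" "0 < t v"
proof -
  have "sum t S \<noteq> 0" using assms by (simp add: closed_simplex_def)
  then obtain v where "v \<in> S" "t v \<noteq> 0" by (rule sum.not_neutral_contains_not_neutral)
  then show ?thesis using that[of v] assms by (simp add: closed_simplex_def less_le)
qed

text \<open>Picks a vertex of largest barycentric coordinate, which exists for points of finite
  simplices. This is a simplicial approximation of the identity: a point of a simplex goes to one of
  its vertices.\<close>

definition top_vertex :: "('a \<Rightarrow> real) \<Rightarrow> 'a" where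
  "top_vertex t = (SOME w. \<forall>v. t v \<le> t w)"

lemma top_vertex_max:
  assumes "t \<in> closed_simplex S" "finite S"
  shows "t v \<le> t (top_vertex t)"
proof -
  obtain u where u: "u \<in> S" "0 < t u" using closed_simplex_ex_pos[OF assms(1)] .
  have "Max (t ` S) \<in> t ` S" using assms(2) u(1) by (intro Max_in) auto
  then obtain w where w: "w \<in> S" "t w = Max (t ` S)" by auto
  then have w: "w \<in> S" "\<And>v. v \<in> S \<Longrightarrow> t v \<le> t w" using assms(2) by auto
  have "t v \<le> t w" for v
    using w(2)[of v] w(2)[OF u(1)] u(2) assms(1) by (cases "v \<in> S") (auto simp: closed_simplex_def)
  then have "\<forall>v. t v \<le> t (top_vertex t)"
    unfolding top_vertex_def by (intro someI[of "\<lambda>w. \<forall>v. t v \<le> t w" w]) blast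
  then show ?thesis by blast
qed

lemma top_vertex_in:
  assumes "t \<in> closed_simplex S" "finite S"
  shows "top_vertex t \<in> S"
proof -
  obtain u where u: "u \<in> S" "0 < t u" using closed_simplex_ex_pos[OF assms(1)] .
  then have "0 < t (top_vertex t)" using top_vertex_max[OF assms, of u] by simp
  then show ?thesis using assms(1) by (auto simp: closed_simplex_def)
qed

text \<open>Smaller than the usual open star of w: the coordinate of w also exceeds all coordinates
  outside S. Thus the top vertices of all its points lie in the one simplex S, which is what
  contiguity needs. The set is empty unless w lies in S.\<close>

definition open_star :: "'a set set \<Rightarrow> 'a \<Rightarrow> 'a set \<Rightarrow> ('a \<Rightarrow> real) set" where
  "open_star K w S = {y \<in> (\<Union>T\<in>K. closed_simplex T). 0 < y w \<and> (\<forall>v. v \<notin> S \<longrightarrow> y v < y w)}"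

lemma top_vertex_open_star:
  assumes "y \<in> open_star K w S" "\<And>T. T \<in> K \<Longrightarrow> finite T"
  shows "top_vertex y \<in> S"
proof (rule ccontr)
  assume "top_vertex y \<notin> S"
  then have "y (top_vertex y) < y w" using assms(1) by (simp add: open_star_def)
  moreover obtain T where "T \<in> K" "y \<in> closed_simplex T" using assms(1) by (auto simp: open_star_def)
  ultimately show False using top_vertex_max[of y T w] assms(2) by fastforce
qed

text \<open>The weak topology tests openness on one closed simplex at a time, and there all but
  finitely many of the defining inequalities compare 0 with a positive number.\<close>

lemma openin_open_star:
  assumes "\<And>T. T \<in> K \<Longrightarrow> finite T"
  shows "openin (geometric_realization K) (open_star K w S)"
  unfolding openin_geometric_realization
proof (intro conjI ballI)
  show "open_star K w S \<subseteq> (\<Union>T\<in>K. closed_simplex T)" by (auto simp: open_star_def)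
  fix T assume T: "T \<in> K"
  have "open {y :: 'a \<Rightarrow> real. 0 < y w}"
    by (intro open_Collect_less continuous_on_const continuous_on_product_coordinates)
  moreover have "open (\<Inter>v\<in>T - S. {y :: 'a \<Rightarrow> real. y v < y w})"
    using assms[OF T] by (intro open_INT ballI open_Collect_less continuous_on_product_coordinates) auto
  moreover have "closed_simplex T \<inter> open_star K w S =
      closed_simplex T \<inter> ({y. 0 < y w} \<inter> (\<Inter>v\<in>T - S. {y. y v < y w}))"
  proof (intro equalityI subsetI)
    fix y assume y: "y \<in> closed_simplex T \<inter> ({y. 0 < y w} \<inter> (\<Inter>v\<in>T - S. {y. y v < y w}))"
    have "y v < y w" if "v \<notin> S" for v
      using y that by (cases "v \<in> T") (auto simp: closed_simplex_def)
    then show "y \<in> closed_simplex T \<inter> open_star K w S" using y T by (auto simp: open_star_def)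
  qed (auto simp: open_star_def)
  ultimately show "openin (top_of_set (closed_simplex T)) (closed_simplex T \<inter> open_star K w S)"
    by (simp only: openin_open_Int open_Int)
qed

lemma topspace_geometric_realization: "topspace (geometric_realization K) = (\<Union>T\<in>K. closed_simplex T)"
proof
  have "openin (geometric_realization K) (topspace (geometric_realization K))" by (rule openin_topspace)
  then show "topspace (geometric_realization K) \<subseteq> (\<Union>T\<in>K. closed_simplex T)"
    unfolding openin_geometric_realization by blast
  have "openin (geometric_realization K) (\<Union>T\<in>K. closed_simplex T)"
    unfolding openin_geometric_realization openin_open by (auto intro!: exI[of _ UNIV])
  then show "(\<Union>T\<in>K. closed_simplex T) \<subseteq> topspace (geometric_realization K)" by (rule openin_subset)
qed

lemma open_star_cover: "(\<Union>T\<in>K. closed_simplex T) \<subseteq> \<Union>{open_star K w S | w S. S \<in> K}"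
proof
  fix y assume "y \<in> (\<Union>T\<in>K. closed_simplex T)"
  then obtain T where T: "T \<in> K" "y \<in> closed_simplex T" by blast
  obtain w where w: "w \<in> T" "0 < y w" using closed_simplex_ex_pos[OF T(2)] .
  then have "y \<in> open_star K w T" using T by (auto simp: open_star_def closed_simplex_def)
  then show "y \<in> \<Union>{open_star K w S | w S. S \<in> K}" using T(1) by blast
qed

lemma continuous_map_closed_simplex:
  assumes "T \<in> K"
  shows "continuous_map (top_of_set (closed_simplex T)) (geometric_realization K) (\<lambda>x. x)"
  unfolding continuous_map_def topspace_geometric_realization
proof (intro conjI allI impI)
  show "(\<lambda>x. x) \<in> topspace (top_of_set (closed_simplex T)) \<rightarrow> (\<Union>T\<in>K. closed_simplex T)"
    using assms by auto
  fix U assume "openin (geometric_realization K) U"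
  then have "openin (top_of_set (closed_simplex T)) (closed_simplex T \<inter> U)"
    using assms unfolding openin_geometric_realization by blast
  then show "openin (top_of_set (closed_simplex T)) {x \<in> topspace (top_of_set (closed_simplex T)). x \<in> U}"
    by (simp add: Int_def)
qed

text \<open>The arcs U are so short that the rounding has at most two values on U and that h sends U
  together with its rounded points into one member of the cover. Hence inserting the rounding before
  h will be a contiguous change after passing to top vertices.\<close>

lemma circle_rounding_cover:
  fixes h :: "complex \<Rightarrow> 'y"
  assumes h: "continuous_map (top_of_set (sphere 0 1)) Z h"
    and V: "\<And>V. V \<in> \<V> \<Longrightarrow> openin Z V" "topspace Z \<subseteq> \<Union>\<V>"
  obtains \<pi> :: "complex \<Rightarrow> complex" where
    "\<And>z. z \<in> sphere 0 1 \<Longrightarrow> \<exists>U. openin (top_of_set (sphere 0 1)) U \<and> z \<in> U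
      \<and> finite (\<pi> ` U) \<and> card (\<pi> ` U) \<le> 2 \<and> (\<exists>V\<in>\<V>. h ` (U \<union> \<pi> ` U) \<subseteq> V)"
proof -
  define \<C> where "\<C> = {C. open C \<and> (\<exists>V\<in>\<V>. h ` (sphere 0 1 \<inter> C) \<subseteq> V)}"
  have cov: "sphere 0 1 \<subseteq> \<Union>\<C>"
  proof
    fix p :: complex assume p: "p \<in> sphere 0 1"
    then have "h p \<in> topspace Z" using h by (auto simp: continuous_map_def Pi_iff)
    then obtain V where V1: "V \<in> \<V>" "h p \<in> V" using V(2) by blast
    have "openin (top_of_set (sphere 0 1)) {x \<in> topspace (top_of_set (sphere 0 1)). h x \<in> V}"
      using h V(1)[OF V1(1)] unfolding continuous_map_def by blast
    then obtain C where "open C" "{x \<in> topspace (top_of_set (sphere 0 1)). h x \<in> V} = sphere 0 1 \<inter> C"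
      unfolding openin_open by blast
    then have "C \<in> \<C>" "p \<in> C" using p V1 unfolding \<C>_def by auto
    then show "p \<in> \<Union>\<C>" by blast
  qed
  have ne: "\<C> \<noteq> {}" using cov by force
  have op: "open B" if "B \<in> \<C>" for B using that by (simp add: \<C>_def)
  obtain \<delta> where d: "0 < \<delta>" "\<And>T. T \<subseteq> sphere 0 1 \<Longrightarrow> diameter T < \<delta> \<Longrightarrow> \<exists>B\<in>\<C>. T \<subseteq> B"
    by (rule Lebesgue_number_lemma[OF compact_sphere ne cov op]) (assumption | blast)+
  \<comment> \<open>Points of U and of its rounding have parameters within 2/n of a, so any two
    differ by at most 4/n; the parametrization is 2 pi-Lipschitz, which makes the diameter at most 8
    pi / n.\<close>
  obtain n :: nat where n: "n > 0" "8 * pi / \<delta> < real n"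
  proof -
    obtain n :: nat where n: "8 * pi / \<delta> < real n" using reals_Archimedean2 by blast
    moreover have "0 < 8 * pi / \<delta>" using d(1) by simp
    ultimately have "0 < real n" by linarith
    then show ?thesis using n that by simp
  qed
  define e where "e t = cis (2 * pi * t)" for t
  have lip: "dist (e s) (e t) \<le> 2 * pi * \<bar>s - t\<bar>" for s t
  proof -
    have "\<bar>sin ((2 * pi * s - 2 * pi * t) / 2)\<bar> \<le> \<bar>(2 * pi * s - 2 * pi * t) / 2\<bar>" by (rule abs_sin_x_le_abs_x)
    also have "\<dots> = pi * \<bar>s - t\<bar>" by (simp add: right_diff_distrib[symmetric] abs_mult)
    finally show ?thesis by (simp add: e_def dist_norm norm_cis_diff)
  qed
  have eq: "e s = e t \<longleftrightarrow> s - t \<in> \<int>" for s t unfolding e_def by (rule cis_eq_cis_iff)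
  obtain \<pi> where pi: "\<And>t. \<pi> (e t) = e (real_of_int \<lfloor>real n * t\<rfloor> / real n)"
    and fin: "\<And>a. finite (\<pi> ` e ` {a - 1 / (2 * real n)<..<a + 1 / (2 * real n)})"
    and card: "\<And>a. card (\<pi> ` e ` {a - 1 / (2 * real n)<..<a + 1 / (2 * real n)}) \<le> 2"
    by (rule rounding_exists[OF eq n(1)]) (rule that)
  show ?thesis
  proof (rule that[of \<pi>])
    fix z :: complex assume z: "z \<in> sphere 0 1"
    define a where "a = Arg z / (2 * pi)"
    have "z \<noteq> 0" "norm z = 1" using z by auto
    then have za: "z = e a" using cis_Arg[of z] by (simp add: e_def a_def sgn_div_norm)
    \<comment> \<open>The radius is the chord belonging to the parameter difference 1 / (2 n), so U
      lies over the interval on which the rounding has at most two values.\<close>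
    define U where "U = sphere 0 1 \<inter> ball z (2 * sin (pi * (1 / (2 * real n))))"
    let ?I = "{a - 1 / (2 * real n)<..<a + 1 / (2 * real n)}"
    have U_arc: "U \<subseteq> e ` ?I"
    proof
      fix u assume u: "u \<in> U"
      have "1 / (2 * real n) \<le> 1 / 2" using n(1) by (simp add: field_simps)
      moreover have "dist u (cis (2 * pi * a)) < 2 * sin (pi * (1 / (2 * real n)))" "norm u = 1"
        using u za by (auto simp: U_def e_def dist_commute)
      ultimately obtain t where "u = cis (2 * pi * t)" "\<bar>t - a\<bar> < 1 / (2 * real n)"
        using sphere_near_arc[of u a "1 / (2 * real n)"] n(1) by auto
      then show "u \<in> e ` ?I" by (auto simp: e_def abs_less_iff intro!: imageI)
    qed
    have near: "\<exists>t. x = e t \<and> \<bar>t - a\<bar> \<le> 2 / real n" if x: "x \<in> U \<union> \<pi> ` U" for x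
    proof -
      have arc: "\<exists>t. \<bar>t - a\<bar> < 1 / (2 * real n) \<and> u = e t" if u: "u \<in> U" for u
      proof -
        obtain t where "t \<in> ?I" "u = e t" using U_arc u by blast
        then show ?thesis by (intro exI[of _ t]) (auto simp: abs_less_iff)
      qed
      obtain t where t: "\<bar>t - a\<bar> < 1 / (2 * real n)" "x = e t \<or> x = \<pi> (e t)"
      proof (cases "x \<in> U")
        case True
        then show ?thesis using arc[OF True] that by blast
      next
        case False
        then obtain u where "u \<in> U" "x = \<pi> u" using x by blast
        then show ?thesis using arc[of u] that by blast
      qed
      have small: "1 / (2 * real n) \<le> 1 / real n" using n(1) by (simp add: field_simps)
      have "real_of_int \<lfloor>real n * t\<rfloor> \<le> real n * t" "real n * t - 1 < real_of_int \<lfloor>real n * t\<rfloor>" by linarith+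
      then have "real_of_int \<lfloor>real n * t\<rfloor> / real n \<le> t" "(real n * t - 1) / real n \<le> real_of_int \<lfloor>real n * t\<rfloor> / real n"
        using n(1) by (simp add: field_simps, intro divide_right_mono) auto
      moreover have "(real n * t - 1) / real n = t - 1 / real n" using n(1) by (simp add: field_simps)
      ultimately have fl: "real_of_int \<lfloor>real n * t\<rfloor> / real n \<le> t" "t - 1 / real n \<le> real_of_int \<lfloor>real n * t\<rfloor> / real n"
        by simp_all
      have "\<bar>real_of_int \<lfloor>real n * t\<rfloor> / real n - a\<bar> \<le> 2 / real n"
        using fl t(1) small by (simp add: abs_le_iff abs_less_iff)
      moreover have "\<bar>t - a\<bar> \<le> 2 / real n" using t(1) small by (simp add: abs_le_iff abs_less_iff)
      ultimately show ?thesis using t(2) pi by auto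
    qed
    have "diameter (U \<union> \<pi> ` U) \<le> 8 * pi / real n"
    proof (rule diameter_le)
      show "U \<union> \<pi> ` U \<noteq> {} \<or> 0 \<le> 8 * pi / real n" by simp
      fix x y assume "x \<in> U \<union> \<pi> ` U" "y \<in> U \<union> \<pi> ` U"
      then obtain s t where st: "x = e s" "\<bar>s - a\<bar> \<le> 2 / real n" "y = e t" "\<bar>t - a\<bar> \<le> 2 / real n" using near by metis
      have "dist x y \<le> 2 * pi * \<bar>s - t\<bar>" unfolding st by (rule lip)
      also have "\<dots> \<le> 2 * pi * (4 / real n)" using st(2,4) by (intro mult_left_mono) auto
      finally show "norm (x - y) \<le> 8 * pi / real n" by (simp add: dist_norm)
    qed
    also have "\<dots> < \<delta>" using n d(1) by (simp add: field_simps)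
    finally have diam: "diameter (U \<union> \<pi> ` U) < \<delta>" .
    have sphere: "U \<union> \<pi> ` U \<subseteq> sphere 0 1"
    proof
      fix x assume "x \<in> U \<union> \<pi> ` U"
      then obtain t where "x = e t" using near by blast
      then show "x \<in> sphere 0 1" by (simp add: e_def)
    qed
    obtain B where B: "B \<in> \<C>" "U \<union> \<pi> ` U \<subseteq> B" using d(2)[OF sphere diam] by (rule bexE)
    with sphere have B: "B \<in> \<C>" "U \<union> \<pi> ` U \<subseteq> sphere 0 1 \<inter> B" by auto
    then obtain V where V1: "V \<in> \<V>" "h ` (sphere 0 1 \<inter> B) \<subseteq> V" by (auto simp: \<C>_def)
    have "h ` (U \<union> \<pi> ` U) \<subseteq> V" using image_mono[OF B(2), of h] V1(2) by (rule order_trans)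
    then have V': "\<exists>V\<in>\<V>. h ` (U \<union> \<pi> ` U) \<subseteq> V" using V1(1) by (rule bexI)
    have sub: "\<pi> ` U \<subseteq> \<pi> ` e ` ?I" using U_arc by blast
    have "0 < sin (pi * (1 / (2 * real n)))" using n(1) by (intro sin_gt_zero) (auto simp: field_simps)
    then have "z \<in> U" using z by (simp add: U_def)
    moreover have "openin (top_of_set (sphere 0 1)) U" unfolding U_def by (simp add: openin_open_Int)
    ultimately show "\<exists>U. openin (top_of_set (sphere 0 1)) U \<and> z \<in> U
      \<and> finite (\<pi> ` U) \<and> card (\<pi> ` U) \<le> 2 \<and> (\<exists>V\<in>\<V>. h ` (U \<union> \<pi> ` U) \<subseteq> V)"
      using V' finite_subset[OF sub fin] order_trans[OF card_mono[OF fin sub] card] by blast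
  qed
qed


section \<open>Complexes homotopy equivalent to the circle\<close>

lemma closed_simplex_affine:
  assumes "x \<in> closed_simplex S" "y \<in> closed_simplex S" "0 \<le> a" "a \<le> 1"
  shows "(\<lambda>v. (1 - a) * x v + a * y v) \<in> closed_simplex S"
  using assms by (auto simp: closed_simplex_def sum.distrib sum_distrib_left[symmetric])

lemma closed_simplex_vertex: "v \<in> S \<Longrightarrow> finite S \<Longrightarrow> (\<lambda>u. if u = v then 1 else 0) \<in> closed_simplex S"
  by (auto simp: closed_simplex_def)

lemma uniform_finite:
  fixes P :: "'i \<Rightarrow> real \<Rightarrow> bool"
  assumes "finite I" "\<And>i. i \<in> I \<Longrightarrow> \<exists>\<delta>>0. P i \<delta>" "\<And>i a b. P i a \<Longrightarrow> b \<le> a \<Longrightarrow> P i b"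
  shows "\<exists>\<delta>>0. \<forall>i\<in>I. P i \<delta>"
  using assms(1,2)
proof (induction I rule: finite_induct)
  case (insert i I)
  obtain a where a: "a > 0" "P i a" using insert.prems[of i] by blast
  obtain b where b: "b > 0" "\<forall>j\<in>I. P j b" using insert.IH insert.prems by blast
  show ?case
    by (rule exI[of _ "min a b"]) (use a b assms(3)[of i a "min a b"] assms(3)[of _ b "min a b"] in auto)
qed (auto intro: exI[of _ 1])

text \<open>The straight line contraction of a simplex to a chosen vertex. Coordinates lie between 0
  and 1, so one of the M steps changes each of them by at most 1/M, while the differences between
  points do not grow.\<close>

lemma contracted_carriers_closed_simplex:
  assumes L: "\<And>S. S \<in> L \<Longrightarrow> finite S" "\<And>S T. S \<in> L \<Longrightarrow> T \<subseteq> S \<Longrightarrow> T \<in> L" and M: "0 < M"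
  shows "contracted_carriers L closed_simplex
    (\<lambda>S i x v. (1 - real i / real M) * x v + real i / real M * (if v = (SOME u. u \<in> S) then 1 else 0))
    M (\<lambda>S v. if v = (SOME u. u \<in> S) then 1 else 0) (\<lambda>a x y. \<forall>v. \<bar>x v - y v\<bar> \<le> a) (1 / real M)"
proof
  fix S i and x :: "'a \<Rightarrow> real" assume S: "S \<in> L" "S \<noteq> {}" and x: "x \<in> closed_simplex S" and i: "i \<le> M"
  have v: "(\<lambda>v. if v = (SOME u. u \<in> S) then 1 else 0) \<in> closed_simplex S"
    using S some_in_eq L(1) by (intro closed_simplex_vertex) auto
  show "(\<lambda>v. (1 - real i / real M) * x v + real i / real M * (if v = (SOME u. u \<in> S) then 1 else 0)) \<in> closed_simplex S"
    using closed_simplex_affine[OF x v, of "real i / real M"] i M by simp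
next
  fix S assume S: "S \<in> L" "S \<noteq> {}"
  show "(\<lambda>v. if v = (SOME u. u \<in> S) then 1 else 0) \<in> closed_simplex S"
    using S some_in_eq L(1) by (intro closed_simplex_vertex) auto
next
  fix S i j a and x y :: "'a \<Rightarrow> real"
  assume S: "S \<in> L" "S \<noteq> {}" and x: "x \<in> closed_simplex S" and y: "y \<in> closed_simplex S"
    and ij: "i \<le> M" "j \<le> M" "i \<le> Suc j" "j \<le> Suc i" and a: "0 \<le> a" "\<forall>v. \<bar>x v - y v\<bar> \<le> a"
  define b :: "'a \<Rightarrow> real" where "b v = (if v = (SOME u. u \<in> S) then 1 else 0)" for v
  have "\<bar>((1 - real i / real M) * x v + real i / real M * b v) - ((1 - real j / real M) * y v + real j / real M * b v)\<bar>
      \<le> a + 1 / real M" for v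
  proof -
    have eq: "((1 - real i / real M) * x v + real i / real M * b v) - ((1 - real j / real M) * y v + real j / real M * b v)
      = (1 - real i / real M) * (x v - y v) + (real i / real M - real j / real M) * (b v - y v)"
    proof -
      have "((1 - p) * x v + p * b v) - ((1 - q) * y v + q * b v) = (1 - p) * (x v - y v) + (p - q) * (b v - y v)" for p q
        by (simp add: algebra_simps)
      then show ?thesis .
    qed
    have "\<bar>(1 - real i / real M) * (x v - y v)\<bar> \<le> 1 * a"
      unfolding abs_mult using a ij M by (intro mult_mono) auto
    moreover have "\<bar>(real i / real M - real j / real M) * (b v - y v)\<bar> \<le> (1 / real M) * 1"
      unfolding abs_mult
    proof (rule mult_mono)
      have "\<bar>real i - real j\<bar> \<le> 1" using ij by auto
      then show "\<bar>real i / real M - real j / real M\<bar> \<le> 1 / real M"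
        using M by (simp add: diff_divide_distrib[symmetric] divide_right_mono)
      have "0 \<le> y v" "y v \<le> 1" using y closed_simplex_le_1[OF y] L(1)[OF S(1)] by (auto simp: closed_simplex_def)
      then show "\<bar>b v - y v\<bar> \<le> 1" by (auto simp: b_def)
    qed auto
    moreover have "\<bar>A + B\<bar> \<le> a + 1 / real M" if "\<bar>A\<bar> \<le> 1 * a" "\<bar>B\<bar> \<le> 1 / real M * 1" for A B
      using that abs_triangle_ineq[of A B] by simp
    ultimately show ?thesis unfolding eq by blast
  qed
  then show "\<forall>v. \<bar>((1 - real i / real M) * x v + real i / real M * (if v = (SOME u. u \<in> S) then 1 else 0)) -
      ((1 - real j / real M) * y v + real j / real M * (if v = (SOME u. u \<in> S) then 1 else 0))\<bar> \<le> a + 1 / real M"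
    unfolding b_def by blast
next
  fix S T assume "S \<in> L" "T \<subseteq> S"
  then show "closed_simplex T \<subseteq> closed_simplex S" using L(1) by (intro closed_simplex_mono) auto
qed (use L M in auto)

text \<open>
  A cycle is subdivided until the given homotopy can be followed, step by step, by contiguous vertex
  maps. In the end the cycle is pushed through a map that rounds the circle to finitely many points,
  hence through a complex of dimension one.
\<close>

theorem homotopy_circle_homology_vanishes:
  fixes K :: "'a set set" and z :: "'a list \<Rightarrow>\<^sub>0 'g::ab_group_add"
  assumes K: "simplicial_complex K" and fin: "\<And>S. S \<in> K \<Longrightarrow> finite S"
    and circ: "geometric_realization K homotopy_equivalent_space top_of_set (sphere (0::complex) 1)"
    and N: "3 \<le> N" and z: "z \<in> alt_chains N K" "bd z = 0"
  shows "homologous N (insert {} K) z 0"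
proof -
  let ?X = "geometric_realization K" and ?S1 = "top_of_set (sphere (0::complex) 1)"
  obtain f h where f: "continuous_map ?X ?S1 f" and h: "continuous_map ?S1 ?X h"
    and hf: "homotopic_with (\<lambda>x. True) ?X ?X (h \<circ> f) id"
    using circ unfolding homotopy_equivalent_space_def by blast
  obtain H where H: "continuous_map (prod_topology (top_of_set {0..1::real}) ?X) ?X H"
    and H0: "\<And>x. H (0, x) = h (f x)" and H1: "\<And>x. H (1, x) = x"
    using hf unfolding homotopic_with_def by auto
  define \<V> where "\<V> = {open_star K w S | w S. S \<in> K}"
  have V: "openin ?X V" if "V \<in> \<V>" for V
    using that openin_open_star[of K] fin by (auto simp: \<V>_def)
  have V_cover: "topspace ?X \<subseteq> \<Union>\<V>"
    unfolding topspace_geometric_realization \<V>_def by (rule open_star_cover)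
  have top_V: "\<exists>S\<in>K. top_vertex ` Y \<subseteq> S" if VY: "V \<in> \<V>" "Y \<subseteq> V" for V Y
  proof -
    obtain u S where S: "S \<in> K" "V = open_star K u S" using VY(1) by (auto simp: \<V>_def)
    have "top_vertex y \<in> S" if "y \<in> Y" for y
      by (rule top_vertex_open_star[of y K u S]) (use that VY(2) S(2) fin in auto)
    then show ?thesis using S(1) by blast
  qed
  obtain \<pi> :: "complex \<Rightarrow> complex" where \<pi>:
    "\<And>z. z \<in> sphere 0 1 \<Longrightarrow> \<exists>U. openin ?S1 U \<and> z \<in> U
      \<and> finite (\<pi> ` U) \<and> card (\<pi> ` U) \<le> 2 \<and> (\<exists>V\<in>\<V>. h ` (U \<union> \<pi> ` U) \<subseteq> V)"
    by (rule circle_rounding_cover[OF h V V_cover]) (assumption, rule that)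
  define \<U> where "\<U> = {U. openin ?S1 U \<and> finite (\<pi> ` U) \<and> card (\<pi> ` U) \<le> 2 \<and> (\<exists>V\<in>\<V>. h ` (U \<union> \<pi> ` U) \<subseteq> V)}"
  have U: "openin ?S1 U" if "U \<in> \<U>" for U using that by (simp add: \<U>_def)
  have U_cover: "topspace ?S1 \<subseteq> \<Union>\<U>"
  proof
    fix x assume "x \<in> topspace ?S1"
    then have "x \<in> sphere 0 1" by simp
    from \<pi>[OF this] show "x \<in> \<Union>\<U>" unfolding \<U>_def by blast
  qed
  \<comment> \<open>One \<delta> per simplex for both covers: for H on the cylinder, and for f, read
    on the cylinder as a map independent of time.\<close>
  define adapted where "adapted S \<delta> \<longleftrightarrow> (\<forall>A\<subseteq>{0..1} \<times> closed_simplex S. A \<noteq> {} \<longrightarrow> (\<forall>p\<in>A. \<forall>q\<in>A. near_point \<delta> p q)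
      \<longrightarrow> (\<exists>V\<in>\<V>. H ` A \<subseteq> V) \<and> (\<exists>U\<in>\<U>. (\<lambda>p. f (snd p)) ` A \<subseteq> U))" for S \<delta>
  have adapted_mono: "adapted S b" if "adapted S a" "b \<le> a" for S a b
  proof -
    have "near_point a p q" if "near_point b p q" for p q
      using that \<open>b \<le> a\<close> unfolding near_point_def by (meson order_trans)
    then show ?thesis using \<open>adapted S a\<close> unfolding adapted_def by meson
  qed
  have adapted_ex: "\<exists>\<delta>>0. adapted S \<delta>" if S: "S \<in> K" for S
  proof -
    let ?D = "{0..1::real} \<times> closed_simplex S"
    have s: "continuous_map (top_of_set ?D) ?X snd"
    proof -
      have "continuous_map (top_of_set ?D) (top_of_set (closed_simplex S)) snd"
        by (auto simp: continuous_map_subtopology_eu intro!: continuous_on_fst continuous_on_snd continuous_on_id)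
      from continuous_map_compose[OF this continuous_map_closed_simplex[OF S]] show ?thesis by (simp add: o_def)
    qed
    have "continuous_map (top_of_set ?D) (top_of_set {0..1}) fst"
      by (auto simp: continuous_map_subtopology_eu intro!: continuous_on_fst continuous_on_snd continuous_on_id)
    with s have "continuous_map (top_of_set ?D) (prod_topology (top_of_set {0..1}) ?X) (\<lambda>p. p)"
      by (simp add: continuous_map_pairwise o_def)
    from continuous_map_compose[OF this H] have cH: "continuous_map (top_of_set ?D) ?X H" by (simp add: o_def)
    from continuous_map_compose[OF s f] have cf: "continuous_map (top_of_set ?D) ?S1 (\<lambda>p. f (snd p))" by (simp add: o_def)
    obtain a where a: "a > 0" "\<And>A. A \<subseteq> ?D \<Longrightarrow> A \<noteq> {} \<Longrightarrow> (\<forall>p\<in>A. \<forall>q\<in>A. near_point a p q) \<Longrightarrow> \<exists>V\<in>\<V>. H ` A \<subseteq> V"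
      using closed_simplex_cylinder_cover[OF fin[OF S] cH V V_cover] by meson
    obtain b where b: "b > 0" "\<And>A. A \<subseteq> ?D \<Longrightarrow> A \<noteq> {} \<Longrightarrow> (\<forall>p\<in>A. \<forall>q\<in>A. near_point b p q) \<Longrightarrow> \<exists>U\<in>\<U>. (\<lambda>p. f (snd p)) ` A \<subseteq> U"
      using closed_simplex_cylinder_cover[OF fin[OF S] cf U U_cover] by meson
    have mono: "near_point a p q" "near_point b p q" if "near_point (min a b) p q" for p q
      using that by (auto simp: near_point_def)
    have "adapted S (min a b)"
      unfolding adapted_def
    proof (intro allI impI conjI)
      fix A assume A: "A \<subseteq> ?D" "A \<noteq> {}" "\<forall>p\<in>A. \<forall>q\<in>A. near_point (min a b) p q"
      show "\<exists>V\<in>\<V>. H ` A \<subseteq> V" using a(2)[OF A(1,2)] A(3) mono(1) by blast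
      show "\<exists>U\<in>\<U>. (\<lambda>p. f (snd p)) ` A \<subseteq> U" using b(2)[OF A(1,2)] A(3) mono(2) by blast
    qed
    then show ?thesis using a(1) b(1) by (intro exI[of _ "min a b"]) simp
  qed
  have zK: "set xs \<in> K" if "xs \<in> keys z" for xs using z(1) that by (auto simp: alt_chains_def)
  have "\<exists>\<delta>>0. \<forall>S\<in>set ` keys z. adapted S \<delta>"
    by (rule uniform_finite) (use zK adapted_ex adapted_mono in auto)
  then obtain \<delta> where d: "\<delta> > 0" "\<And>xs. xs \<in> keys z \<Longrightarrow> adapted (set xs) \<delta>" by auto
  \<comment> \<open>Subdivision in degree N has mesh N/M, which must not exceed \<delta>; the time
    step 1/M then does not exceed it either.\<close>
  obtain M :: nat where M: "real N / \<delta> < real M" using reals_Archimedean2 by blast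
  have "0 \<le> real N / \<delta>" using d(1) by simp
  with M have "0 < real M" by linarith
  then have M0: "0 < M" by simp
  have M1: "real N * (1 / real M) \<le> \<delta>" using M d(1) M0 by (simp add: field_simps)
  have "1 / real M \<le> real N * (1 / real M)" using N by (simp add: divide_right_mono)
  with M1 have M2: "1 / real M \<le> \<delta>" by linarith
  define L where "L = {T. \<exists>xs\<in>keys z. T \<subseteq> set xs}"
  have L_fin: "finite S" if "S \<in> L" for S using that finite_subset by (auto simp: L_def)
  have L_down: "T \<in> L" if "S \<in> L" "T \<subseteq> S" for S T using that by (auto simp: L_def)
  have L_K: "L \<subseteq> insert {} K"
  proof
    fix T assume "T \<in> L"
    then obtain xs where "xs \<in> keys z" "T \<subseteq> set xs" by (auto simp: L_def)
    then show "T \<in> insert {} K" using simplicial_complexD[OF K, of "set xs" T] zK by blast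
  qed
  have z_L: "z \<in> alt_chains N L" using z(1) by (auto simp: alt_chains_def L_def)
  interpret sub: contracted_carriers L closed_simplex
    "\<lambda>S i x v. (1 - real i / real M) * x v + real i / real M * (if v = (SOME u. u \<in> S) then 1 else 0)"
    M "\<lambda>S v. if v = (SOME u. u \<in> S) then 1 else 0" "\<lambda>a x y. \<forall>v. \<bar>x v - y v\<bar> \<le> a" "1 / real M"
    by (rule contracted_carriers_closed_simplex[OF L_fin L_down M0])
  \<comment> \<open>The vertices of w are points of the realization, so f, h and H can be applied to
    them. P records that each simplex of w lies in one closed simplex and has mesh at most
    N/M.\<close>
  define w where "w = sub.subdivision N z"
  define P where "P = {T. (\<exists>S\<in>L. T \<subseteq> closed_simplex S) \<and> sub.small (real N * (1 / real M)) T}"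
  have w: "w \<in> alt_chains N P" unfolding w_def P_def by (rule sub.subdivision_in_chains[OF z_L])
  have bw: "bd w = 0" unfolding w_def by (rule sub.bd_subdivision_cycle[OF z_L z(2)])
  have P_down: "T \<in> P" if "S \<in> P" "T \<subseteq> S" for S T using that unfolding P_def sub.small_def by blast
  obtain y where y: "y \<in> alt_chains (Suc N) {T. \<exists>S\<in>L. T \<subseteq> S}" "bd y = push (map top_vertex) w - z"
  proof -
    have Car: "top_vertex ` closed_simplex S \<subseteq> S" if "S \<in> L" for S
      using top_vertex_in[OF _ L_fin[OF that]] by blast
    show thesis
      by (rule sub.push_subdivision_homologous[OF z_L z(2) Car]) (auto simp: w_def intro: that)
  qed
  have start: "homologous N (insert {} K) (push (map top_vertex) w) z"
  proof -
    have "{T. \<exists>S\<in>L. T \<subseteq> S} \<subseteq> insert {} K" using L_down L_K by blast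
    from subsetD[OF alt_chains_mono[OF this] y(1)] y(2) show ?thesis unfolding homologous_def by blast
  qed
  have adapted_cover: "(\<exists>V\<in>\<V>. H ` ({i, j} \<times> T) \<subseteq> V) \<and> (\<exists>U\<in>\<U>. f ` T \<subseteq> U)"
    if T: "T \<in> P" "T \<noteq> {}" and ij: "i \<in> {0..1}" "j \<in> {0..1}" "\<bar>i - j\<bar> \<le> \<delta>" for T i j
  proof -
    obtain xs where xs: "xs \<in> keys z" "T \<subseteq> closed_simplex (set xs)"
    proof -
      obtain S where "S \<in> L" "T \<subseteq> closed_simplex S" using T by (auto simp: P_def)
      moreover from this obtain xs where "xs \<in> keys z" "S \<subseteq> set xs" by (auto simp: L_def)
      ultimately show thesis using closed_simplex_mono[of S "set xs"] that by auto
    qed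
    have sm: "\<bar>x v - y v\<bar> \<le> \<delta>" if "x \<in> T" "y \<in> T" for x y v
    proof -
      have "\<bar>x v - y v\<bar> \<le> real N * (1 / real M)" using T(1) that by (auto simp: P_def sub.small_def)
      then show ?thesis using M1 by linarith
    qed
    have near: "\<forall>p\<in>{i, j} \<times> T. \<forall>q\<in>{i, j} \<times> T. near_point \<delta> p q"
    proof (intro ballI)
      fix p q assume "p \<in> {i, j} \<times> T" "q \<in> {i, j} \<times> T"
      then show "near_point \<delta> p q" using sm ij(3) d(1) by (auto simp: near_point_def abs_minus_commute)
    qed
    have sub: "{i, j} \<times> T \<subseteq> {0..1} \<times> closed_simplex (set xs)" using ij xs(2) by auto
    have ne: "{i, j} \<times> T \<noteq> {}" using T(2) by auto
    have "(\<exists>V\<in>\<V>. H ` ({i, j} \<times> T) \<subseteq> V) \<and> (\<exists>U\<in>\<U>. (\<lambda>p. f (snd p)) ` ({i, j} \<times> T) \<subseteq> U)"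
      by (rule d(2)[OF xs(1), unfolded adapted_def, THEN spec, THEN mp, THEN mp, THEN mp, OF sub ne near])
    moreover have "(\<lambda>p. f (snd p)) ` ({i, j} \<times> T) = f ` T" by force
    ultimately show ?thesis by simp
  qed
  \<comment> \<open>The homotopy at time i/M followed by the choice of a top vertex: for i = M this
    is \<open>top_vertex\<close>, for i = 0 it factors through the circle via f and h.\<close>
  define \<psi> where "\<psi> i x = top_vertex (H (real i / real M, x))" for i x
  have step: "homologous N (insert {} K) (push (map (\<psi> (Suc i))) w) (push (map (\<psi> i)) w)" if i: "i < M" for i
  proof (rule homologous_contiguous[OF w bw])
    show "T \<in> P" if "S \<in> P" "T \<subseteq> S" for S T by (rule P_down[OF that])
    fix T U assume T: "T \<in> P" and U: "U \<subseteq> \<psi> i ` T \<union> \<psi> (Suc i) ` T"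
    show "U \<in> insert {} K"
    proof (cases "T = {}")
      case False
      let ?i = "real i / real M" and ?j = "real (Suc i) / real M"
      have "?i \<in> {0..1}" "?j \<in> {0..1}" using i by auto
      moreover have "\<bar>?i - ?j\<bar> \<le> \<delta>" using M2 M0 by (simp add: diff_divide_distrib[symmetric])
      ultimately obtain V where V1: "V \<in> \<V>" "H ` ({?i, ?j} \<times> T) \<subseteq> V" using adapted_cover[OF T False] by blast
      obtain S where S: "S \<in> K" "top_vertex ` H ` ({?i, ?j} \<times> T) \<subseteq> S" using top_V[OF V1] by blast
      have img: "\<psi> i ` T \<union> \<psi> (Suc i) ` T \<subseteq> top_vertex ` H ` ({?i, ?j} \<times> T)" by (auto simp: \<psi>_def)
      have "U \<subseteq> S" by (rule order_trans[OF U order_trans[OF img S(2)]])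
      then show ?thesis using simplicial_complexD[OF K, of S U] S(1) by simp
    qed (use U in simp)
  qed
  have "homologous N (insert {} K) (push (map (\<psi> M)) w) (push (map (\<psi> 0)) w)"
    by (rule homologous_chain[of M N _ "\<lambda>i. push (map (\<psi> i)) w"]) (rule step)
  moreover have "\<psi> M = top_vertex" using M0 by (simp add: \<psi>_def H1 fun_eq_iff)
  ultimately have top_0: "homologous N (insert {} K) (push (map top_vertex) w) (push (map (\<psi> 0)) w)" by simp
  \<comment> \<open>The map at time 0 with the rounding inserted between f and h. It is contiguous
    to \<open>\<psi> 0\<close>, since h sends a member of \<open>\<U>\<close> and its rounded points
    into one open star.\<close>
  define \<psi>' where "\<psi>' x = top_vertex (h (\<pi> (f x)))" for x
  have last: "homologous N (insert {} K) (push (map \<psi>') w) (push (map (\<psi> 0)) w)"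
  proof (rule homologous_contiguous[OF w bw])
    show "T \<in> P" if "S \<in> P" "T \<subseteq> S" for S T by (rule P_down[OF that])
    fix T U assume T: "T \<in> P" and U: "U \<subseteq> \<psi> 0 ` T \<union> \<psi>' ` T"
    show "U \<in> insert {} K"
    proof (cases "T = {}")
      case False
      obtain W where W: "W \<in> \<U>" "f ` T \<subseteq> W" using adapted_cover[OF T False, of 0 0] d(1) by auto
      then obtain V where V1: "V \<in> \<V>" "h ` (W \<union> \<pi> ` W) \<subseteq> V" by (auto simp: \<U>_def)
      obtain S where S: "S \<in> K" "top_vertex ` h ` (W \<union> \<pi> ` W) \<subseteq> S" using top_V[OF V1] by blast
      have img: "\<psi> 0 ` T \<union> \<psi>' ` T \<subseteq> top_vertex ` h ` (W \<union> \<pi> ` W)"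
        using W(2) by (auto simp: \<psi>_def \<psi>'_def H0)
      have "U \<subseteq> S" by (rule order_trans[OF U order_trans[OF img S(2)]])
      then show ?thesis using simplicial_complexD[OF K, of S U] S(1) by simp
    qed (use U in simp)
  qed
  \<comment> \<open>On a simplex of w the rounded f takes at most two values, and an alternating
    chain on N \<ge> 3 entries cannot live on two vertices.\<close>
  have "push (map (\<lambda>x. \<pi> (f x))) w = 0"
  proof (rule alt_chains_eq_zero)
    show "push (map (\<lambda>x. \<pi> (f x))) w \<in> alt_chains N {T. card T \<le> 2}"
    proof (rule alt_chains_push[OF w])
      fix T assume T: "T \<in> P"
      show "(\<lambda>x. \<pi> (f x)) ` T \<in> {T. card T \<le> 2}"
      proof (cases "T = {}")
        case False
        obtain W where W: "W \<in> \<U>" "f ` T \<subseteq> W" using adapted_cover[OF T False, of 0 0] d(1) by auto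
        then have "(\<lambda>x. \<pi> (f x)) ` T \<subseteq> \<pi> ` W" by auto
        then show ?thesis using W(1) card_mono[of "\<pi> ` W" "(\<lambda>x. \<pi> (f x)) ` T"] by (auto simp: \<U>_def)
      qed simp
    qed
  qed (use N in auto)
  moreover have "push (map \<psi>') w = push (map (\<lambda>x. top_vertex (h x))) (push (map (\<lambda>x. \<pi> (f x))) w)"
    by (simp add: push_push \<psi>'_def[abs_def] o_def)
  ultimately have "push (map \<psi>') w = 0" by simp
  then have "homologous N (insert {} K) (push (map (\<psi> 0)) w) 0" using homologous_sym[OF last] by simp
  then show ?thesis by (rule homologous_trans[OF homologous_trans[OF homologous_sym[OF start] top_0]])
qed


section \<open>Rips complexes and contracting flows\<close>

lemma Rips_iff:
  "S \<in> Rips Y r \<longleftrightarrow> finite S \<and> S \<noteq> {} \<and> S \<subseteq> Y \<and> (\<forall>x\<in>S. \<forall>y\<in>S. dist x y < r)"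
proof -
  have "diameter S < r \<longleftrightarrow> (\<forall>x\<in>S. \<forall>y\<in>S. dist x y < r)" if S: "finite S" "S \<noteq> {}"
  proof
    assume "diameter S < r"
    then show "\<forall>x\<in>S. \<forall>y\<in>S. dist x y < r"
      using diameter_bounded_bound[OF finite_imp_bounded[OF S(1)]] by (meson le_less_trans)
  next
    assume *: "\<forall>x\<in>S. \<forall>y\<in>S. dist x y < r"
    obtain x y where "x \<in> S" "y \<in> S" "dist x y = diameter S"
      using diameter_compact_attained[OF finite_imp_compact[OF S(1)] S(2)] by blast
    with * show "diameter S < r" by metis
  qed
  then show ?thesis unfolding Rips_def by blast
qed

text \<open>With the empty simplex the complex is closed under all subsets, as
  \<open>alt_chains_bd\<close> and the carrier arguments ask. Only chains on the empty list see the
  difference.\<close>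

definition Rips\<^sub>0 :: "'a::metric_space set \<Rightarrow> real \<Rightarrow> 'a set set" where
  "Rips\<^sub>0 Y r = insert {} (Rips Y r)"

lemma Rips\<^sub>0_iff:
  "S \<in> Rips\<^sub>0 Y r \<longleftrightarrow> finite S \<and> S \<subseteq> Y \<and> (\<forall>x\<in>S. \<forall>y\<in>S. dist x y < r)"
  unfolding Rips\<^sub>0_def by (auto simp: Rips_iff)

lemma simplicial_complex_Rips: "simplicial_complex (Rips Y r)"
  unfolding simplicial_complex_def
proof (intro ballI allI impI)
  fix S T assume "S \<in> Rips Y r" "T \<subseteq> S" "T \<noteq> {}"
  then show "T \<in> Rips Y r" using finite_subset[of T S] by (auto simp: Rips_iff)
qed

lemma Rips\<^sub>0_down: "S \<in> Rips\<^sub>0 Y r \<Longrightarrow> T \<subseteq> S \<Longrightarrow> T \<in> Rips\<^sub>0 Y r"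
  unfolding Rips\<^sub>0_def by (rule simplicial_complexD[OF simplicial_complex_Rips])

lemma Rips_mono: "Y \<subseteq> Z \<Longrightarrow> p \<le> q \<Longrightarrow> Rips Y p \<subseteq> Rips Z q"
proof
  fix S assume YZ: "Y \<subseteq> Z" "p \<le> q" and "S \<in> Rips Y p"
  then have S: "finite S" "S \<noteq> {}" "S \<subseteq> Y" "\<forall>x\<in>S. \<forall>y\<in>S. dist x y < p" by (simp_all add: Rips_iff)
  have "\<forall>x\<in>S. \<forall>y\<in>S. dist x y < q"
    using S(4) YZ(2) by (intro ballI) (rule less_le_trans[of _ p], auto)
  with S YZ(1) show "S \<in> Rips Z q" by (simp add: Rips_iff)
qed

lemma Rips\<^sub>0_mono: "Y \<subseteq> Z \<Longrightarrow> p \<le> q \<Longrightarrow> Rips\<^sub>0 Y p \<subseteq> Rips\<^sub>0 Z q"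
  using Rips_mono[of Y Z p q] by (auto simp: Rips\<^sub>0_def)

lemma alt_chains_Rips\<^sub>0: "alt_chains (Suc n) (Rips\<^sub>0 Y r) = alt_chains (Suc n) (Rips Y r)"
  unfolding Rips\<^sub>0_def by (rule alt_chains_insert_empty)

text \<open>The inequalities are strict and only finitely many simplices occur in a chain. The slack
  s is what vertices may move without leaving scale r.\<close>

lemma Rips_chain_slack:
  assumes "z \<in> alt_chains n (Rips\<^sub>0 Y r)"
  obtains s where "0 < s" "\<And>xs x y. xs \<in> keys z \<Longrightarrow> x \<in> set xs \<Longrightarrow> y \<in> set xs \<Longrightarrow> dist x y + s < r"
proof -
  have "\<exists>s>0. dist (fst p) (snd p) + s < r" if "p \<in> (\<Union>xs\<in>keys z. set xs \<times> set xs)" for p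
  proof -
    have "dist (fst p) (snd p) < r" using that assms by (auto simp: alt_chains_def Rips\<^sub>0_iff)
    then show ?thesis by (intro exI[of _ "(r - dist (fst p) (snd p)) / 2"]) (simp add: field_simps)
  qed
  then have "\<exists>s>0. \<forall>p\<in>(\<Union>xs\<in>keys z. set xs \<times> set xs). dist (fst p) (snd p) + s < r"
    by (intro uniform_finite) auto
  then obtain s where "s > 0" and s: "\<And>p. p \<in> (\<Union>xs\<in>keys z. set xs \<times> set xs) \<Longrightarrow> dist (fst p) (snd p) + s < r" by blast
  show ?thesis
  proof (rule that[OF \<open>s > 0\<close>])
    fix xs x y assume "xs \<in> keys z" "x \<in> set xs" "y \<in> set xs"
    then show "dist x y + s < r" using s[of "(x, y)"] by auto
  qed
qed

text \<open>Time is cut into steps during which the finitely many vertices of z move by less than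
  the slack. At equal times distances do not exceed the original ones, so the images of a simplex at
  two consecutive times together span a simplex of scale r: consecutive maps are contiguous.\<close>

lemma contracting_flow_homologous:
  fixes G :: "real \<Rightarrow> 'a::metric_space \<Rightarrow> 'a" and z :: "'a list \<Rightarrow>\<^sub>0 'g::ab_group_add"
  assumes start: "\<And>x. x \<in> Y \<Longrightarrow> G 0 x = x"
    and stays: "\<And>x t. x \<in> Y \<Longrightarrow> t \<in> {0..1} \<Longrightarrow> G t x \<in> Y"
    and cont: "\<And>x. x \<in> Y \<Longrightarrow> continuous_on {0..1} (\<lambda>t. G t x)"
    and contr: "\<And>x y t. x \<in> Y \<Longrightarrow> y \<in> Y \<Longrightarrow> t \<in> {0..1} \<Longrightarrow> dist (G t x) (G t y) \<le> dist x y"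
    and z: "z \<in> alt_chains n (Rips\<^sub>0 Y r)" "bd z = 0"
  shows "homologous n (Rips\<^sub>0 Y r) (push (map (G 1)) z) z"
proof -
  obtain s where s: "0 < s" "\<And>xs x y. xs \<in> keys z \<Longrightarrow> x \<in> set xs \<Longrightarrow> y \<in> set xs \<Longrightarrow> dist x y + s < r"
    using Rips_chain_slack[OF z(1)] by metis
  define W where "W = (\<Union>xs\<in>keys z. set xs)"
  have W: "finite W" "W \<subseteq> Y" using z(1) by (auto simp: W_def alt_chains_def Rips\<^sub>0_iff)
  have "\<exists>\<delta>>0. \<forall>x\<in>W. \<forall>t\<in>{0..1}. \<forall>u\<in>{0..1}. \<bar>t - u\<bar> < \<delta> \<longrightarrow> dist (G t x) (G u x) < s"
  proof (rule uniform_finite[OF W(1)])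
    fix x assume "x \<in> W"
    then have "uniformly_continuous_on {0..1} (\<lambda>t. G t x)"
      using W by (intro compact_uniformly_continuous cont) auto
    then obtain d where "d > 0" "\<And>t u. t \<in> {0..1} \<Longrightarrow> u \<in> {0..1} \<Longrightarrow> dist u t < d \<Longrightarrow> dist (G u x) (G t x) < s"
      unfolding uniformly_continuous_on_def using s(1) by metis
    then show "\<exists>\<delta>>0. \<forall>t\<in>{0..1}. \<forall>u\<in>{0..1}. \<bar>t - u\<bar> < \<delta> \<longrightarrow> dist (G t x) (G u x) < s"
      by (intro exI[of _ d]) (auto simp: dist_real_def)
  qed auto
  then obtain \<delta> where d: "\<delta> > 0"
    "\<And>x t u. x \<in> W \<Longrightarrow> t \<in> {0..1} \<Longrightarrow> u \<in> {0..1} \<Longrightarrow> \<bar>t - u\<bar> < \<delta> \<Longrightarrow> dist (G t x) (G u x) < s" by metis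
  obtain M :: nat where M: "1 / \<delta> < real M" using reals_Archimedean2 by blast
  have "0 < 1 / \<delta>" using d(1) by simp
  with M have M0: "0 < real M" by linarith
  have M1: "1 / real M < \<delta>" using M d(1) M0 by (simp add: field_simps)
  define L where "L = {T. \<exists>xs\<in>keys z. T \<subseteq> set xs}"
  have z_L: "z \<in> alt_chains n L" using z(1) by (auto simp: alt_chains_def L_def)
  have step: "homologous n (Rips\<^sub>0 Y r) (push (map (G (real (Suc i) / real M))) z) (push (map (G (real i / real M))) z)"
    if i: "i < M" for i
  proof (rule homologous_contiguous[OF z_L z(2)])
    show "T \<in> L" if "S \<in> L" "T \<subseteq> S" for S T using that by (auto simp: L_def)
    let ?i = "real i / real M" and ?j = "real (Suc i) / real M"
    fix S U assume S: "S \<in> L" and U: "U \<subseteq> G ?i ` S \<union> G ?j ` S"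
    obtain xs where xs: "xs \<in> keys z" "S \<subseteq> set xs" using S by (auto simp: L_def)
    have ij: "?i \<in> {0..1}" "?j \<in> {0..1}" using i by auto
    have close: "\<bar>t - u\<bar> < \<delta>" if "t \<in> {?i, ?j}" "u \<in> {?i, ?j}" for t u
      using that M1 M0 d(1) by (auto simp: diff_divide_distrib[symmetric])
    have SW: "x \<in> W" "x \<in> Y" if "x \<in> S" for x using that xs W(2) by (auto simp: W_def)
    have dist: "dist (G t x) (G u y) < r" if "x \<in> S" "y \<in> S" "t \<in> {?i, ?j}" "u \<in> {?i, ?j}" for x y t u
    proof -
      have tu: "t \<in> {0..1}" "u \<in> {0..1}" using that ij by auto
      have "dist (G t x) (G u y) \<le> dist (G t x) (G t y) + dist (G t y) (G u y)" by (rule dist_triangle)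
      also have "\<dots> \<le> dist x y + s"
        using contr[OF SW(2)[OF that(1)] SW(2)[OF that(2)] tu(1)] d(2)[OF SW(1)[OF that(2)] tu close[OF that(3,4)]]
        by linarith
      also have "\<dots> < r" using s(2)[OF xs(1)] that xs(2) by auto
      finally show ?thesis .
    qed
    have rep: "\<exists>x\<in>S. \<exists>t\<in>{?i, ?j}. a = G t x" if "a \<in> U" for a using that U by auto
    have "finite S" using xs(2) finite_subset by blast
    then have "finite U" using U finite_subset by blast
    moreover have "U \<subseteq> Y"
    proof
      fix a assume "a \<in> U"
      then obtain x t where "x \<in> S" "t \<in> {?i, ?j}" "a = G t x" using rep by blast
      then show "a \<in> Y" using stays[OF SW(2), of x t] ij by auto
    qed
    moreover have "dist a b < r" if ab: "a \<in> U" "b \<in> U" for a b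
    proof -
      obtain x t where "x \<in> S" "t \<in> {?i, ?j}" "a = G t x" using rep[OF ab(1)] by blast
      moreover obtain y u where "y \<in> S" "u \<in> {?i, ?j}" "b = G u y" using rep[OF ab(2)] by blast
      ultimately show ?thesis using dist by simp
    qed
    ultimately show "U \<in> Rips\<^sub>0 Y r" by (simp add: Rips\<^sub>0_iff)
  qed
  have "homologous n (Rips\<^sub>0 Y r) (push (map (G (real M / real M))) z) (push (map (G (real 0 / real M))) z)"
    by (rule homologous_chain[of M n _ "\<lambda>i. push (map (G (real i / real M))) z"]) (rule step)
  moreover have "push (map (G 0)) z = push (\<lambda>xs. xs) z"
    by (rule push_cong) (use start W(2) in \<open>auto simp: W_def intro!: map_idI\<close>)
  ultimately show ?thesis using M0 by simp
qed

text \<open>Invariance of domain, applied in a chart of the ambient surface.\<close>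

lemma surface_interior_subset_interior:
  fixes N :: "'a::metric_space set"
  assumes X: "surface (UNIV :: 'a set)"
  shows "surface_interior N \<subseteq> interior N"
proof
  fix q assume "q \<in> surface_interior N"
  then obtain U where U: "openin (top_of_set N) U" "q \<in> U" "U homeomorphic (UNIV :: complex set)"
    unfolding surface_interior_def by blast
  obtain W where W: "openin (top_of_set UNIV) W" "q \<in> W"
    "W homeomorphic (UNIV :: complex set) \<or> W homeomorphic {z :: complex. 0 \<le> Im z}"
    using X unfolding surface_def by blast
  then obtain P :: "complex set" where W: "open W" "q \<in> W" "W homeomorphic P" by auto
  obtain \<theta> \<theta>' where th: "homeomorphism W P \<theta> \<theta>'" using W(3) by (auto simp: homeomorphic_def)
  obtain \<kappa>' \<kappa> where ka: "homeomorphism U (UNIV :: complex set) \<kappa>' \<kappa>" using U(3) by (auto simp: homeomorphic_def)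
  obtain O1 where O1: "open O1" "U = N \<inter> O1" using U(1) by (auto simp: openin_open)
  define Q where "Q = {c. \<kappa> c \<in> W}"
  have kc: "continuous_on UNIV \<kappa>" "\<kappa> ` UNIV = U" using ka by (auto simp: homeomorphism_def)
  have Q: "open Q" using open_vimage[OF W(1) kc(1)] by (simp add: Q_def vimage_def)
  have "open ((\<theta> \<circ> \<kappa>) ` Q)"
  proof (rule invariance_of_domain[OF _ Q])
    have "continuous_on Q \<kappa>" by (rule continuous_on_subset[OF kc(1)]) simp
    moreover have "continuous_on (\<kappa> ` Q) \<theta>"
      by (rule continuous_on_subset[OF homeomorphism_cont1[OF th]]) (auto simp: Q_def)
    ultimately show "continuous_on Q (\<theta> \<circ> \<kappa>)" by (rule continuous_on_compose)
    show "inj_on (\<theta> \<circ> \<kappa>) Q"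
    proof (rule inj_on_inverseI[of _ "\<lambda>c. \<kappa>' (\<theta>' c)"])
      fix c assume "c \<in> Q"
      then show "\<kappa>' (\<theta>' ((\<theta> \<circ> \<kappa>) c)) = c"
        using homeomorphism_apply1[OF th] homeomorphism_apply2[OF ka] by (simp add: Q_def)
    qed
  qed
  moreover have "(\<theta> \<circ> \<kappa>) ` Q = \<theta> ` (U \<inter> W)"
    using kc(2) by (auto simp: Q_def image_iff) 
  ultimately have "open (\<theta> ` (U \<inter> W))" by simp
  then have "open (\<theta> -` (\<theta> ` (U \<inter> W)) \<inter> W)"
    using homeomorphism_cont1[OF th] W(1) continuous_on_open_vimage[of W \<theta>] by blast
  moreover have "\<theta> -` (\<theta> ` (U \<inter> W)) \<inter> W = U \<inter> W"
  proof (intro equalityI subsetI)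
    fix x assume x: "x \<in> \<theta> -` (\<theta> ` (U \<inter> W)) \<inter> W"
    then obtain u where "u \<in> U \<inter> W" "\<theta> x = \<theta> u" by auto
    then show "x \<in> U \<inter> W" using homeomorphism_apply1[OF th, of x] homeomorphism_apply1[OF th, of u] x by simp
  qed auto
  ultimately have "open (U \<inter> W)" by simp
  moreover have "U \<inter> W \<subseteq> N" using O1 by auto
  ultimately show "q \<in> interior N" using U(2) W(2) by (auto intro: interiorI)
qed

text \<open>If an endpoint lies on the boundary it serves as q. Otherwise a geodesic joins a point
  outside N to a point of N, hence meets the frontier; a point of the frontier of a closed set lies
  in N but not in its topological interior, so by invariance of domain it is a boundary point in the
  sense of manifolds.\<close>

lemma geodesic_meets_boundary:
  fixes N :: "'a::metric_space set"
  assumes X: "geodesic_space (UNIV :: 'a set)" "surface (UNIV :: 'a set)"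
    and N: "closed N" and x: "x \<notin> surface_interior N" and y: "y \<in> N"
  obtains q where "q \<in> surface_boundary N" "dist x q + dist q y = dist x y"
proof (cases "x \<in> N \<or> y \<notin> surface_interior N")
  case True
  then show ?thesis using that[of x] that[of y] x y by (auto simp: surface_boundary_def)
next
  case False
  then have "x \<noteq> y" using y by auto
  then obtain \<gamma> :: "real \<Rightarrow> 'a" where g: "\<gamma> 0 = x" "\<gamma> (dist x y) = y"
    "\<forall>s\<in>{0..dist x y}. \<forall>t\<in>{0..dist x y}. dist (\<gamma> s) (\<gamma> t) = \<bar>s - t\<bar>"
    using X(1) unfolding geodesic_space_def by blast
  have "continuous_on {0..dist x y} \<gamma>"
    unfolding continuous_on_iff using g(3) by (metis dist_real_def)
  then have "connected (\<gamma> ` {0..dist x y})" by (rule connected_continuous_image) simp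
  moreover have "x \<in> \<gamma> ` {0..dist x y}" "y \<in> \<gamma> ` {0..dist x y}"
    using g(1,2) by (metis atLeastAtMost_iff image_eqI order_refl zero_le_dist)+
  ultimately have "\<gamma> ` {0..dist x y} \<inter> frontier N \<noteq> {}"
    using False y by (intro connected_Int_frontier) auto
  then obtain t where t: "t \<in> {0..dist x y}" "\<gamma> t \<in> frontier N" by blast
  then have "\<gamma> t \<in> N" "\<gamma> t \<notin> interior N" using N by (auto simp: frontier_def)
  then have "\<gamma> t \<in> surface_boundary N"
    using surface_interior_subset_interior[OF X(2)] by (auto simp: surface_boundary_def)
  moreover have "dist x (\<gamma> t) + dist (\<gamma> t) y = dist x y"
    using g(3)[rule_format, of 0 t] g(3)[rule_format, of t "dist x y"] t(1) g(1,2) by auto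
  ultimately show ?thesis by (rule that)
qed


section \<open>The neighbourhood of an isolated circle\<close>

text \<open>
  The part of a deformation contraction that matters for Rips complexes; it does not need joint
  continuity.
\<close>

definition contracts_to :: "'a::metric_space set \<Rightarrow> 'a set \<Rightarrow> ('a \<Rightarrow> 'a) \<Rightarrow> bool" where
  "contracts_to Y A \<rho> \<longleftrightarrow> A \<subseteq> Y \<and> (\<exists>G. (\<forall>x\<in>Y. G 0 x = x) \<and> (\<forall>x\<in>Y. \<forall>t\<in>{0..1::real}. G t x \<in> Y)
     \<and> (\<forall>x\<in>Y. continuous_on {0..1} (\<lambda>t. G t x))
     \<and> (\<forall>x\<in>Y. \<forall>y\<in>Y. \<forall>t\<in>{0..1}. dist (G t x) (G t y) \<le> dist x y)
     \<and> (\<forall>a\<in>A. \<forall>t\<in>{0..1}. G t a = a) \<and> (\<forall>x\<in>Y. G 1 x \<in> A) \<and> G 1 = \<rho>)"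

lemma deformation_contraction_contracts_to:
  assumes "deformation_contraction Y A"
  obtains \<rho> where "contracts_to Y A \<rho>"
proof -
  obtain F :: "'a \<times> real \<Rightarrow> 'a" where F: "A \<subseteq> Y" "continuous_on (Y \<times> {0..1}) F" "F ` (Y \<times> {0..1}) \<subseteq> Y"
    "\<forall>x\<in>Y. F (x, 0) = x" "\<forall>x\<in>Y. F (x, 1) \<in> A" "\<forall>a\<in>A. \<forall>t\<in>{0..1}. F (a, t) = a"
    "\<forall>x\<in>Y. \<forall>y\<in>Y. \<forall>t\<in>{0..1}. \<forall>t'\<in>{0..1}. t < t' \<longrightarrow> dist (F (x, t')) (F (y, t')) \<le> dist (F (x, t)) (F (y, t))"
    using assms unfolding deformation_contraction_def by blast
  have "dist (F (x, t)) (F (y, t)) \<le> dist x y" if xy: "x \<in> Y" "y \<in> Y" and t: "t \<in> {0..1}" for x y t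
  proof (cases "t = 0")
    case True
    then show ?thesis using F(4) xy by simp
  next
    case False
    then have "dist (F (x, t)) (F (y, t)) \<le> dist (F (x, 0)) (F (y, 0))"
      using F(7)[rule_format, OF xy, of 0 t] t by simp
    then show ?thesis using F(4) xy by simp
  qed
  moreover have "continuous_on {0..1} (\<lambda>t. F (x, t))" if "x \<in> Y" for x
    by (rule continuous_on_compose2[OF F(2)]) (use that in \<open>auto intro!: continuous_intros\<close>)
  moreover have "F (x, t) \<in> Y" if "x \<in> Y" "t \<in> {0..1}" for x t using F(3) that by blast
  ultimately have "contracts_to Y A (\<lambda>x. F (x, 1))"
    unfolding contracts_to_def using F(1,4,5,6) by (intro conjI exI[of _ "\<lambda>t x. F (x, t)"]) auto
  then show ?thesis by (rule that)
qed

lemma contracts_toD: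
  assumes "contracts_to Y A \<rho>"
  shows "A \<subseteq> Y" "x \<in> Y \<Longrightarrow> \<rho> x \<in> A" "x \<in> A \<Longrightarrow> \<rho> x = x"
    "x \<in> Y \<Longrightarrow> y \<in> Y \<Longrightarrow> dist (\<rho> x) (\<rho> y) \<le> dist x y"
proof -
  obtain G where G: "A \<subseteq> Y" "\<forall>x\<in>Y. \<forall>y\<in>Y. \<forall>t\<in>{0..1::real}. dist (G t x) (G t y) \<le> dist x y"
    "\<forall>a\<in>A. \<forall>t\<in>{0..1::real}. G t a = a" "\<forall>x\<in>Y. G 1 x \<in> A" "G 1 = \<rho>"
    using assms unfolding contracts_to_def by blast
  show "A \<subseteq> Y" by (rule G(1))
  show "x \<in> Y \<Longrightarrow> \<rho> x \<in> A" using G(4,5) by blast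
  show "x \<in> A \<Longrightarrow> \<rho> x = x" using G(3,5) by auto
  show "x \<in> Y \<Longrightarrow> y \<in> Y \<Longrightarrow> dist (\<rho> x) (\<rho> y) \<le> dist x y" using G(2,5) by auto
qed

lemma contracts_to_homologous:
  assumes "contracts_to Y A \<rho>" "z \<in> alt_chains n (Rips\<^sub>0 Y r)" "bd z = 0"
  shows "homologous n (Rips\<^sub>0 Y r) (push (map \<rho>) z) z"
proof -
  obtain G where G: "\<forall>x\<in>Y. G 0 x = x" "\<forall>x\<in>Y. \<forall>t\<in>{0..1::real}. G t x \<in> Y"
    "\<forall>x\<in>Y. continuous_on {0..1} (\<lambda>t. G t x)"
    "\<forall>x\<in>Y. \<forall>y\<in>Y. \<forall>t\<in>{0..1}. dist (G t x) (G t y) \<le> dist x y" "G 1 = \<rho>"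
    using assms(1) unfolding contracts_to_def by blast
  show ?thesis unfolding G(5)[symmetric]
    by (rule contracting_flow_homologous[OF _ _ _ _ assms(2,3)]) (use G in auto)
qed

lemma contracts_to_push:
  assumes "contracts_to Y A \<rho>" "c \<in> alt_chains n (Rips\<^sub>0 Y r)"
  shows "push (map \<rho>) c \<in> alt_chains n (Rips\<^sub>0 A r)"
proof (rule alt_chains_push[OF assms(2)])
  fix S assume "S \<in> Rips\<^sub>0 Y r"
  then have S: "finite S" "S \<subseteq> Y" "\<forall>x\<in>S. \<forall>y\<in>S. dist x y < r" by (simp_all add: Rips\<^sub>0_iff)
  note \<rho> = contracts_toD[OF assms(1)]
  have "dist (\<rho> x) (\<rho> y) < r" if "x \<in> S" "y \<in> S" for x y
  proof -
    have "dist (\<rho> x) (\<rho> y) \<le> dist x y" using \<rho>(4)[of x y] S(2) that by blast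
    also have "\<dots> < r" using S(3) that by blast
    finally show ?thesis .
  qed
  moreover have "\<rho> ` S \<subseteq> A" using \<rho>(2) S(2) by blast
  ultimately show "\<rho> ` S \<in> Rips\<^sub>0 A r" using S(1) by (simp add: Rips\<^sub>0_iff)
qed

lemma contracts_to_push_id:
  assumes "contracts_to Y A \<rho>" "c \<in> alt_chains n (Rips\<^sub>0 A r)"
  shows "push (map \<rho>) c = c"
proof -
  have "push (map \<rho>) c = push (\<lambda>xs. xs) c"
    by (rule push_cong) (use assms(2) contracts_toD(3)[OF assms(1)] in
      \<open>auto simp: alt_chains_def Rips\<^sub>0_iff subset_iff intro!: map_idI\<close>)
  then show ?thesis by simp
qed

section \<open>Cutting chains and adding homologies\<close>

lemma filter_set_in_chains:
  assumes "c \<in> alt_chains n K" "\<And>S. S \<in> K \<Longrightarrow> P S \<Longrightarrow> S \<in> L"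
  shows "filter_chain (\<lambda>xs. P (set xs)) c \<in> alt_chains n L"
  using assms by (auto simp: alt_chains_def alt_def keys_filter_chain lookup_filter_chain)

lemma filter_chain_split: "filter_chain P c + filter_chain (\<lambda>x. \<not> P x) c = c"
  by (rule poly_mapping_eqI) (simp add: lookup_add lookup_filter_chain)

lemma alt_chains_Int: "c \<in> alt_chains n K \<Longrightarrow> c \<in> alt_chains n L \<Longrightarrow> c \<in> alt_chains n (K \<inter> L)"
  by (auto simp: alt_chains_def)

lemma homologous_add:
  assumes "homologous n K a b" "homologous n K c d"
  shows "homologous n K (a + c) (b + d)"
proof -
  obtain y z where "y \<in> alt_chains (Suc n) K" "bd y = a - b" "z \<in> alt_chains (Suc n) K" "bd z = c - d"
    using assms unfolding homologous_def by blast
  then show ?thesis unfolding homologous_def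
    by (intro bexI[of _ "y + z"]) (auto simp: bd_add alt_chains_add)
qed

lemma homologous_0D:
  assumes "homologous n K z 0"
  obtains y where "y \<in> alt_chains (Suc n) K" "bd y = z"
  using assms unfolding homologous_def by auto

text \<open>At scale \<open>D\<close> itself a chain already lives at a smaller scale.\<close>

lemma Rips_circle_homology_vanishes:
  fixes z :: "'a::metric_space list \<Rightarrow>\<^sub>0 'g::ab_group_add"
  assumes circ: "\<And>r. 0 < r \<Longrightarrow> r < D \<Longrightarrow>
      geometric_realization (Rips Y r) homotopy_equivalent_space top_of_set (sphere (0::complex) 1)"
    and r: "0 < r" "r \<le> D" and n: "3 \<le> n" and z: "z \<in> alt_chains n (Rips\<^sub>0 Y r)" "bd z = 0"
  shows "homologous n (Rips\<^sub>0 Y r) z 0"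
proof -
  obtain s where s: "0 < s" "\<And>xs x y. xs \<in> keys z \<Longrightarrow> x \<in> set xs \<Longrightarrow> y \<in> set xs \<Longrightarrow> dist x y + s < r"
    using Rips_chain_slack[OF z(1)] by metis
  \<comment> \<open>A scale below r and hence below D; r / 2 keeps it positive when s is
    large.\<close>
  define r' where "r' = max (r - s) (r / 2)"
  have r': "0 < r'" "r' < r" using r(1) s(1) by (auto simp: r'_def)
  have "finite (set xs) \<and> set xs \<noteq> {} \<and> set xs \<subseteq> Y \<and> (\<forall>x\<in>set xs. \<forall>y\<in>set xs. dist x y < r')" if xs: "xs \<in> keys z" for xs
  proof -
    have "set xs \<subseteq> Y" "length xs = n" using z(1) xs by (auto simp: alt_chains_def Rips\<^sub>0_iff)
    moreover have "dist x y < r'" if "x \<in> set xs" "y \<in> set xs" for x y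
      using s(2)[OF xs that] by (simp add: r'_def)
    ultimately show ?thesis using n by auto
  qed
  then have "z \<in> alt_chains n (Rips Y r')"
    using z(1) by (auto simp: alt_chains_def Rips_iff)
  then have "homologous n (insert {} (Rips Y r')) z 0"
    by (intro homotopy_circle_homology_vanishes simplicial_complex_Rips circ n z(2)) (use r r' in \<open>auto simp: Rips_iff\<close>)
  then show ?thesis unfolding Rips\<^sub>0_def[symmetric]
    by (rule homologous_mono) (rule Rips\<^sub>0_mono, use r' in auto)
qed

locale isolated_circle =
  fixes \<alpha> N\<^sub>1 N\<^sub>2 \<alpha>\<^sub>1 \<alpha>\<^sub>2 :: "'a::metric_space set" and D :: real
  assumes X: "geodesic_space (UNIV :: 'a set)" "surface (UNIV :: 'a set)" and D: "0 < D"
    and N: "closed N\<^sub>1" "N\<^sub>1 \<subseteq> N\<^sub>2" and nbhd: "(\<Union>x\<in>N\<^sub>1. ball x D) \<subseteq> N\<^sub>2"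
    and boundary: "surface_boundary N\<^sub>1 = \<alpha>\<^sub>1 \<union> \<alpha>\<^sub>2"
    and apart: "\<And>x y. x \<in> \<alpha>\<^sub>1 \<Longrightarrow> y \<in> \<alpha>\<^sub>2 \<Longrightarrow> D \<le> dist x y"
    and circ1: "\<And>r. 0 < r \<Longrightarrow> r < D \<Longrightarrow>
      geometric_realization (Rips \<alpha>\<^sub>1 r) homotopy_equivalent_space top_of_set (sphere (0::complex) 1)"
    and circ2: "\<And>r. 0 < r \<Longrightarrow> r < D \<Longrightarrow>
      geometric_realization (Rips \<alpha>\<^sub>2 r) homotopy_equivalent_space top_of_set (sphere (0::complex) 1)"
    and dcA: "deformation_contraction (N\<^sub>2 - surface_interior N\<^sub>1) (surface_boundary N\<^sub>1)"
    and dcN: "deformation_contraction N\<^sub>1 \<alpha>"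
begin

definition collar :: "'a set" where "collar = N\<^sub>2 - surface_interior N\<^sub>1"
text \<open>The boundary of \<open>N\<^sub>1\<close> is kept on this side, so that
  \<open>outside\<close> meets \<open>N\<^sub>2\<close> exactly in the collar.\<close>

definition outside :: "'a set" where "outside = - surface_interior N\<^sub>1"

lemma boundary_subset: "surface_boundary N\<^sub>1 \<subseteq> N\<^sub>1" "surface_boundary N\<^sub>1 \<subseteq> collar"
  using N(2) by (auto simp: surface_boundary_def collar_def)

text \<open>After pushing to the boundary of \<open>N\<^sub>1\<close>, no simplex meets both
  circles, since they are at least D apart and r \<le> D. So the cycle splits into one cycle on each
  circle, and the circles have no homology in dimension n - 1 \<ge> 2.\<close>

lemma collar_homology_vanishes:
  fixes z :: "'a list \<Rightarrow>\<^sub>0 'g::ab_group_add"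
  assumes r: "0 < r" "r \<le> D" and n: "3 \<le> n" and z: "z \<in> alt_chains n (Rips\<^sub>0 collar r)" "bd z = 0"
  shows "homologous n (Rips\<^sub>0 collar r) z 0"
proof -
  obtain \<rho> where \<rho>: "contracts_to collar (surface_boundary N\<^sub>1) \<rho>"
    using deformation_contraction_contracts_to[OF dcA] unfolding collar_def by metis
  define w where "w = push (map \<rho>) z"
  have w: "w \<in> alt_chains n (Rips\<^sub>0 (\<alpha>\<^sub>1 \<union> \<alpha>\<^sub>2) r)"
    using contracts_to_push[OF \<rho> z(1)] by (simp add: w_def boundary)
  have bw: "bd w = 0" by (simp add: w_def bd_push_map z(2))
  have split: "S \<subseteq> \<alpha>\<^sub>1 \<or> S \<subseteq> \<alpha>\<^sub>2" if "S \<in> Rips\<^sub>0 (\<alpha>\<^sub>1 \<union> \<alpha>\<^sub>2) r" for S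
  proof (rule ccontr)
    assume "\<not> (S \<subseteq> \<alpha>\<^sub>1 \<or> S \<subseteq> \<alpha>\<^sub>2)"
    then obtain x y where xy: "x \<in> S" "x \<notin> \<alpha>\<^sub>1" "y \<in> S" "y \<notin> \<alpha>\<^sub>2" by blast
    then have "x \<in> \<alpha>\<^sub>2" "y \<in> \<alpha>\<^sub>1" "dist y x < r" using that by (auto simp: Rips\<^sub>0_iff)
    then show False using apart[of y x] r(2) by simp
  qed
  define w1 where "w1 = filter_chain (\<lambda>xs. set xs \<subseteq> \<alpha>\<^sub>1) w"
  define w2 where "w2 = filter_chain (\<lambda>xs. \<not> set xs \<subseteq> \<alpha>\<^sub>1) w"
  have w12: "w = w1 + w2" by (simp add: w1_def w2_def filter_chain_split)
  have w1: "w1 \<in> alt_chains n (Rips\<^sub>0 \<alpha>\<^sub>1 r)"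
    unfolding w1_def by (rule filter_set_in_chains[OF w]) (auto simp: Rips\<^sub>0_iff)
  have w2: "w2 \<in> alt_chains n (Rips\<^sub>0 \<alpha>\<^sub>2 r)"
    unfolding w2_def
  proof (rule filter_set_in_chains[OF w])
    fix S assume "S \<in> Rips\<^sub>0 (\<alpha>\<^sub>1 \<union> \<alpha>\<^sub>2) r" "\<not> S \<subseteq> \<alpha>\<^sub>1"
    then show "S \<in> Rips\<^sub>0 \<alpha>\<^sub>2 r" using split[of S] by (simp add: Rips\<^sub>0_iff)
  qed
  \<comment> \<open>The boundaries of the two halves cancel, so each lives on both circles, whose
    complexes share only the empty simplex. As the lists of the boundary have length m + 1 > 0, the
    empty simplex carries nothing and both halves are cycles.\<close>
  obtain m where m: "n = Suc (Suc m)" using n by (metis Suc_le_D numeral_3_eq_3 Suc_le_mono)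
  have b1: "bd w1 \<in> alt_chains (Suc m) (Rips\<^sub>0 \<alpha>\<^sub>1 r)" and b2: "bd w2 \<in> alt_chains (Suc m) (Rips\<^sub>0 \<alpha>\<^sub>2 r)"
    using w1 w2 unfolding m by (auto intro: alt_chains_bd Rips\<^sub>0_down)
  have sum0: "bd w1 + bd w2 = 0" using bw by (simp add: w12 bd_add)
  have "bd w1 = - bd w2" using sum0 by (simp add: add_eq_0_iff2)
  then have "bd w1 \<in> alt_chains (Suc m) (Rips\<^sub>0 \<alpha>\<^sub>2 r)" using alt_chains_uminus[OF b2] by simp
  with b1 have "bd w1 \<in> alt_chains (Suc m) (Rips\<^sub>0 \<alpha>\<^sub>1 r \<inter> Rips\<^sub>0 \<alpha>\<^sub>2 r)" by (rule alt_chains_Int)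
  moreover have "card S \<noteq> Suc m" if "S \<in> Rips\<^sub>0 \<alpha>\<^sub>1 r \<inter> Rips\<^sub>0 \<alpha>\<^sub>2 r" for S
  proof -
    have "S = {}"
    proof (rule ccontr)
      assume "S \<noteq> {}"
      then obtain x where "x \<in> S" by blast
      then have "x \<in> \<alpha>\<^sub>1" "x \<in> \<alpha>\<^sub>2" using that by (auto simp: Rips\<^sub>0_iff)
      then show False using apart[of x x] D by simp
    qed
    then show ?thesis by simp
  qed
  ultimately have bw1: "bd w1 = 0" by (rule alt_chains_eq_zero)
  then have bw2: "bd w2 = 0" using sum0 by simp
  have sub: "\<alpha>\<^sub>1 \<subseteq> collar" "\<alpha>\<^sub>2 \<subseteq> collar" using boundary boundary_subset(2) by auto
  have "homologous n (Rips\<^sub>0 collar r) w1 0"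
    by (rule homologous_mono[OF Rips_circle_homology_vanishes[OF circ1 r n w1 bw1] Rips\<^sub>0_mono])
       (use sub in auto)
  moreover have "homologous n (Rips\<^sub>0 collar r) w2 0"
    by (rule homologous_mono[OF Rips_circle_homology_vanishes[OF circ2 r n w2 bw2] Rips\<^sub>0_mono])
       (use sub in auto)
  ultimately have "homologous n (Rips\<^sub>0 collar r) w 0" using homologous_add[of n _ w1 0 w2 0] w12 by simp
  moreover have "homologous n (Rips\<^sub>0 collar r) w z"
    unfolding w_def by (rule contracts_to_homologous[OF \<rho> z])
  ultimately show ?thesis by (metis homologous_sym homologous_trans)
qed

text \<open>Points of the collar flow to the boundary of \<open>N\<^sub>1\<close> while \<open>N\<^sub>1\<close> stays fixed.\<close>

lemma N2_contracts_to_N1: obtains \<rho> where "contracts_to N\<^sub>2 N\<^sub>1 \<rho>"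
proof -
  obtain \<rho> where "contracts_to collar (surface_boundary N\<^sub>1) \<rho>"
    using deformation_contraction_contracts_to[OF dcA] unfolding collar_def by metis
  then obtain F where F: "\<forall>x\<in>collar. F 0 x = x" "\<forall>x\<in>collar. \<forall>t\<in>{0..1::real}. F t x \<in> collar"
    "\<forall>x\<in>collar. continuous_on {0..1} (\<lambda>t. F t x)"
    "\<forall>x\<in>collar. \<forall>y\<in>collar. \<forall>t\<in>{0..1}. dist (F t x) (F t y) \<le> dist x y"
    "\<forall>a\<in>surface_boundary N\<^sub>1. \<forall>t\<in>{0..1}. F t a = a" "\<forall>x\<in>collar. F 1 x \<in> surface_boundary N\<^sub>1"
    unfolding contracts_to_def by blast
  define G where "G t x = (if x \<in> N\<^sub>1 then x else F t x)" for t x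
  have out: "x \<in> collar" if "x \<in> N\<^sub>2" "x \<notin> N\<^sub>1" for x
    using that by (auto simp: collar_def surface_interior_def)
  have mixed: "dist (F t x) y \<le> dist x y" if x: "x \<in> collar" and y: "y \<in> N\<^sub>1" and t: "t \<in> {0..1}" for x y t
  proof -
    have "x \<notin> surface_interior N\<^sub>1" using x by (simp add: collar_def)
    then obtain q where q: "q \<in> surface_boundary N\<^sub>1" "dist x q + dist q y = dist x y"
      using geodesic_meets_boundary[OF X N(1) _ y] by blast
    have qc: "q \<in> collar" using q(1) boundary_subset(2) by (rule rev_subsetD)
    have "dist (F t x) y \<le> dist (F t x) q + dist q y" by (rule dist_triangle)
    moreover have "dist (F t x) q \<le> dist x q"
      using F(4)[rule_format, OF x qc t] F(5)[rule_format, OF q(1) t] by simp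
    ultimately show ?thesis using q(2) by simp
  qed
  have contr: "dist (G t x) (G t y) \<le> dist x y" if "x \<in> N\<^sub>2" "y \<in> N\<^sub>2" "t \<in> {0..1}" for x y t
  proof (cases "x \<in> N\<^sub>1"; cases "y \<in> N\<^sub>1")
    assume "x \<in> N\<^sub>1" "y \<notin> N\<^sub>1"
    then show ?thesis using mixed[OF out[of y], of x t] that by (simp add: G_def dist_commute)
  next
    assume "x \<notin> N\<^sub>1" "y \<in> N\<^sub>1"
    then show ?thesis using mixed[OF out[of x], of y t] that by (simp add: G_def)
  next
    assume "x \<notin> N\<^sub>1" "y \<notin> N\<^sub>1"
    then show ?thesis using F(4) out that by (simp add: G_def)
  qed (simp add: G_def)
  have "contracts_to N\<^sub>2 N\<^sub>1 (G 1)"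
    unfolding contracts_to_def
  proof (intro conjI exI[of _ G] ballI)
    fix x assume x: "x \<in> N\<^sub>2"
    show "G 0 x = x" using F(1) out x by (simp add: G_def)
    show "continuous_on {0..1} (\<lambda>t. G t x)"
      using F(3) out x by (cases "x \<in> N\<^sub>1") (simp_all add: G_def)
    show "G 1 x \<in> N\<^sub>1" using F(6) out x boundary_subset(1) by (auto simp: G_def)
    fix t :: real assume t: "t \<in> {0..1}"
    show "G t x \<in> N\<^sub>2" using F(2) out x t by (auto simp: G_def collar_def)
  next
    fix x y and t :: real assume "x \<in> N\<^sub>2" "y \<in> N\<^sub>2" "t \<in> {0..1}"
    then show "dist (G t x) (G t y) \<le> dist x y" by (rule contr)
  qed (use N(2) in \<open>auto simp: G_def\<close>)
  then show ?thesis by (rule that)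
qed

text \<open>Composes the contractions of \<open>N\<^sub>2\<close> to \<open>N\<^sub>1\<close> and of
  \<open>N\<^sub>1\<close> to \<alpha>. The properties are stated for all degrees and scales at
  once, because the same map is applied to a cycle and to a chain that it bounds.\<close>

lemma retraction_to_circle:
  obtains \<rho> where
    "\<And>n r (c :: 'a list \<Rightarrow>\<^sub>0 'g::ab_group_add). c \<in> alt_chains n (Rips\<^sub>0 N\<^sub>2 r) \<Longrightarrow> push (map \<rho>) c \<in> alt_chains n (Rips\<^sub>0 \<alpha> r)"
    "\<And>n r (c :: 'a list \<Rightarrow>\<^sub>0 'g). c \<in> alt_chains n (Rips\<^sub>0 \<alpha> r) \<Longrightarrow> push (map \<rho>) c = c"
    "\<And>n r (c :: 'a list \<Rightarrow>\<^sub>0 'g). c \<in> alt_chains n (Rips\<^sub>0 N\<^sub>2 r) \<Longrightarrow> bd c = 0 \<Longrightarrow> homologous n (Rips\<^sub>0 N\<^sub>2 r) (push (map \<rho>) c) c"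
proof -
  obtain \<rho>\<^sub>2 where r2: "contracts_to N\<^sub>2 N\<^sub>1 \<rho>\<^sub>2" using N2_contracts_to_N1 .
  obtain \<rho>\<^sub>1 where r1: "contracts_to N\<^sub>1 \<alpha> \<rho>\<^sub>1" using deformation_contraction_contracts_to[OF dcN] .
  have comp: "push (map (\<lambda>x. \<rho>\<^sub>1 (\<rho>\<^sub>2 x))) c = push (map \<rho>\<^sub>1) (push (map \<rho>\<^sub>2) c)" for c :: "'a list \<Rightarrow>\<^sub>0 'g"
    by (simp add: push_push o_def)
  show ?thesis
  proof (rule that[of "\<lambda>x. \<rho>\<^sub>1 (\<rho>\<^sub>2 x)"])
    have c1: "push (map \<rho>\<^sub>2) c \<in> alt_chains n (Rips\<^sub>0 N\<^sub>1 r)" if "c \<in> alt_chains n (Rips\<^sub>0 N\<^sub>2 r)"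
      for n r and c :: "'a list \<Rightarrow>\<^sub>0 'g"
      by (rule contracts_to_push[OF r2 that])
    show "push (map (\<lambda>x. \<rho>\<^sub>1 (\<rho>\<^sub>2 x))) c \<in> alt_chains n (Rips\<^sub>0 \<alpha> r)"
      if c: "c \<in> alt_chains n (Rips\<^sub>0 N\<^sub>2 r)" for n r and c :: "'a list \<Rightarrow>\<^sub>0 'g"
      unfolding comp by (rule contracts_to_push[OF r1 c1[OF c]])
    show "homologous n (Rips\<^sub>0 N\<^sub>2 r) (push (map (\<lambda>x. \<rho>\<^sub>1 (\<rho>\<^sub>2 x))) c) c"
      if c: "c \<in> alt_chains n (Rips\<^sub>0 N\<^sub>2 r)" and bc: "bd c = 0" for n r and c :: "'a list \<Rightarrow>\<^sub>0 'g"
    proof -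
      have "homologous n (Rips\<^sub>0 N\<^sub>1 r) (push (map \<rho>\<^sub>1) (push (map \<rho>\<^sub>2) c)) (push (map \<rho>\<^sub>2) c)"
        by (rule contracts_to_homologous[OF r1 c1[OF c]]) (simp add: bd_push_map bc)
      then have "homologous n (Rips\<^sub>0 N\<^sub>2 r) (push (map \<rho>\<^sub>1) (push (map \<rho>\<^sub>2) c)) (push (map \<rho>\<^sub>2) c)"
        by (rule homologous_mono) (rule Rips\<^sub>0_mono[OF N(2) order_refl])
      from homologous_trans[OF this contracts_to_homologous[OF r2 c bc]]
      show ?thesis unfolding comp .
    qed
    show "push (map (\<lambda>x. \<rho>\<^sub>1 (\<rho>\<^sub>2 x))) c = c"
      if c: "c \<in> alt_chains n (Rips\<^sub>0 \<alpha> r)" for n r and c :: "'a list \<Rightarrow>\<^sub>0 'g"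
    proof -
      have "c \<in> alt_chains n (Rips\<^sub>0 N\<^sub>1 r)"
        by (rule subsetD[OF alt_chains_mono[OF Rips\<^sub>0_mono[OF contracts_toD(1)[OF r1] order_refl]] c])
      then show ?thesis
        unfolding comp by (simp only: contracts_to_push_id[OF r2] contracts_to_push_id[OF r1 c])
    qed
  qed
qed

text \<open>A simplex of diameter less than D that meets \<open>N\<^sub>1\<close> stays in the
  D-neighborhood of \<open>N\<^sub>1\<close>, hence in \<open>N\<^sub>2\<close>. So simplices are
  sorted by whether they meet \<open>N\<^sub>1\<close>.\<close>

lemma Rips_cover:
  assumes "r \<le> D" "S \<in> Rips\<^sub>0 UNIV r"
  shows "S \<inter> N\<^sub>1 \<noteq> {} \<Longrightarrow> S \<in> Rips\<^sub>0 N\<^sub>2 r" "S \<inter> N\<^sub>1 = {} \<Longrightarrow> S \<in> Rips\<^sub>0 outside r"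
proof -
  assume "S \<inter> N\<^sub>1 \<noteq> {}"
  then obtain x where x: "x \<in> S" "x \<in> N\<^sub>1" by blast
  have "y \<in> N\<^sub>2" if "y \<in> S" for y
  proof -
    have "dist x y < r" using assms(2) x(1) that by (simp add: Rips\<^sub>0_iff)
    then have "y \<in> ball x D" using assms(1) by simp
    then show ?thesis using nbhd x(2) by blast
  qed
  then show "S \<in> Rips\<^sub>0 N\<^sub>2 r" using assms(2) by (auto simp: Rips\<^sub>0_iff)
next
  assume "S \<inter> N\<^sub>1 = {}"
  then have "S \<subseteq> outside" by (auto simp: outside_def surface_interior_def)
  then show "S \<in> Rips\<^sub>0 outside r" using assms(2) by (auto simp: Rips\<^sub>0_iff)
qed

lemma chain_split:
  assumes "r \<le> D" "c \<in> alt_chains n (Rips\<^sub>0 UNIV r)"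
  obtains c1 c2 where "c = c1 + c2" "c1 \<in> alt_chains n (Rips\<^sub>0 N\<^sub>2 r)" "c2 \<in> alt_chains n (Rips\<^sub>0 outside r)"
proof (rule that)
  show "c = filter_chain (\<lambda>xs. set xs \<inter> N\<^sub>1 \<noteq> {}) c + filter_chain (\<lambda>xs. \<not> set xs \<inter> N\<^sub>1 \<noteq> {}) c"
    by (simp only: filter_chain_split)
  show "filter_chain (\<lambda>xs. set xs \<inter> N\<^sub>1 \<noteq> {}) c \<in> alt_chains n (Rips\<^sub>0 N\<^sub>2 r)"
    by (rule filter_set_in_chains[OF assms(2)]) (rule Rips_cover(1)[OF assms(1)])
  show "filter_chain (\<lambda>xs. \<not> set xs \<inter> N\<^sub>1 \<noteq> {}) c \<in> alt_chains n (Rips\<^sub>0 outside r)"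
    by (rule filter_set_in_chains[OF assms(2)]) (use Rips_cover(2)[OF assms(1)] in blast)
qed

lemma Rips_collar: "Rips\<^sub>0 N\<^sub>2 r \<inter> Rips\<^sub>0 outside r \<subseteq> Rips\<^sub>0 collar r"
  by (auto simp: Rips\<^sub>0_iff collar_def outside_def)

lemma cycle_in_collar_bounds:
  fixes c :: "'a list \<Rightarrow>\<^sub>0 'g::ab_group_add"
  assumes "0 < r" "r \<le> D" "3 \<le> n" "c \<in> alt_chains n (Rips\<^sub>0 N\<^sub>2 r)" "c \<in> alt_chains n (Rips\<^sub>0 outside r)" "bd c = 0"
  obtains u where "u \<in> alt_chains (Suc n) (Rips\<^sub>0 N\<^sub>2 r)" "u \<in> alt_chains (Suc n) (Rips\<^sub>0 outside r)" "bd u = c"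
proof -
  have "c \<in> alt_chains n (Rips\<^sub>0 collar r)"
    by (rule subsetD[OF alt_chains_mono[OF Rips_collar] alt_chains_Int[OF assms(4,5)]])
  from homologous_0D[OF collar_homology_vanishes[OF assms(1-3) this assms(6)]]
  obtain u where u: "u \<in> alt_chains (Suc n) (Rips\<^sub>0 collar r)" "bd u = c" .
  have "collar \<subseteq> N\<^sub>2" "collar \<subseteq> outside" by (auto simp: collar_def outside_def)
  then show ?thesis
    using that[OF subsetD[OF alt_chains_mono[OF Rips\<^sub>0_mono] u(1)] subsetD[OF alt_chains_mono[OF Rips\<^sub>0_mono] u(1)] u(2)]
    by simp
qed

text \<open>Cutting z = z1 + z2 leaves \<open>bd z1 = - bd z2\<close>, a cycle of dimension k - 1 in
  the collar. If u fills it there, z1 - u and z2 + u are cycles; the first is moved to \<alpha>, the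
  second stays outside.\<close>

lemma homology_spans:
  fixes z :: "'a list \<Rightarrow>\<^sub>0 'g::ab_group_add"
  assumes r: "0 < r" "r \<le> D" and k: "3 \<le> k" and z: "z \<in> cycles (Suc k) (Rips UNIV r)"
  shows "\<exists>a\<in>cycles (Suc k) (Rips \<alpha> r). \<exists>w\<in>cycles (Suc k) (Rips outside r).
    \<exists>y\<in>alt_chains (Suc (Suc k)) (Rips UNIV r). z = a + w + bd y"
proof -
  have z': "z \<in> alt_chains (Suc k) (Rips\<^sub>0 UNIV r)" "bd z = 0" using z by (simp_all add: cycles_def alt_chains_Rips\<^sub>0)
  obtain z1 z2 where s: "z = z1 + z2" "z1 \<in> alt_chains (Suc k) (Rips\<^sub>0 N\<^sub>2 r)" "z2 \<in> alt_chains (Suc k) (Rips\<^sub>0 outside r)"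
    using chain_split[OF r(2) z'(1)] .
  have b1: "bd z1 \<in> alt_chains k (Rips\<^sub>0 N\<^sub>2 r)" by (rule alt_chains_bd[OF s(2)]) (rule Rips\<^sub>0_down)
  have b2: "bd z2 \<in> alt_chains k (Rips\<^sub>0 outside r)" by (rule alt_chains_bd[OF s(3)]) (rule Rips\<^sub>0_down)
  have b: "bd z1 = - bd z2" using z'(2) by (simp add: s(1) bd_add add_eq_0_iff2)
  have b3: "bd z1 \<in> alt_chains k (Rips\<^sub>0 outside r)" unfolding b by (rule alt_chains_uminus[OF b2])
  obtain u where u: "u \<in> alt_chains (Suc k) (Rips\<^sub>0 N\<^sub>2 r)" "u \<in> alt_chains (Suc k) (Rips\<^sub>0 outside r)" "bd u = bd z1"
    using cycle_in_collar_bounds[OF r k b1 b3 bd_bd[OF s(2)]] .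
  obtain \<rho> where \<rho>: "\<And>n r (c :: 'a list \<Rightarrow>\<^sub>0 'g). c \<in> alt_chains n (Rips\<^sub>0 N\<^sub>2 r) \<Longrightarrow> push (map \<rho>) c \<in> alt_chains n (Rips\<^sub>0 \<alpha> r)"
    "\<And>n r (c :: 'a list \<Rightarrow>\<^sub>0 'g). c \<in> alt_chains n (Rips\<^sub>0 N\<^sub>2 r) \<Longrightarrow> bd c = 0 \<Longrightarrow> homologous n (Rips\<^sub>0 N\<^sub>2 r) (push (map \<rho>) c) c"
    by (rule retraction_to_circle[where ?'g = 'g]) (rule that)
  have c: "z1 - u \<in> alt_chains (Suc k) (Rips\<^sub>0 N\<^sub>2 r)" "bd (z1 - u) = 0"
    using alt_chains_diff[OF s(2) u(1)] u(3) by (simp_all add: bd_diff)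
  define a where "a = push (map \<rho>) (z1 - u)"
  have a: "a \<in> cycles (Suc k) (Rips \<alpha> r)"
    using \<rho>(1)[OF c(1)] c(2) by (simp add: a_def cycles_def bd_push_map alt_chains_Rips\<^sub>0)
  obtain y where y: "y \<in> alt_chains (Suc (Suc k)) (Rips\<^sub>0 N\<^sub>2 r)" "bd y = (z1 - u) - a"
    using homologous_sym[OF \<rho>(2)[OF c]] unfolding homologous_def a_def by blast
  have y': "y \<in> alt_chains (Suc (Suc k)) (Rips UNIV r)"
    using subsetD[OF alt_chains_mono[OF Rips\<^sub>0_mono[OF subset_UNIV order_refl]] y(1)] by (simp add: alt_chains_Rips\<^sub>0)
  have w: "z2 + u \<in> cycles (Suc k) (Rips outside r)"
    using alt_chains_add[OF s(3) u(2)] u(3) b by (simp add: cycles_def bd_add alt_chains_Rips\<^sub>0)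
  have "z = a + (z2 + u) + bd y" by (simp add: s(1) y(2))
  then show ?thesis using a w y' by blast
qed

text \<open>Cutting y = y1 + y2 makes \<open>a - bd y1 = bd y2 - w\<close> a cycle of dimension k in
  the collar. Filling it by u gives \<open>a = bd (y1 + u)\<close> inside \<open>N\<^sub>2\<close>,
  and the retraction carries this to \<alpha> without changing a.\<close>

lemma homology_trivial:
  fixes a :: "'a list \<Rightarrow>\<^sub>0 'g::ab_group_add"
  assumes r: "0 < r" "r \<le> D" and k: "3 \<le> k" and a: "a \<in> cycles (Suc k) (Rips \<alpha> r)"
    and w: "w \<in> cycles (Suc k) (Rips outside r)"
    and y: "y \<in> alt_chains (Suc (Suc k)) (Rips UNIV r)" "a + w = bd y"
  shows "a \<in> bd ` alt_chains (Suc (Suc k)) (Rips \<alpha> r)"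
proof -
  obtain \<rho>\<^sub>1 where r1: "contracts_to N\<^sub>1 \<alpha> \<rho>\<^sub>1" using deformation_contraction_contracts_to[OF dcN] .
  have \<alpha>N: "\<alpha> \<subseteq> N\<^sub>2" using contracts_toD(1)[OF r1] N(2) by (rule order_trans)
  obtain \<rho> where \<rho>: "\<And>n r (c :: 'a list \<Rightarrow>\<^sub>0 'g). c \<in> alt_chains n (Rips\<^sub>0 N\<^sub>2 r) \<Longrightarrow> push (map \<rho>) c \<in> alt_chains n (Rips\<^sub>0 \<alpha> r)"
    "\<And>n r (c :: 'a list \<Rightarrow>\<^sub>0 'g). c \<in> alt_chains n (Rips\<^sub>0 \<alpha> r) \<Longrightarrow> push (map \<rho>) c = c"
    by (rule retraction_to_circle[where ?'g = 'g]) (rule that)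
  have y': "y \<in> alt_chains (Suc (Suc k)) (Rips\<^sub>0 UNIV r)" using y(1) by (simp add: alt_chains_Rips\<^sub>0)
  obtain y1 y2 where s: "y = y1 + y2" "y1 \<in> alt_chains (Suc (Suc k)) (Rips\<^sub>0 N\<^sub>2 r)" "y2 \<in> alt_chains (Suc (Suc k)) (Rips\<^sub>0 outside r)"
    using chain_split[OF r(2) y'] .
  have a': "a \<in> alt_chains (Suc k) (Rips\<^sub>0 \<alpha> r)" "bd a = 0" using a by (simp_all add: cycles_def alt_chains_Rips\<^sub>0)
  have w': "w \<in> alt_chains (Suc k) (Rips\<^sub>0 outside r)" using w by (simp add: cycles_def alt_chains_Rips\<^sub>0)
  have aN: "a \<in> alt_chains (Suc k) (Rips\<^sub>0 N\<^sub>2 r)"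
    by (rule subsetD[OF alt_chains_mono[OF Rips\<^sub>0_mono[OF \<alpha>N order_refl]] a'(1)])
  have c1: "a - bd y1 \<in> alt_chains (Suc k) (Rips\<^sub>0 N\<^sub>2 r)"
    using aN alt_chains_bd[OF s(2) Rips\<^sub>0_down] by (rule alt_chains_diff)
  have eq: "a - bd y1 = bd y2 - w"
    using y(2) by (simp add: s(1) bd_add algebra_simps)
  have c2: "a - bd y1 \<in> alt_chains (Suc k) (Rips\<^sub>0 outside r)"
    unfolding eq using alt_chains_bd[OF s(3) Rips\<^sub>0_down] w' by (rule alt_chains_diff)
  have "bd (a - bd y1) = 0" using a'(2) bd_bd[OF s(2)] by (simp add: bd_diff)
  moreover have "3 \<le> Suc k" using k by simp
  ultimately obtain u where u: "u \<in> alt_chains (Suc (Suc k)) (Rips\<^sub>0 N\<^sub>2 r)" "bd u = a - bd y1"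
    using cycle_in_collar_bounds[OF r _ c1 c2] by blast
  have "a = bd (y1 + u)" by (simp add: bd_add u(2))
  then have "a = bd (push (map \<rho>) (y1 + u))" using \<rho>(2)[OF a'(1)] by (simp add: bd_push_map)
  moreover have "push (map \<rho>) (y1 + u) \<in> alt_chains (Suc (Suc k)) (Rips \<alpha> r)"
    using \<rho>(1)[OF alt_chains_add[OF s(2) u(1)]] by (simp add: alt_chains_Rips\<^sub>0)
  ultimately show ?thesis by blast
qed

lemma direct_summand_high_degree:
  fixes G :: "'g::ab_group_add itself"
  assumes k: "3 \<le> k"
  shows "direct_summand_via {0<..D} (Rips_persistence G k \<alpha>) (Rips_persistence G k (UNIV :: 'a set))
           (\<lambda>r. homology_inclusion G k (Rips \<alpha> r) (Rips UNIV r))"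
  unfolding Rips_persistence_def
proof (rule direct_summand_viaI[where V = "\<lambda>r. cycles (Suc k) (Rips outside r)"])
  show "cycles (Suc k) (Rips outside p) \<subseteq> cycles (Suc k) (Rips outside q)" if "p < q" for p q
    by (rule cycles_mono[OF Rips_mono]) (use that in auto)
  show "cycles (Suc k) (Rips outside r) \<subseteq> cycles (Suc k) (Rips UNIV r)" for r
    by (rule cycles_mono[OF Rips_mono]) auto
  show "1 \<le> k" using k by simp
  show "Rips \<alpha> r \<subseteq> Rips UNIV r" for r by (rule Rips_mono) auto
  show "Rips \<alpha> p \<subseteq> Rips \<alpha> q" if "p < q" for p q by (rule Rips_mono) (use that in auto)
  show "Rips (UNIV :: 'a set) p \<subseteq> Rips UNIV q" if "p < q" for p q by (rule Rips_mono) (use that in auto)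
  show "\<exists>a\<in>cycles (Suc k) (Rips \<alpha> r). \<exists>w\<in>cycles (Suc k) (Rips outside r).
      \<exists>y\<in>alt_chains (Suc (Suc k)) (Rips UNIV r). z = a + w + bd y"
    if "r \<in> {0<..D}" "z \<in> cycles (Suc k) (Rips UNIV r)" for r and z :: "'a list \<Rightarrow>\<^sub>0 'g"
    by (rule homology_spans[OF _ _ k that(2)]) (use that(1) in auto)
  show "a \<in> bd ` alt_chains (Suc (Suc k)) (Rips \<alpha> r)"
    if "r \<in> {0<..D}" "a \<in> cycles (Suc k) (Rips \<alpha> r)" "w \<in> cycles (Suc k) (Rips outside r)"
      "y \<in> alt_chains (Suc (Suc k)) (Rips UNIV r)" "a + w = bd y" for r and a w y :: "'a list \<Rightarrow>\<^sub>0 'g"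
    by (rule homology_trivial[OF _ _ k that(2-5)]) (use that(1) in auto)
qed (auto intro: simplicial_complex_Rips cycles_add cycles_uminus)

end


section \<open>Short cycles on a metric circle\<close>

text \<open>The oriented simplex with coefficient g as an alternating chain, obtained by iterated
  cones from the empty list. It vanishes when a vertex is repeated.\<close>

primrec elementary :: "'a list \<Rightarrow> 'g::ab_group_add \<Rightarrow> ('a list \<Rightarrow>\<^sub>0 'g)" where
  "elementary [] g = single [] g"
| "elementary (x # xs) g = chain_cone x (elementary xs g)"

lemma alt_single_Nil: "alt (single [] (g :: 'g::ab_group_add) :: 'a list \<Rightarrow>\<^sub>0 'g)"
  unfolding alt_def
proof (intro conjI allI impI)
  fix n and xs :: "'a list" assume "Suc n < length xs"
  then have "length xs \<noteq> 0" "length (swap_at n xs) \<noteq> 0" by auto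
  then have "xs \<noteq> []" "swap_at n xs \<noteq> []" by (metis list.size(3))+
  then show "lookup (single [] g) (swap_at n xs) = - lookup (single [] g) xs"
    by (simp add: lookup_single)
qed simp

lemma elementary_in_chains: "elementary xs g \<in> alt_chains (length xs) {set xs}"
proof (induction xs)
  case Nil
  then show ?case by (auto simp: alt_chains_def alt_single_Nil)
next
  case (Cons x xs)
  have "chain_cone x (elementary xs g) \<in> alt_chains (Suc (length xs)) {set (x # xs)}"
    by (rule alt_chains_cone[OF Cons]) simp
  then show ?case by simp
qed

lemma elementary_in_chains': "set xs \<in> K \<Longrightarrow> n = length xs \<Longrightarrow> elementary xs g \<in> alt_chains n K"
  using subsetD[OF alt_chains_mono[of "{set xs}" K] elementary_in_chains[of xs g]] by simp

lemma elementary_add: "elementary xs (g + h) = elementary xs g + elementary xs h"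
  by (induction xs) (simp_all add: single_add cone_add)

lemma lookup_elementary: "distinct xs \<Longrightarrow> lookup (elementary xs g) xs = g"
proof (induction xs)
  case (Cons x xs)
  have "lookup (elementary xs g) (x # ys) = 0" for ys
  proof (rule ccontr)
    assume "lookup (elementary xs g) (x # ys) \<noteq> 0"
    then have "x # ys \<in> keys (elementary xs g)" by (simp add: in_keys_iff)
    then have "set (x # ys) = set xs" using elementary_in_chains[of xs g] unfolding alt_chains_def by blast
    then show False using Cons.prems by auto
  qed
  then show ?case using Cons by (simp add: lookup_cone)
qed simp

text \<open>All orderings of a simplex are permutations of one another, so antisymmetry determines
  the component from the coefficient of a single ordering.\<close>

lemma part_eq_elementary:
  assumes z: "z \<in> alt_chains n K" and xs: "distinct xs" "length xs = n"
  shows "part (set xs) z = elementary xs (lookup z xs)"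
proof -
  define d where "d = part (set xs) z - elementary xs (lookup z xs)"
  have p: "part (set xs) z \<in> alt_chains n {set xs}"
    by (rule subsetD[OF alt_chains_mono alt_chains_part[OF z]]) auto
  have d: "d \<in> alt_chains n {set xs}"
    unfolding d_def using xs(2) elementary_in_chains[of xs "lookup z xs"] by (intro alt_chains_diff p) simp
  have 0: "lookup d xs = 0" by (simp add: d_def lookup_minus lookup_part lookup_elementary[OF xs(1)])
  have "lookup d ys = 0" for ys
  proof (rule ccontr)
    assume "lookup d ys \<noteq> 0"
    then have ys: "ys \<in> keys d" by (simp add: in_keys_iff)
    then have "set ys = set xs" "distinct ys" using d by (auto simp: alt_chains_def dest: alt_distinctD)
    then have "mset ys = mset xs" using xs(1) set_eq_iff_mset_eq_distinct by blast
    then obtain p where "p permutes {..<length xs}" "permute_list p xs = ys" by (rule mset_eq_permutation)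
    then show False using alt_permute[of d p xs] d 0 ys by (auto simp: alt_chains_def in_keys_iff split: if_splits)
  qed
  then have "d = 0" by (intro poly_mapping_eqI) simp
  then show ?thesis by (simp add: d_def)
qed

section \<open>Orientation and boundary of oriented simplices\<close>

lemma cone_push_Cons: "chain_cone a (push (Cons x) c) = push (Cons a) (push (Cons x) c) - push (Cons x) (chain_cone a c)"
  by (rule additive_eqI[where c = c]) (simp_all add: cone_add push_add)

lemma cone_list_anticommute: "chain_cone a (cone_list b xs g) + chain_cone b (cone_list a xs g) = 0"
proof (induction xs)
  case (Cons x xs)
  have "chain_cone a (cone_list b (x # xs) g) + chain_cone b (cone_list a (x # xs) g)
      = push (Cons x) (chain_cone a (cone_list b xs g) + chain_cone b (cone_list a xs g))"
    by (simp add: cone_diff cone_push_Cons push_diff push_add algebra_simps)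
  then show ?case using Cons by simp
qed simp

lemma cone_anticommute: "chain_cone a (chain_cone b c) = - chain_cone b (chain_cone a c)"
proof (rule additive_eqI[where c = c])
  fix xs :: "'a list" and g :: 'b
  show "chain_cone a (chain_cone b (single xs g)) = - chain_cone b (chain_cone a (single xs g))"
    using cone_list_anticommute[of a b xs g] by (simp add: eq_neg_iff_add_eq_0)
qed (simp_all add: cone_add)

lemma elementary3_rotate: "elementary [a, b, c] g = elementary [b, c, a] g"
  using cone_anticommute[of a b "chain_cone c (single [] g)"] cone_anticommute[of a c "single [] g"]
  by (simp add: cone_uminus del: cone_single)

lemma bd_elementary3: "bd (elementary [a, b, c] g) = elementary [b, c] g - elementary [a, c] g + elementary [a, b] g"
  by (simp add: bd_cone cone_diff del: cone_single)

lemma bd_elementary4: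
  "bd (elementary [a, b, c, d] g) = elementary [b, c, d] g - elementary [a, c, d] g + elementary [a, b, d] g - elementary [a, b, c] g"
  by (simp add: bd_cone cone_diff cone_add del: cone_single)

section \<open>Distance to the nearest integer\<close>

definition nint :: "real \<Rightarrow> real" where
  "nint x = \<bar>x - of_int (round x)\<bar>"

lemma nint_le: "nint x \<le> \<bar>x - of_int n\<bar>"
  unfolding nint_def by (rule round_diff_minimal)

lemma nint_le_abs: "nint x \<le> \<bar>x\<bar>"
  using nint_le[of x 0] by simp

lemma nint_le_half: "nint x \<le> 1 / 2"
  unfolding nint_def using of_int_round_abs_le[of x] by (simp add: abs_minus_commute)

lemma nint_eq_abs:
  assumes "\<bar>x\<bar> \<le> 1 / 2"
  shows "nint x = \<bar>x\<bar>"
proof (cases "round x = 0")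
  case False
  then have "\<bar>real_of_int (round x)\<bar> \<ge> 1" by linarith
  then have "\<bar>x - of_int (round x)\<bar> \<ge> \<bar>x\<bar>" using assms by linarith
  then show ?thesis using nint_le_abs[of x] by (simp add: nint_def)
qed (simp add: nint_def)

lemma nint_add_int: "nint (x + of_int n) = nint x"
proof (rule antisym)
  show "nint (x + of_int n) \<le> nint x"
    using nint_le[of "x + of_int n" "round x + n"] by (simp add: nint_def)
  show "nint x \<le> nint (x + of_int n)"
    using nint_le[of x "round (x + of_int n) - n"] by (simp add: nint_def algebra_simps)
qed

lemma nint_eq_0_iff: "nint x = 0 \<longleftrightarrow> x \<in> \<int>"
proof
  assume "nint x = 0"
  then have "x = of_int (round x)" by (simp add: nint_def)
  then show "x \<in> \<int>" by (metis Ints_of_int)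
next
  assume "x \<in> \<int>"
  then obtain n where "x = of_int n" by (rule Ints_cases)
  then show "nint x = 0" by (simp add: nint_def)
qed

lemma nint_less_ex: "nint x < d \<Longrightarrow> \<exists>n::int. \<bar>x - of_int n\<bar> < d"
  unfolding nint_def by blast

text \<open>L is the circumference, and \<open>nint\<close> of the difference is the arc length
  distance on the reals modulo 1. The diameter is therefore L/2.\<close>

locale metric_circle =
  fixes e :: "real \<Rightarrow> 'a::metric_space" and L :: real
  assumes L: "0 < L" and dist_e: "dist (e s) (e t) = L * nint (s - t)"
begin

lemma e_eq_iff: "e s = e t \<longleftrightarrow> s - t \<in> \<int>"
proof -
  have "e s = e t \<longleftrightarrow> L * nint (s - t) = 0" by (simp add: dist_e[symmetric])
  then show ?thesis using L by (simp add: nint_eq_0_iff)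
qed

lemma e_add_int: "e (s + of_int n) = e s"
  by (simp add: e_eq_iff)

lemma dist_e_le: "dist (e s) (e t) \<le> L * \<bar>s - t\<bar>"
  unfolding dist_e using L nint_le_abs by simp

lemma dist_e_close: "\<bar>s - t\<bar> \<le> 1 / 2 \<Longrightarrow> dist (e s) (e t) = L * \<bar>s - t\<bar>"
  by (simp add: dist_e nint_eq_abs)

lemma lift_near:
  assumes "dist (e s) (e t) < L * d"
  obtains s' where "e s' = e s" "\<bar>s' - t\<bar> < d"
proof -
  have "nint (s - t) < d" using assms L by (simp add: dist_e)
  then obtain n :: int where "\<bar>s - t - of_int n\<bar> < d" using nint_less_ex by blast
  then show ?thesis using that[of "s + of_int (- n)"] e_add_int[of s "- n"] by (simp add: algebra_simps)
qed

text \<open>Vertex sets contained in an arc of length less than r, that is, simplices that do not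
  wind around. Winding triangles exist as soon as three arcs shorter than r can close up, which
  happens for r > L/3.\<close>

definition short :: "real \<Rightarrow> 'a set set" where
  "short r = {S. finite S \<and> (\<exists>u l. 0 \<le> l \<and> L * l < r \<and> S \<subseteq> e ` {u..u + l})}"

lemma short_down: "S \<in> short r \<Longrightarrow> T \<subseteq> S \<Longrightarrow> T \<in> short r"
proof -
  assume S: "S \<in> short r" and T: "T \<subseteq> S"
  then obtain u l where "finite S" "0 \<le> l" "L * l < r" "S \<subseteq> e ` {u..u + l}" unfolding short_def by blast
  then show "T \<in> short r"
    unfolding short_def using T finite_subset[OF T] by (intro CollectI conjI exI[of _ u] exI[of _ l]) auto
qed

lemma short_Rips: "short r \<subseteq> Rips\<^sub>0 (range e) r"
proof
  fix S assume "S \<in> short r"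
  then obtain u l where S: "finite S" "L * l < r" "S \<subseteq> e ` {u..u + l}" unfolding short_def by blast
  have "dist x y < r" if xy: "x \<in> S" "y \<in> S" for x y
  proof -
    obtain s t where st: "x = e s" "y = e t" "s \<in> {u..u + l}" "t \<in> {u..u + l}" using S(3) xy by blast
    have "dist x y \<le> L * \<bar>s - t\<bar>" unfolding st(1,2) by (rule dist_e_le)
    also have "\<dots> \<le> L * l" using st(3,4) L by (intro mult_left_mono) auto
    finally show ?thesis using S(2) by simp
  qed
  then show "S \<in> Rips\<^sub>0 (range e) r" using S by (auto simp: Rips\<^sub>0_iff)
qed

text \<open>Lifts of the two extreme points of S. The bound 1/2 makes the pair unique up to a common
  integer translation.\<close>

definition ends_of :: "'a set \<Rightarrow> real \<times> real \<Rightarrow> bool" where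
  "ends_of S p \<longleftrightarrow> fst p \<le> snd p \<and> snd p - fst p < 1 / 2 \<and> e (fst p) \<in> S \<and> e (snd p) \<in> S \<and> S \<subseteq> e ` {fst p..snd p}"

lemma ends_exist:
  assumes "r \<le> L / 2" "S \<in> short r" "S \<noteq> {}"
  shows "\<exists>p. ends_of S p \<and> L * (snd p - fst p) < r"
proof -
  obtain u l where S: "finite S" "0 \<le> l" "L * l < r" "S \<subseteq> e ` {u..u + l}" using assms(2) unfolding short_def by blast
  have "L * l < L * (1 / 2)" using S(3) assms(1) by simp
  then have l: "l < 1 / 2" using L by simp
  define A where "A = {t \<in> {u..u + l}. e t \<in> S}"
  have "inj_on e A"
  proof (rule inj_onI)
    fix s t assume st: "s \<in> A" "t \<in> A" "e s = e t"
    then obtain n :: int where n: "s - t = of_int n" by (auto simp: e_eq_iff elim: Ints_cases)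
    have "\<bar>s - t\<bar> < 1" using st(1,2) l by (auto simp: A_def)
    then have "n = 0" using n by linarith
    then show "s = t" using n by simp
  qed
  moreover have "e ` A \<subseteq> S" by (auto simp: A_def)
  ultimately have fA: "finite A" using S(1) by (metis finite_imageD finite_subset)
  have eA: "e ` A = S" using S(4) by (auto simp: A_def)
  then have neA: "A \<noteq> {}" using assms(3) by blast
  have mM: "Min A \<in> A" "Max A \<in> A" using fA neA by auto
  have le: "Min A \<le> Max A" using fA neA mM by simp
  have len: "Max A - Min A \<le> l" using mM by (auto simp: A_def)
  have "A \<subseteq> {Min A..Max A}" using fA by auto
  then have "S \<subseteq> e ` {Min A..Max A}" using eA by blast
  moreover have "e (Min A) \<in> S" "e (Max A) \<in> S" using eA mM by auto
  moreover have "L * (Max A - Min A) < r"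
  proof (rule le_less_trans[OF _ S(3)])
    show "L * (Max A - Min A) \<le> L * l" using len L by (intro mult_left_mono) auto
  qed
  ultimately show ?thesis using le len l by (intro exI[of _ "(Min A, Max A)"]) (simp add: ends_of_def)
qed

text \<open>The end points of the face lift into the larger arc after adding integers i and j. Both
  arcs are shorter than 1/2, so i - j has absolute value below 1 and the two integers agree: the
  subarc is translated as a whole.\<close>

lemma ends_mono:
  assumes "ends_of S p" "ends_of T q" "T \<subseteq> S"
  shows "e ` {fst q..snd q} \<subseteq> e ` {fst p..snd p}"
proof -
  obtain a b where ab: "e (fst q) = e a" "a \<in> {fst p..snd p}" "e (snd q) = e b" "b \<in> {fst p..snd p}"
    using assms unfolding ends_of_def by blast
  obtain i j :: int where ij: "a - fst q = of_int i" "b - snd q = of_int j"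
    using ab(1,3) e_eq_iff by (metis Ints_cases)
  have "\<bar>real_of_int (j - i)\<bar> < 1"
    using ij ab(2,4) assms(1,2) unfolding ends_of_def by auto
  then have ji: "j = i" by linarith
  show ?thesis
  proof
    fix x assume "x \<in> e ` {fst q..snd q}"
    then obtain t where t: "x = e t" "fst q \<le> t" "t \<le> snd q" by auto
    have "x = e (t + of_int i)" using t(1) by (simp add: e_add_int)
    moreover have "t + of_int i \<in> {fst p..snd p}" using t(2,3) ij ji ab(2,4) by auto
    ultimately show "x \<in> e ` {fst p..snd p}" by blast
  qed
qed

definition ends :: "'a set \<Rightarrow> real \<times> real" where
  "ends S = (SOME p. ends_of S p)"

text \<open>The arc spanned by S. The empty set has no end points; its arc is set to be empty, which
  keeps arcs monotone.\<close>

definition arc :: "'a set \<Rightarrow> 'a set" where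
  "arc S = (if S = {} then {} else e ` {fst (ends S)..snd (ends S)})"

definition shrink :: "nat \<Rightarrow> 'a set \<Rightarrow> nat \<Rightarrow> 'a \<Rightarrow> 'a" where
  "shrink M S i x = (let u = fst (ends S) in
     e (u + (1 - real i / real M) * ((SOME t. t \<in> {u..snd (ends S)} \<and> e t = x) - u)))"

lemma ends_of_ends: "r \<le> L / 2 \<Longrightarrow> S \<in> short r \<Longrightarrow> S \<noteq> {} \<Longrightarrow> ends_of S (ends S)"
  unfolding ends_def using ends_exist[of r S] someI_ex[of "ends_of S"] by blast

text \<open>The choice of \<open>ends\<close> does not mention r. The bound is recovered from any
  pair of end points that satisfies it, because on arcs shorter than 1/2 the length is the distance
  between the ends.\<close>

lemma ends_length:
  assumes "r \<le> L / 2" "S \<in> short r" "S \<noteq> {}"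
  shows "L * (snd (ends S) - fst (ends S)) < r"
proof -
  obtain p where p: "ends_of S p" "L * (snd p - fst p) < r" using ends_exist[OF assms] by blast
  note h = ends_of_ends[OF assms]
  have "e (snd (ends S)) \<in> e ` {fst p..snd p}" "e (fst (ends S)) \<in> e ` {fst p..snd p}"
    using h p(1) unfolding ends_of_def by blast+
  then obtain a b where ab: "e (fst (ends S)) = e a" "a \<in> {fst p..snd p}" "e (snd (ends S)) = e b" "b \<in> {fst p..snd p}"
    by blast
  have le: "\<bar>fst (ends S) - snd (ends S)\<bar> \<le> 1 / 2" using h unfolding ends_of_def by auto
  have "L * \<bar>fst (ends S) - snd (ends S)\<bar> = dist (e a) (e b)"
    unfolding dist_e_close[OF le, symmetric] ab(1,3) ..
  also have "\<dots> \<le> L * \<bar>a - b\<bar>" by (rule dist_e_le)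
  also have "\<dots> \<le> L * (snd p - fst p)" using ab L by (intro mult_left_mono) auto
  finally show ?thesis using p(2) h by (auto simp: ends_of_def)
qed

lemma shrink_e:
  assumes "ends_of S (ends S)" "t \<in> {fst (ends S)..snd (ends S)}"
  shows "shrink M S i (e t) = e (fst (ends S) + (1 - real i / real M) * (t - fst (ends S)))"
proof -
  have "s = t" if s: "s \<in> {fst (ends S)..snd (ends S)}" "e s = e t" for s
  proof -
    obtain n :: int where n: "s - t = of_int n" using s(2) by (auto simp: e_eq_iff elim: Ints_cases)
    have "\<bar>s - t\<bar> < 1" using s(1) assms unfolding ends_of_def by auto
    then have "n = 0" using n by linarith
    then show ?thesis using n by simp
  qed
  then have "(SOME s. s \<in> {fst (ends S)..snd (ends S)} \<and> e s = e t) = t"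
    using assms(2) by (intro some_equality) auto
  then show ?thesis by (simp add: shrink_def Let_def)
qed

text \<open>On arcs shorter than half the circle, distance is L times the parameter difference, so
  shrinking the parameter linearly towards the initial point increases no distance by more than the
  step L/M.\<close>

lemma contracted_carriers_short:
  assumes r: "r \<le> L / 2" and M: "0 < M"
  shows "contracted_carriers (short r) arc (shrink M) M (\<lambda>S. e (fst (ends S))) (\<lambda>a x y. dist x y \<le> a) (L / real M)"
proof
  show "0 \<le> L / real M" using L by simp
  show "T \<in> short r" if "S \<in> short r" "T \<subseteq> S" for S T using that by (rule short_down)
  show "arc T \<subseteq> arc S" if "S \<in> short r" "T \<subseteq> S" for S T
  proof (cases "T = {}")
    case False
    then have "S \<noteq> {}" using that by blast
    then show ?thesis
      using ends_mono[OF ends_of_ends[OF r that(1)] ends_of_ends[OF r short_down[OF that] False] that(2)] False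
      by (simp add: arc_def)
  qed (simp add: arc_def)
next
  fix S assume S: "S \<in> short r" "S \<noteq> {}"
  note h = ends_of_ends[OF r S]
  let ?u = "fst (ends S)" and ?v = "snd (ends S)"
  have uv: "?u \<le> ?v" "?v - ?u < 1 / 2" using h by (simp_all add: ends_of_def)
  have arc: "arc S = e ` {?u..?v}" using S by (simp add: arc_def)
  show "e ?u \<in> arc S" using uv by (auto simp: arc)
  {
    fix i x assume i: "i \<le> M" and "x \<in> arc S"
    then obtain t where t: "x = e t" "t \<in> {?u..?v}" by (auto simp: arc)
    have "(1 - real i / real M) * (t - ?u) \<le> 1 * (t - ?u)" using t(2) by (intro mult_right_mono) auto
    moreover have "0 \<le> (1 - real i / real M) * (t - ?u)" using t(2) i M by simp
    ultimately have "?u + (1 - real i / real M) * (t - ?u) \<in> {?u..?v}" using t(2) by auto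
    then show "shrink M S i x \<in> arc S" unfolding t(1) shrink_e[OF h t(2)] arc by blast
  next
    fix x assume "x \<in> arc S"
    then obtain t where t: "x = e t" "t \<in> {?u..?v}" by (auto simp: arc)
    show "shrink M S 0 x = x" unfolding t(1) shrink_e[OF h t(2)] by simp
    show "shrink M S M x = e ?u" unfolding t(1) shrink_e[OF h t(2)] using M by simp
  next
    fix x y i j a assume "x \<in> arc S" "y \<in> arc S" and ij: "i \<le> M" "j \<le> M" "i \<le> Suc j" "j \<le> Suc i"
      and a: "0 \<le> a" "dist x y \<le> a"
    then obtain s t where st: "x = e s" "s \<in> {?u..?v}" "y = e t" "t \<in> {?u..?v}" by (auto simp: arc)
    define p q where "p = real i / real M" and "q = real j / real M"
    have p: "0 \<le> p" "p \<le> 1" using ij M by (auto simp: p_def)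
    have "\<bar>real i - real j\<bar> \<le> 1" using ij by auto
    then have pq: "\<bar>p - q\<bar> \<le> 1 / real M"
      using M by (simp add: p_def q_def diff_divide_distrib[symmetric] divide_right_mono)
    have "\<bar>s - t\<bar> \<le> 1 / 2" using st(2,4) uv by (auto simp: abs_if)
    then have "dist x y = L * \<bar>s - t\<bar>" unfolding st by (rule dist_e_close)
    have "\<bar>(?u + (1 - p) * (s - ?u)) - (?u + (1 - q) * (t - ?u))\<bar> = \<bar>(1 - p) * (s - t) + (q - p) * (t - ?u)\<bar>"
      by (simp add: algebra_simps)
    also have "\<dots> \<le> \<bar>(1 - p) * (s - t)\<bar> + \<bar>(q - p) * (t - ?u)\<bar>" by (rule abs_triangle_ineq)
    also have "\<dots> \<le> 1 * \<bar>s - t\<bar> + 1 / real M * 1"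
      unfolding abs_mult using p pq st(4) uv by (intro add_mono mult_mono) auto
    finally have "L * \<bar>(?u + (1 - p) * (s - ?u)) - (?u + (1 - q) * (t - ?u))\<bar> \<le> L * (\<bar>s - t\<bar> + 1 / real M)"
      using L by (intro mult_left_mono) auto
    also have "\<dots> = dist x y + L / real M" using \<open>dist x y = L * \<bar>s - t\<bar>\<close> by (simp add: algebra_simps)
    also have "\<dots> \<le> a + L / real M" using a by simp
    finally show "dist (shrink M S i x) (shrink M S j y) \<le> a + L / real M"
      unfolding st(1,3) shrink_e[OF h st(2)] shrink_e[OF h st(4)] p_def[symmetric] q_def[symmetric]
      using dist_e_le order_trans by blast
  }
qed auto

text \<open>The scheme used for |K|, now carried out inside the circle with arcs as carriers:
  subdivide the cycle within its arcs, then round it to a regular polygon, which has no alternating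
  chains on three or more vertices.\<close>

lemma short_cycle_bounds:
  fixes z :: "'a list \<Rightarrow>\<^sub>0 'g::ab_group_add"
  assumes r: "0 < r" "r \<le> L / 2" and n: "3 \<le> n" and z: "z \<in> alt_chains n (short r)" "bd z = 0"
  shows "homologous n (Rips\<^sub>0 (range e) r) z 0"
proof -
  \<comment> \<open>Number of vertices of the polygon. Rounding moves a point by at most L/m; moving
    both ends and adding the mesh, which is below L/(2m), must stay below r.\<close>
  obtain m :: nat where m: "4 * L / r < real m" using reals_Archimedean2 by blast
  have "0 < 4 * L / r" using r L by simp
  with m have m0: "0 < real m" by linarith
  have m1: "4 * (L / real m) < r" using m m0 r by (simp add: field_simps)
  \<comment> \<open>The mesh n L / M of the subdivision becomes less than half an edge L/m of the
    polygon, so that each subdivided simplex rounds to at most two vertices.\<close>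
  obtain M :: nat where M: "real n * 4 * real m < real M" using reals_Archimedean2 by blast
  have "0 \<le> real n * 4 * real m" by simp
  with M have "0 < real M" by linarith
  then have M0: "0 < M" by simp
  define \<epsilon> where "\<epsilon> = real n * (L / real M)"
  have e1: "\<epsilon> < L * (1 / (2 * real m))"
  proof -
    have "real n * 2 * real m \<le> real n * 4 * real m" by (intro mult_right_mono mult_left_mono) auto
    then have "real n * 2 * real m < real M" using M by (rule le_less_trans)
    then have "L * (real n * 2 * real m) < L * real M" using L by simp
    then show ?thesis using m0 \<open>0 < real M\<close> by (simp add: \<epsilon>_def field_simps)
  qed
  have m0': "0 < m" using m0 by simp
  obtain \<pi> where pi: "\<And>t. \<pi> (e t) = e (real_of_int \<lfloor>real m * t\<rfloor> / real m)"
    and fin: "\<And>a. finite (\<pi> ` e ` {a - 1 / (2 * real m)<..<a + 1 / (2 * real m)})"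
    and card: "\<And>a. card (\<pi> ` e ` {a - 1 / (2 * real m)<..<a + 1 / (2 * real m)}) \<le> 2"
    by (rule rounding_exists[OF e_eq_iff m0']) (rule that)
  interpret sub: contracted_carriers "short r" arc "shrink M" M "\<lambda>S. e (fst (ends S))" "\<lambda>a x y. dist x y \<le> a" "L / real M"
    by (rule contracted_carriers_short[OF r(2) M0])
  define w where "w = sub.subdivision n z"
  define P where "P = {T. finite T \<and> T \<subseteq> range e \<and> (\<forall>x\<in>T. \<forall>y\<in>T. dist x y \<le> \<epsilon>)}"
  have arc_range: "arc S \<subseteq> range e" for S by (auto simp: arc_def)
  have w: "w \<in> alt_chains n P"
    using sub.subdivision_in_chains[OF z(1)] arc_range
    unfolding w_def alt_chains_def P_def sub.small_def \<epsilon>_def by blast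
  have bw: "bd w = 0" unfolding w_def by (rule sub.bd_subdivision_cycle[OF z])
  have arc_sub: "S \<subseteq> arc S" if "S \<in> short r" for S
    using ends_of_ends[OF r(2) that] by (cases "S = {}") (auto simp: arc_def ends_of_def)
  obtain y where y: "y \<in> alt_chains (Suc n) {T. \<exists>S\<in>short r. T \<subseteq> arc S}" "bd y = push (map (\<lambda>x. x)) w - z"
    unfolding w_def
    by (rule sub.push_subdivision_homologous[OF z, where \<phi> = "\<lambda>x. x" and Car = arc])
       (auto intro: that dest: arc_sub subsetD[OF sub.C_mono])
  have arc_short: "T \<in> short r" if "S \<in> short r" "T \<subseteq> arc S" "finite T" for S T
  proof (cases "S = {}")
    case False
    have "fst (ends S) \<le> snd (ends S)" using ends_of_ends[OF r(2) that(1) False] by (simp add: ends_of_def)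
    then show ?thesis
      using that False ends_length[OF r(2) that(1) False] unfolding short_def
      by (intro CollectI conjI exI[of _ "fst (ends S)"] exI[of _ "snd (ends S) - fst (ends S)"]) (auto simp: arc_def)
  next
    case True
    then have "T = S" using that by (simp add: arc_def)
    then show ?thesis using that(1) by simp
  qed
  have "set xs \<in> Rips\<^sub>0 (range e) r" if xs: "xs \<in> keys y" for xs
  proof -
    obtain S where S: "S \<in> short r" "set xs \<subseteq> arc S" using y(1) xs unfolding alt_chains_def by blast
    show ?thesis by (rule subsetD[OF short_Rips arc_short[OF S finite_set]])
  qed
  then have "y \<in> alt_chains (Suc n) (Rips\<^sub>0 (range e) r)" using y(1) by (simp add: alt_chains_def)
  then have wz: "homologous n (Rips\<^sub>0 (range e) r) w z"
    using y(2) unfolding homologous_def by (intro bexI[of _ y]) auto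
  have pi_near: "dist (e t) (\<pi> (e t)) \<le> L / real m" for t
  proof -
    have "\<bar>real m * t - real_of_int \<lfloor>real m * t\<rfloor>\<bar> \<le> 1" by linarith
    then have "\<bar>real m * t - real_of_int \<lfloor>real m * t\<rfloor>\<bar> / real m \<le> 1 / real m"
      using m0 by (intro divide_right_mono) auto
    moreover have "\<bar>t - real_of_int \<lfloor>real m * t\<rfloor> / real m\<bar> = \<bar>real m * t - real_of_int \<lfloor>real m * t\<rfloor>\<bar> / real m"
    proof -
      have "t - real_of_int \<lfloor>real m * t\<rfloor> / real m = (real m * t - real_of_int \<lfloor>real m * t\<rfloor>) / real m"
        using m0 by (simp add: diff_divide_distrib)
      then show ?thesis using m0 by (simp add: abs_divide)
    qed
    ultimately have "L * \<bar>t - real_of_int \<lfloor>real m * t\<rfloor> / real m\<bar> \<le> L * (1 / real m)"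
      using L by (intro mult_left_mono) auto
    then show ?thesis unfolding pi using dist_e_le[of t] order_trans by fastforce
  qed
  have eps: "\<epsilon> + 2 * (L / real m) < r"
  proof -
    have "L * (1 / (2 * real m)) \<le> 1 * (L / real m)" using m0 L by (simp add: field_simps)
    moreover have "0 < L / real m" using L m0 by simp
    ultimately show ?thesis using e1 m1 by linarith
  qed
  have "homologous n (Rips\<^sub>0 (range e) r) (push (map \<pi>) w) (push (map (\<lambda>x. x)) w)"
  proof (rule homologous_contiguous[OF w bw])
    show "T \<in> P" if "S \<in> P" "T \<subseteq> S" for S T using that finite_subset unfolding P_def by blast
    fix S U assume S: "S \<in> P" and U: "U \<subseteq> (\<lambda>x. x) ` S \<union> \<pi> ` S"
    have near: "\<exists>x\<in>S. dist a x \<le> L / real m" "a \<in> range e" if a: "a \<in> U" for a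
    proof -
      obtain x where x: "x \<in> S" "a = x \<or> a = \<pi> x" using U a by auto
      obtain t where t: "x = e t" using S x(1) unfolding P_def by blast
      have "dist x x \<le> L / real m" using L by simp
      then show "\<exists>x\<in>S. dist a x \<le> L / real m"
        using x pi_near[of t] t by (metis dist_commute)
      show "a \<in> range e" using x(2) t pi by auto
    qed
    have "dist a b < r" if ab: "a \<in> U" "b \<in> U" for a b
    proof -
      obtain x where x: "x \<in> S" "dist a x \<le> L / real m" using near(1)[OF ab(1)] by blast
      obtain y where y: "y \<in> S" "dist b y \<le> L / real m" using near(1)[OF ab(2)] by blast
      have "dist x y \<le> \<epsilon>" using S x(1) y(1) by (simp add: P_def)
      moreover have "dist a b \<le> dist a x + dist x y + dist b y"
        using dist_triangle[of a b x] dist_triangle[of x b y] by (simp add: dist_commute)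
      ultimately show ?thesis using x y eps by linarith
    qed
    moreover have "finite U" using U S finite_subset[OF U] by (simp add: P_def)
    ultimately show "U \<in> Rips\<^sub>0 (range e) r" using near(2) by (auto simp: Rips\<^sub>0_iff)
  qed
  then have pw: "homologous n (Rips\<^sub>0 (range e) r) (push (map \<pi>) w) w" by simp
  have "push (map \<pi>) w = 0"
  proof (rule alt_chains_eq_zero)
    show "push (map \<pi>) w \<in> alt_chains n {T. card T \<le> 2}"
    proof (rule alt_chains_push[OF w])
      fix T assume T: "T \<in> P"
      show "\<pi> ` T \<in> {T. card T \<le> 2}"
      proof (cases "T = {}")
        case False
        then obtain t where t: "e t \<in> T" using T unfolding P_def by blast
        have "T \<subseteq> e ` {t - 1 / (2 * real m)<..<t + 1 / (2 * real m)}"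
        proof
          fix x assume x: "x \<in> T"
          then obtain s where s: "x = e s" using T unfolding P_def by blast
          have "dist (e s) (e t) \<le> \<epsilon>" using T x t s by (simp add: P_def)
          then have "dist (e s) (e t) < L * (1 / (2 * real m))" using e1 by simp
          then obtain s' where "e s' = e s" "\<bar>s' - t\<bar> < 1 / (2 * real m)" by (rule lift_near)
          then show "x \<in> e ` {t - 1 / (2 * real m)<..<t + 1 / (2 * real m)}"
            using s by (intro image_eqI[of _ _ s']) (auto simp: abs_less_iff)
        qed
        then have "\<pi> ` T \<subseteq> \<pi> ` e ` {t - 1 / (2 * real m)<..<t + 1 / (2 * real m)}" by blast
        from order_trans[OF card_mono[OF fin this] card] show ?thesis by simp
      qed simp
    qed
  qed (use n in auto)
  then have "homologous n (Rips\<^sub>0 (range e) r) w 0" using homologous_sym[OF pw] by simp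
  then show ?thesis by (rule homologous_trans[OF homologous_sym[OF wz]])
qed

end


section \<open>Second homology of a metric circle\<close>

lemma elementary_zero [simp]: "elementary xs 0 = 0"
  using additive_imp_zero[of "elementary xs"] elementary_add by blast

lemma elementary_sum: "elementary xs (sum f A) = (\<Sum>i\<in>A. elementary xs (f i))"
  by (rule additive_imp_sum) (rule elementary_add)

context metric_circle
begin

text \<open>Triangles that go once around, lifted to the line so that x + 1 is the next lift of x.
  On lifts the condition consists of strict linear inequalities, hence describes an open convex set;
  this is what makes all winding triangles equivalent.\<close>

definition winding :: "real \<Rightarrow> (real \<times> real \<times> real) set" where
  "winding r = {(x, y, z). L * (y - x) < r \<and> L * (z - y) < r \<and> L * (x + 1 - z) < r}"

definition triangle :: "real \<times> real \<times> real \<Rightarrow> 'g::ab_group_add \<Rightarrow> ('a list \<Rightarrow>\<^sub>0 'g)" where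
  "triangle p g = (case p of (x, y, z) \<Rightarrow> elementary [e x, e y, e z] g)"

lemma winding_gaps:
  assumes "r \<le> L / 2" "(x, y, z) \<in> winding r"
  shows "x < y" "y < z" "z < x + 1" "y - x < 1 / 2" "z - y < 1 / 2" "x + 1 - z < 1 / 2"
proof -
  have "L * (y - x) < L * (1 / 2)" "L * (z - y) < L * (1 / 2)" "L * (x + 1 - z) < L * (1 / 2)"
    using assms by (auto simp: winding_def)
  then show *: "y - x < 1 / 2" "z - y < 1 / 2" "x + 1 - z < 1 / 2" using L by simp_all
  then show "x < y" "y < z" "z < x + 1" by linarith+
qed

lemma winding_rotate: "(x, y, z) \<in> winding r \<longleftrightarrow> (y, z, x + 1) \<in> winding r"
  by (auto simp: winding_def)

lemma triangle_rotate: "triangle (x, y, z) g = triangle (y, z, x + 1) g"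
  using elementary3_rotate[of "e x" "e y" "e z" g] e_add_int[of x 1] by (simp add: triangle_def del: elementary.simps)

text \<open>Homology relative to the short subcomplex, with the short chain that makes up the
  difference kept explicit.\<close>

definition equivalent_mod_short :: "real \<Rightarrow> ('a list \<Rightarrow>\<^sub>0 'g::ab_group_add) \<Rightarrow> ('a list \<Rightarrow>\<^sub>0 'g) \<Rightarrow> bool" where
  "equivalent_mod_short r c d \<longleftrightarrow>
     (\<exists>s\<in>alt_chains 3 (short r). \<exists>y\<in>alt_chains 4 (Rips\<^sub>0 (range e) r). c = d + s + bd y)"

lemma equivalent_mod_short_sym:
  assumes "equivalent_mod_short r c d"
  shows "equivalent_mod_short r d c"
proof -
  obtain s y where sy: "s \<in> alt_chains 3 (short r)" "y \<in> alt_chains 4 (Rips\<^sub>0 (range e) r)" "c = d + s + bd y"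
    using assms unfolding equivalent_mod_short_def by blast
  show ?thesis unfolding equivalent_mod_short_def
    by (intro bexI[of _ "- s"] bexI[of _ "- y"]) (use sy in \<open>auto simp: bd_uminus alt_chains_uminus\<close>)
qed

lemma equivalent_mod_short_trans:
  assumes "equivalent_mod_short r c d" "equivalent_mod_short r d f"
  shows "equivalent_mod_short r c f"
proof -
  obtain s y where sy: "s \<in> alt_chains 3 (short r)" "y \<in> alt_chains 4 (Rips\<^sub>0 (range e) r)" "c = d + s + bd y"
    using assms(1) unfolding equivalent_mod_short_def by blast
  obtain s' y' where sy': "s' \<in> alt_chains 3 (short r)" "y' \<in> alt_chains 4 (Rips\<^sub>0 (range e) r)" "d = f + s' + bd y'"
    using assms(2) unfolding equivalent_mod_short_def by blast
  show ?thesis unfolding equivalent_mod_short_def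
    by (intro bexI[of _ "s' + s"] bexI[of _ "y' + y"])
      (use sy sy' in \<open>auto simp: bd_add alt_chains_add algebra_simps\<close>)
qed

lemma dist_e_less:
  assumes "s \<le> t" "L * (t - s) < r"
  shows "dist (e s) (e t) < r"
  using dist_e_le[of s t] assms by (simp add: abs_minus_commute)

text \<open>Moving one vertex of a winding triangle sweeps out a tetrahedron with two short faces.\<close>

lemma move_last_vertex:
  fixes g :: "'g::ab_group_add"
  assumes r: "0 < r" "r \<le> L / 2" and p: "(x, y, z) \<in> winding r" "(x, y, z') \<in> winding r"
  shows "equivalent_mod_short r (triangle (x, y, z) g) (triangle (x, y, z') g)"
proof -
  note g1 = winding_gaps[OF r(2) p(1)] and g2 = winding_gaps[OF r(2) p(2)]
  have lin: "L * (y - x) < r" "L * (z - y) < r" "L * (x + 1 - z) < r" "L * (z' - y) < r" "L * (x + 1 - z') < r"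
    using p by (auto simp: winding_def)
  have zz: "L * (z' - z) < r" "L * (z - z') < r"
  proof -
    have "L * (z' - z) \<le> L * (z' - y)" using g1 L by (intro mult_left_mono) auto
    then show "L * (z' - z) < r" using lin(4) by simp
    have "L * (z - z') \<le> L * (z - y)" using g2 L by (intro mult_left_mono) auto
    then show "L * (z - z') < r" using lin(2) by simp
  qed
  define T where "T = elementary [e x, e y, e z, e z'] g"
  have ex: "e (x + 1) = e x" using e_add_int[of x 1] by simp
  have d: "dist (e x) (e y) < r" "dist (e y) (e z) < r" "dist (e y) (e z') < r" "dist (e z) (e x) < r" "dist (e z') (e x) < r"
    using dist_e_less[of x y r] dist_e_less[of y z r] dist_e_less[of y z' r] dist_e_less[of z "x + 1" r]
      dist_e_less[of z' "x + 1" r] lin g1 g2 by (simp_all add: ex)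
  have d': "dist (e z) (e z') < r"
    using dist_e_less[of z z' r] dist_e_less[of z' z r] zz by (cases "z \<le> z'") (simp_all add: dist_commute)
  have T: "T \<in> alt_chains 4 (Rips\<^sub>0 (range e) r)"
    unfolding T_def
  proof (rule elementary_in_chains')
    show "set [e x, e y, e z, e z'] \<in> Rips\<^sub>0 (range e) r"
      unfolding Rips\<^sub>0_iff using d d' r(1) by (auto simp: dist_commute)
  qed simp
  have s1: "{e y, e z, e z'} \<in> short r"
    unfolding short_def
  proof (intro CollectI conjI exI)
    show "0 \<le> max z z' - y" using g1 by simp
    show "L * (max z z' - y) < r" using lin by (simp add: max_def)
    show "{e y, e z, e z'} \<subseteq> e ` {y..y + (max z z' - y)}" using g1 g2 by (auto intro!: imageI)
  qed simp
  have s2: "{e x, e z, e z'} \<in> short r"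
    unfolding short_def
  proof (intro CollectI conjI exI)
    show "0 \<le> x + 1 - min z z'" using g1 by simp
    show "L * (x + 1 - min z z') < r" using lin by (simp add: min_def)
    have "e x = e (x + 1)" using e_add_int[of x 1] by simp
    then show "{e x, e z, e z'} \<subseteq> e ` {min z z'..min z z' + (x + 1 - min z z')}" using g1 g2 by (auto intro!: imageI)
  qed simp
  define s where "s = elementary [e y, e z, e z'] g - elementary [e x, e z, e z'] g"
  have s: "s \<in> alt_chains 3 (short r)"
    unfolding s_def using s1 s2 by (intro alt_chains_diff elementary_in_chains') auto
  have "triangle (x, y, z) g = triangle (x, y, z') g + s + bd (- T)"
    unfolding T_def s_def bd_uminus bd_elementary4 by (simp add: triangle_def del: elementary.simps)
  then show ?thesis unfolding equivalent_mod_short_def using s alt_chains_uminus[OF T] by blast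
qed

text \<open>An equivalence relation with open classes on a connected set has only one class. Inside
  a box of winding triples the vertices can be moved one at a time; the first two cases follow from
  the last by rotating the triangle.\<close>

lemma triangle_equiv:
  fixes g :: "'g::ab_group_add"
  assumes r: "0 < r" "r \<le> L / 2" and pq: "p \<in> winding r" "q \<in> winding r"
  shows "equivalent_mod_short r (triangle p g) (triangle q g)"
proof -
  have move1: "equivalent_mod_short r (triangle (x, y, z) g) (triangle (x', y, z) g)"
    if "(x, y, z) \<in> winding r" "(x', y, z) \<in> winding r" for x x' y z
    using move_last_vertex[OF r, of y z "x + 1" "x' + 1" g] that
    by (simp add: winding_rotate[of x] winding_rotate[of x'] triangle_rotate[of x] triangle_rotate[of x'])
  have move2: "equivalent_mod_short r (triangle (x, y, z) g) (triangle (x, y', z) g)"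
    if "(x, y, z) \<in> winding r" "(x, y', z) \<in> winding r" for x y y' z
    using move1[of y z "x + 1" y'] that
    by (simp add: winding_rotate[of x] triangle_rotate[of x])
  have "convex (winding r)"
  proof -
    have c: "convex {p :: real \<times> real \<times> real. a \<bullet> p < b}" for a b by (rule convex_halfspace_lt)
    have "winding r = {p. (- L, L, 0) \<bullet> p < r} \<inter> {p. (0, - L, L) \<bullet> p < r} \<inter> {p. (L, 0, - L) \<bullet> p < r - L}"
      by (auto simp: winding_def algebra_simps)
    then show ?thesis by (simp only:) (intro convex_Int c)
  qed
  then have conn: "connected (winding r)" by (rule convex_connected)
  have op: "open (winding r)"
  proof -
    have "winding r = {p. (- L, L, 0) \<bullet> p < r} \<inter> {p. (0, - L, L) \<bullet> p < r} \<inter> {p. (L, 0, - L) \<bullet> p < r - L}"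
      by (auto simp: winding_def algebra_simps)
    then show ?thesis by (simp only:) (intro open_Int open_halfspace_lt)
  qed
  show ?thesis
  proof (rule connected_equivalence_relation[OF conn pq(1) pq(2)])
    show "equivalent_mod_short r (triangle b g) (triangle a g)"
      if "equivalent_mod_short r (triangle a g) (triangle b g)" for a b using that by (rule equivalent_mod_short_sym)
    show "equivalent_mod_short r (triangle a g) (triangle c g)"
      if "equivalent_mod_short r (triangle a g) (triangle b g)" "equivalent_mod_short r (triangle b g) (triangle c g)" for a b c
      using that by (rule equivalent_mod_short_trans)
    fix a assume a: "a \<in> winding r"
    obtain A B where AB: "open A" "open B" "a \<in> A \<times> B" "A \<times> B \<subseteq> winding r" by (rule open_prod_elim[OF op a])
    have "snd a \<in> B" using AB(3) by auto
    then obtain C D where CD: "open C" "open D" "snd a \<in> C \<times> D" "C \<times> D \<subseteq> B" by (rule open_prod_elim[OF AB(2)])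
    define W where "W = A \<times> C \<times> D"
    have W: "W \<subseteq> winding r" "a \<in> W" "open W"
      using AB CD by (auto simp: W_def mem_Times_iff intro!: open_Times)
    have "equivalent_mod_short r (triangle a g) (triangle b g)" if b: "b \<in> W" for b
    proof -
      obtain x y z x' y' z' where ab: "a = (x, y, z)" "b = (x', y', z')" by (cases a, cases b) auto
      have in_W: "(u, v, w) \<in> winding r" if "u \<in> {x, x'}" "v \<in> {y, y'}" "w \<in> {z, z'}" for u v w
        using W(1,2) b that unfolding W_def ab by auto
      have "equivalent_mod_short r (triangle (x, y, z) g) (triangle (x', y, z) g)" by (intro move1 in_W) auto
      moreover have "equivalent_mod_short r (triangle (x', y, z) g) (triangle (x', y', z) g)" by (intro move2 in_W) auto
      moreover have "equivalent_mod_short r (triangle (x', y', z) g) (triangle (x', y', z') g)"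
        by (intro move_last_vertex r in_W) auto
      ultimately show ?thesis unfolding ab using equivalent_mod_short_trans by blast
    qed
    then show "\<exists>T. openin (top_of_set (winding r)) T \<and> a \<in> T \<and> (\<forall>x\<in>T. equivalent_mod_short r (triangle a g) (triangle x g))"
      using W by (intro exI[of _ W]) (auto simp: open_subset)
  qed
qed

lemma small_gap:
  assumes "0 < r" "r \<le> L / 2" "dist (e s) (e t) < r" "s < t" "t < s + 1"
  shows "L * (t - s) < r \<or> L * (s + 1 - t) < r"
proof -
  have "dist (e s) (e t) < L * (r / L)" using assms(3) L by simp
  then obtain s' where s': "e s' = e s" "\<bar>s' - t\<bar> < r / L" by (rule lift_near)
  then obtain n :: int where n: "s' - s = of_int n" by (auto simp: e_eq_iff elim: Ints_cases)
  have "r / L \<le> 1 / 2" using assms(2) L by (simp add: field_simps)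
  then have "\<bar>s' - t\<bar> < 1 / 2" using s'(2) by linarith
  then have "n = 0 \<or> n = 1" using n assms(4,5) by linarith
  then have "t - s < r / L \<or> s + 1 - t < r / L" using n s'(2) by auto
  then show ?thesis using L by (simp add: pos_less_divide_eq mult.commute)
qed

text \<open>Each pair of vertices is close along one of the two arcs between them. If for some pair
  this arc contains the third vertex, the triangle is short; otherwise all three consecutive gaps
  are small, which is winding.\<close>

lemma triangle_classification:
  assumes r: "0 < r" "r \<le> L / 2" and S: "{e x, e y, e z} \<in> Rips\<^sub>0 (range e) r" and xyz: "x < y" "y < z" "z < x + 1"
  shows "{e x, e y, e z} \<in> short r \<or> (x, y, z) \<in> winding r"
proof -
  have d: "dist (e x) (e y) < r" "dist (e y) (e z) < r" "dist (e x) (e z) < r"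
    using S by (auto simp: Rips\<^sub>0_iff)
  have shift: "e (x + 1) = e x" "e (y + 1) = e y" using e_add_int[of x 1] e_add_int[of y 1] by simp_all
  have short: "T \<in> short r" if "finite T" "0 \<le> l" "L * l < r" "T \<subseteq> e ` {u..u + l}" for T u l
    unfolding short_def using that by blast
  have xy: "L * (y - x) < r \<or> L * (x + 1 - y) < r" by (rule small_gap[OF r d(1)]) (use xyz in auto)
  have yz: "L * (z - y) < r \<or> L * (y + 1 - z) < r" by (rule small_gap[OF r d(2)]) (use xyz in auto)
  have xz: "L * (z - x) < r \<or> L * (x + 1 - z) < r" by (rule small_gap[OF r d(3)]) (use xyz in auto)
  consider "L * (z - x) < r" | "L * (x + 1 - y) < r" | "L * (y + 1 - z) < r" | "(x, y, z) \<in> winding r"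
    using xy yz xz unfolding winding_def by blast
  then show ?thesis
  proof cases
    case 1
    have "{e x, e y, e z} \<subseteq> e ` {x..x + (z - x)}" using xyz by (auto intro!: imageI)
    then show ?thesis using short[of _ "z - x" x] 1 xyz by auto
  next
    case 2
    have "{e (x + 1), e y, e z} \<subseteq> e ` {y..y + (x + 1 - y)}" using xyz by (intro insert_subsetI imageI) auto
    then show ?thesis using short[of "{e (x + 1), e y, e z}" "x + 1 - y" y] 2 xyz unfolding shift by auto
  next
    case 3
    have "{e (x + 1), e (y + 1), e z} \<subseteq> e ` {z..z + (y + 1 - z)}" using xyz by (intro insert_subsetI imageI) auto
    then show ?thesis using short[of "{e (x + 1), e (y + 1), e z}" "y + 1 - z" z] 3 xyz unfolding shift by auto
  qed blast
qed

definition lift :: "'a \<Rightarrow> real" where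
  "lift a = (SOME t. 0 \<le> t \<and> t < 1 \<and> e t = a)"

lemma lift:
  assumes "a \<in> range e"
  shows "0 \<le> lift a" "lift a < 1" "e (lift a) = a"
proof -
  obtain s where s: "a = e s" using assms by blast
  have "e (s + of_int (- \<lfloor>s\<rfloor>)) = a" unfolding s by (rule e_add_int)
  then have "\<exists>t. 0 \<le> t \<and> t < 1 \<and> e t = a"
    by (intro exI[of _ "s + of_int (- \<lfloor>s\<rfloor>)"]) (simp, linarith)
  from someI_ex[OF this] show "0 \<le> lift a" "lift a < 1" "e (lift a) = a" unfolding lift_def by blast+
qed

lemma three_points_classification:
  assumes r: "0 < r" "r \<le> L / 2" and S: "S \<in> Rips\<^sub>0 (range e) r" "card S = 3"
  shows "S \<in> short r \<or> (\<exists>x y z. (x, y, z) \<in> winding r \<and> S = {e x, e y, e z})"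
proof -
  obtain a b c where abc: "S = {a, b, c}" "a \<noteq> b" "a \<noteq> c" "b \<noteq> c"
    using S(2) by (auto simp: card_3_iff)
  have rng: "a \<in> range e" "b \<in> range e" "c \<in> range e" using S(1) abc(1) by (auto simp: Rips\<^sub>0_iff)
  note la = lift[OF rng(1)] and lb = lift[OF rng(2)] and lc = lift[OF rng(3)]
  have ne: "lift a \<noteq> lift b" "lift a \<noteq> lift c" "lift b \<noteq> lift c" using abc la(3) lb(3) lc(3) by metis+
  have main: "S \<in> short r \<or> (\<exists>x y z. (x, y, z) \<in> winding r \<and> S = {e x, e y, e z})"
    if "x < y" "y < z" "0 \<le> x" "z < 1" "S = {e x, e y, e z}" for x y z
    using triangle_classification[OF r, of x y z] that S(1) by auto
  consider "lift a < lift b" "lift b < lift c" | "lift a < lift c" "lift c < lift b"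
    | "lift b < lift a" "lift a < lift c" | "lift b < lift c" "lift c < lift a"
    | "lift c < lift a" "lift a < lift b" | "lift c < lift b" "lift b < lift a"
    using ne by linarith
  then show ?thesis
  proof cases
    case 1
    have "S = {e (lift a), e (lift b), e (lift c)}" using abc(1) by (simp add: la(3) lb(3) lc(3) insert_commute)
    then show ?thesis by (rule main[OF 1 la(1) lc(2)])
  next
    case 2
    have "S = {e (lift a), e (lift c), e (lift b)}" using abc(1) by (simp add: la(3) lb(3) lc(3) insert_commute)
    then show ?thesis by (rule main[OF 2 la(1) lb(2)])
  next
    case 3
    have "S = {e (lift b), e (lift a), e (lift c)}" using abc(1) by (simp add: la(3) lb(3) lc(3) insert_commute)
    then show ?thesis by (rule main[OF 3 lb(1) lc(2)])
  next
    case 4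
    have "S = {e (lift b), e (lift c), e (lift a)}" using abc(1) by (simp add: la(3) lb(3) lc(3) insert_commute)
    then show ?thesis by (rule main[OF 4 lb(1) la(2)])
  next
    case 5
    have "S = {e (lift c), e (lift a), e (lift b)}" using abc(1) by (simp add: la(3) lb(3) lc(3) insert_commute)
    then show ?thesis by (rule main[OF 5 lc(1) lb(2)])
  next
    case 6
    have "S = {e (lift c), e (lift b), e (lift a)}" using abc(1) by (simp add: la(3) lb(3) lc(3) insert_commute)
    then show ?thesis by (rule main[OF 6 lc(1) la(2)])
  qed
qed

text \<open>
  Counts, with signs, how often the edges of a chain run through \<open>e 0\<close>: this distinguishes the
  boundary of a winding triangle from the boundaries of short ones.
\<close>

definition crossing :: "('a list \<Rightarrow>\<^sub>0 'g::ab_group_add) \<Rightarrow> 'g" where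
  "crossing = linear_extension (\<lambda>xs g. case xs of [a, b] \<Rightarrow> (if lift a - lift b > 1 / 2 then g else 0) | _ \<Rightarrow> 0)"

text \<open>The multiple n g, needed only for n = -1, 0, 1.\<close>

definition signed :: "int \<Rightarrow> 'g::ab_group_add \<Rightarrow> 'g" where
  "signed n g = (if n = 1 then g else if n = - 1 then - g else 0)"

lemma signed_triangle_short:
  "p \<in> {-1, 0, 1} \<Longrightarrow> q \<in> {-1, 0, 1} \<Longrightarrow> q + p \<in> {-1, 0, 1} \<Longrightarrow> signed p g - signed (q + p) g + signed q g = 0"
  unfolding signed_def by auto

lemma signed_triangle_winding:
  "p \<in> {-1, 0, 1} \<Longrightarrow> q \<in> {-1, 0, 1} \<Longrightarrow> q + p - 1 \<in> {-1, 0, 1} \<Longrightarrow> signed p g - signed (q + p - 1) g + signed q g = g"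
  unfolding signed_def by auto

lemma crossing_add: "crossing (c + d) = crossing c + crossing d"
  unfolding crossing_def by (rule linear_extension_add) (auto split: list.split)

lemmas crossing_zero [simp] = additive_imp_zero[of crossing, OF crossing_add]
  and crossing_diff = additive_imp_diff[of crossing, OF crossing_add]
  and crossing_sum = additive_imp_sum[of crossing, OF crossing_add]

lemma crossing_single: "crossing (single [a, b] g) = (if lift a - lift b > 1 / 2 then g else 0)"
  unfolding crossing_def by (subst linear_extension_single) (auto split: list.split)

text \<open>The integer that carries a real parameter to its representative in [0, 1). Along an edge
  shorter than 1/2 its change is the signed number of passages through \<open>e 0\<close>.\<close>

definition offset :: "real \<Rightarrow> int" where
  "offset s = \<lfloor>lift (e s) - s\<rfloor>"

lemma lift_e: "lift (e s) = s + of_int (offset s)"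
proof -
  have "lift (e s) - s \<in> \<int>" using lift(3)[of "e s", OF rangeI] by (simp only: e_eq_iff)
  then show ?thesis by (auto simp: offset_def elim!: Ints_cases)
qed

lemma offset_add_1: "offset (s + 1) = offset s - 1"
  using lift_e[of s] lift_e[of "s + 1"] e_add_int[of s 1] by simp

lemma crossing_edge:
  assumes "\<bar>s - t\<bar> < 1 / 2"
  shows "crossing (elementary [e s, e t] g) = signed (offset s - offset t) g"
    "offset s - offset t \<in> {-1, 0, 1}"
proof -
  have l: "lift (e s) - lift (e t) = s - t + of_int (offset s - offset t)" using lift_e[of s] lift_e[of t] by simp
  have "\<bar>lift (e s) - lift (e t)\<bar> < 1" using lift(1,2)[of "e s"] lift(1,2)[of "e t"] by simp
  then have "\<bar>real_of_int (offset s - offset t)\<bar> < 2" using l assms by linarith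
  then show k: "offset s - offset t \<in> {-1, 0, 1}" by auto
  have "crossing (elementary [e s, e t] g) =
      (if lift (e s) - lift (e t) > 1 / 2 then g else 0) - (if lift (e t) - lift (e s) > 1 / 2 then g else 0)"
    by (simp add: crossing_diff crossing_single)
  also have "\<dots> = signed (offset s - offset t) g"
    using k l assms by (auto simp: signed_def)
  finally show "crossing (elementary [e s, e t] g) = signed (offset s - offset t) g" .
qed

text \<open>The offsets telescope around the triangle up to the jump between x and x + 1: after one
  turn exactly one crossing remains.\<close>

lemma crossing_bd_winding:
  assumes "r \<le> L / 2" "p \<in> winding r"
  shows "crossing (bd (triangle p g)) = g"
proof -
  obtain x y z where p: "p = (x, y, z)" by (cases p) auto
  note gaps = winding_gaps[OF assms(1) assms(2)[unfolded p]]
  have ex: "e x = e (x + 1)" using e_add_int[of x 1] by simp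
  have yz: "\<bar>y - z\<bar> < 1 / 2" and xy: "\<bar>x - y\<bar> < 1 / 2" and xz: "\<bar>x + 1 - z\<bar> < 1 / 2" using gaps by auto
  have "crossing (bd (triangle p g)) =
      crossing (elementary [e y, e z] g) - crossing (elementary [e (x + 1), e z] g) + crossing (elementary [e x, e y] g)"
    unfolding p triangle_def prod.case bd_elementary3 crossing_add crossing_diff using ex by simp
  also have "\<dots> = signed (offset y - offset z) g - signed (offset x - 1 - offset z) g + signed (offset x - offset y) g"
    unfolding crossing_edge(1)[OF yz] crossing_edge(1)[OF xy] crossing_edge(1)[OF xz] offset_add_1 ..
  also have "\<dots> = g"
  proof -
    have eq: "offset x - 1 - offset z = (offset x - offset y) + (offset y - offset z) - 1" by simp
    show ?thesis unfolding eq
      by (rule signed_triangle_winding[OF crossing_edge(2)[OF yz] crossing_edge(2)[OF xy]])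
        (use crossing_edge(2)[OF xz] in \<open>simp only: offset_add_1 eq\<close>)
  qed
  finally show ?thesis .
qed

text \<open>The vertices of a short triangle lift into one interval shorter than 1/2, so the offsets
  along its three edges telescope to zero.\<close>

lemma crossing_bd_short:
  assumes r: "r \<le> L / 2" and s: "s \<in> alt_chains 3 (short r)"
  shows "crossing (bd s) = 0"
proof -
  have "crossing (bd (part S s)) = 0" if S: "S \<in> set ` keys s" for S
  proof -
    obtain xs where xs: "xs \<in> keys s" "S = set xs" using S by blast
    have len: "length xs = 3" "set xs \<in> short r" "distinct xs"
      using s xs(1) by (auto simp: alt_chains_def dest: alt_distinctD)
    obtain u l where ul: "L * l < r" "set xs \<subseteq> e ` {u..u + l}" using len(2) unfolding short_def by blast
    have "L * l < L * (1 / 2)" using ul(1) r by simp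
    then have l: "l < 1 / 2" using L by simp
    obtain A B C where ABC: "xs = [A, B, C]" using len(1) by (auto simp: numeral_3_eq_3 length_Suc_conv)
    obtain a b c where abc: "A = e a" "B = e b" "C = e c" "a \<in> {u..u + l}" "b \<in> {u..u + l}" "c \<in> {u..u + l}"
      using ul(2) unfolding ABC by auto
    define g where "g = lookup s xs"
    have bc: "\<bar>b - c\<bar> < 1 / 2" and ac: "\<bar>a - c\<bar> < 1 / 2" and ab: "\<bar>a - b\<bar> < 1 / 2"
      using abc(4-6) l by (auto simp: abs_if)
    have "part S s = elementary [e a, e b, e c] g"
      using part_eq_elementary[OF s len(3,1)] xs(2) ABC abc(1-3) by (simp add: g_def del: elementary.simps)
    then have "crossing (bd (part S s)) =
        crossing (elementary [e b, e c] g) - crossing (elementary [e a, e c] g) + crossing (elementary [e a, e b] g)"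
      unfolding bd_elementary3[symmetric] crossing_add[symmetric] crossing_diff[symmetric] by simp
    also have "\<dots> = signed (offset b - offset c) g - signed (offset a - offset c) g + signed (offset a - offset b) g"
      unfolding crossing_edge(1)[OF bc] crossing_edge(1)[OF ac] crossing_edge(1)[OF ab] ..
    also have "\<dots> = 0"
    proof -
      have eq: "offset a - offset c = (offset a - offset b) + (offset b - offset c)" by simp
      show ?thesis unfolding eq
        by (rule signed_triangle_short[OF crossing_edge(2)[OF bc] crossing_edge(2)[OF ab]])
          (use crossing_edge(2)[OF ac] in \<open>simp only: eq\<close>)
    qed
    finally show ?thesis .
  qed
  then have "(\<Sum>S\<in>set ` keys s. crossing (bd (part S s))) = 0" by simp
  then have "crossing (bd (\<Sum>S\<in>set ` keys s. part S s)) = 0" by (simp add: bd_sum crossing_sum)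
  then show ?thesis by (simp add: sum_part)
qed

text \<open>For r > L/2 every finite set of points is a simplex and a cone suffices. Otherwise all
  triangles are either short or equivalent to multiples of one winding triangle, so z is a multiple
  of it plus a short chain plus a boundary. The crossing number of \<open>bd z = 0\<close> makes the
  multiple zero, and the remaining short cycle bounds.\<close>

theorem second_homology_vanishes:
  fixes z :: "'a list \<Rightarrow>\<^sub>0 'g::ab_group_add"
  assumes r: "0 < r" and z: "z \<in> alt_chains 3 (Rips\<^sub>0 (range e) r)" "bd z = 0"
  shows "homologous 3 (Rips\<^sub>0 (range e) r) z 0"
proof (cases "r \<le> L / 2")
  case False
  have d: "dist (e s) (e t) < r" for s t
  proof -
    have "dist (e s) (e t) \<le> L * (1 / 2)" unfolding dist_e using L nint_le_half by (intro mult_left_mono) auto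
    then show ?thesis using False by simp
  qed
  have "chain_cone (e 0) z \<in> alt_chains (Suc 3) (Rips\<^sub>0 (range e) r)"
  proof (rule alt_chains_cone[OF z(1)])
    fix S assume "S \<in> Rips\<^sub>0 (range e) r"
    then have S: "finite S" "S \<subseteq> range e" by (simp_all add: Rips\<^sub>0_iff)
    have "dist x y < r" if xy: "x \<in> insert (e 0) S" "y \<in> insert (e 0) S" for x y
    proof -
      obtain s t where "x = e s" "y = e t" using xy S(2) by blast
      then show ?thesis using d by simp
    qed
    then show "insert (e 0) S \<in> Rips\<^sub>0 (range e) r" using S by (simp add: Rips\<^sub>0_iff)
  qed
  moreover have "bd (chain_cone (e 0) z) = z" by (simp add: bd_cone z(2))
  ultimately show ?thesis unfolding homologous_def by (intro bexI[of _ "chain_cone (e 0) z"]) auto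
next
  case True
  have z_card: "S \<in> Rips\<^sub>0 (range e) r" "card S = 3" if S: "S \<in> set ` keys z" for S
  proof -
    obtain xs where xs: "xs \<in> keys z" "S = set xs" using S by blast
    then have "distinct xs" "length xs = 3" "set xs \<in> Rips\<^sub>0 (range e) r"
      using z(1) by (auto simp: alt_chains_def dest: alt_distinctD)
    then show "S \<in> Rips\<^sub>0 (range e) r" "card S = 3" using xs(2) distinct_card[of xs] by auto
  qed
  show ?thesis
  proof (cases "set ` keys z \<subseteq> short r")
    case short: True
    then have "z \<in> alt_chains 3 (short r)" using z(1) by (auto simp: alt_chains_def)
    then show ?thesis by (intro short_cycle_bounds r True z(2)) auto
  next
    case False
    then obtain S0 where "S0 \<in> set ` keys z" "S0 \<notin> short r" by blast
    then obtain p0 where p0: "p0 \<in> winding r"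
      using three_points_classification[OF r True z_card] by blast
    have "\<exists>g. equivalent_mod_short r (part S z) (triangle p0 g)" if S: "S \<in> set ` keys z" for S
    proof (cases "S \<in> short r")
      case True
      have "part S z \<in> alt_chains 3 (short r)"
        by (rule subsetD[OF alt_chains_mono alt_chains_part[OF z(1)]]) (use True in auto)
      \<comment> \<open>A short simplex contributes the coefficient 0 to the reference
        triangle.\<close>
      then have "equivalent_mod_short r (part S z) (triangle p0 0)"
        unfolding equivalent_mod_short_def by (intro bexI[of _ "part S z"] bexI[of _ 0]) (auto simp: triangle_def split: prod.split simp del: elementary.simps)
      then show ?thesis by blast
    next
      case False
      then obtain x y w where w: "(x, y, w) \<in> winding r" "S = {e x, e y, e w}"
        using three_points_classification[OF r \<open>r \<le> L / 2\<close> z_card[OF S]] by blast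
      have "distinct [e x, e y, e w]" using z_card(2)[OF S] w(2) by (auto simp: card_insert_if split: if_splits)
      then have "part S z = triangle (x, y, w) (lookup z [e x, e y, e w])"
        using part_eq_elementary[OF z(1), of "[e x, e y, e w]"] w(2) by (simp add: triangle_def del: elementary.simps)
      then show ?thesis using triangle_equiv[OF r \<open>r \<le> L / 2\<close> w(1) p0] by metis
    qed
    then obtain g where "\<forall>S\<in>set ` keys z. equivalent_mod_short r (part S z) (triangle p0 (g S))" by metis
    then have "\<forall>S\<in>set ` keys z. \<exists>s y. s \<in> alt_chains 3 (short r) \<and> y \<in> alt_chains 4 (Rips\<^sub>0 (range e) r)
        \<and> part S z = triangle p0 (g S) + s + bd y"
      unfolding equivalent_mod_short_def by blast
    then obtain s y where sy: "\<And>S. S \<in> set ` keys z \<Longrightarrow> s S \<in> alt_chains 3 (short r) \<and> y S \<in> alt_chains 4 (Rips\<^sub>0 (range e) r)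
        \<and> part S z = triangle p0 (g S) + s S + bd (y S)"
      by metis
    define g0 where "g0 = sum g (set ` keys z)"
    define s0 where "s0 = sum s (set ` keys z)"
    define y0 where "y0 = sum y (set ` keys z)"
    have s0: "s0 \<in> alt_chains 3 (short r)" unfolding s0_def using sy by (intro alt_chains_sum) blast
    have y0: "y0 \<in> alt_chains 4 (Rips\<^sub>0 (range e) r)" unfolding y0_def using sy by (intro alt_chains_sum) blast
    have "z = (\<Sum>S\<in>set ` keys z. part S z)" by (simp add: sum_part)
    also have "\<dots> = (\<Sum>S\<in>set ` keys z. triangle p0 (g S) + s S + bd (y S))" using sy by (intro sum.cong) auto
    also have "\<dots> = triangle p0 g0 + s0 + bd y0"
      by (simp add: g0_def s0_def y0_def sum.distrib bd_sum triangle_def elementary_sum split: prod.split del: elementary.simps)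
    finally have z_eq: "z = triangle p0 g0 + s0 + bd y0" .
    \<comment> \<open>Counting crossings of the boundary annihilates the short chain and the
      boundary term and reads off the total coefficient of the reference triangle.\<close>
    have "0 = crossing (bd z)" by (simp add: z(2))
    also have "\<dots> = g0"
      unfolding z_eq bd_add crossing_add crossing_bd_winding[OF True p0] crossing_bd_short[OF True s0] bd_bd[OF y0] by simp
    finally have "g0 = 0" by simp
    then have z_eq': "z = s0 + bd y0" using z_eq by (simp add: triangle_def split: prod.split del: elementary.simps)
    then have "bd s0 = 0" using z(2) bd_bd[OF y0] by (simp add: bd_add)
    then have "homologous 3 (Rips\<^sub>0 (range e) r) s0 0" by (intro short_cycle_bounds r True s0) auto
    moreover have "homologous 3 (Rips\<^sub>0 (range e) r) z s0"
      unfolding homologous_def using y0 z_eq' by (intro bexI[of _ y0]) auto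
    ultimately show ?thesis using homologous_trans by blast
  qed
qed

end


section \<open>Geodesic circles\<close>

definition circle_param :: "(real \<Rightarrow> 'a::metric_space) \<Rightarrow> 'a set \<Rightarrow> bool" where
  "circle_param c C \<longleftrightarrow> continuous_on UNIV c \<and> range c = C \<and> (\<forall>s t. c s = c t \<longleftrightarrow> s - t \<in> \<int>)"

lemma circle_param_exists:
  assumes "topological_circle C"
  obtains c where "circle_param c C"
proof -
  obtain u u' where u: "homeomorphism (sphere (0::complex) 1) C u u'"
    using assms homeomorphic_sym unfolding topological_circle_def homeomorphic_def by metis
  have cis: "(\<lambda>t. cis (2 * pi * t)) ` UNIV = sphere 0 1"
  proof (intro equalityI subsetI)
    fix z :: complex assume "z \<in> sphere 0 1"
    then have "z \<noteq> 0" "norm z = 1" by auto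
    then have "z = cis (2 * pi * (Arg z / (2 * pi)))" using cis_Arg[of z] by (simp add: sgn_div_norm)
    then show "z \<in> range (\<lambda>t. cis (2 * pi * t))" by blast
  qed auto
  have "continuous_on UNIV (\<lambda>t. cis (2 * pi * t))"
    unfolding cis_conv_exp by (intro continuous_intros)
  then have "continuous_on UNIV (\<lambda>t. u (cis (2 * pi * t)))"
    by (rule continuous_on_compose2[OF homeomorphism_cont1[OF u]]) auto
  moreover have "range (\<lambda>t. u (cis (2 * pi * t))) = C"
    using cis homeomorphism_image1[OF u] by (metis image_image)
  moreover have "u (cis (2 * pi * s)) = u (cis (2 * pi * t)) \<longleftrightarrow> s - t \<in> \<int>" for s t
  proof -
    have "inj_on u (sphere 0 1)" by (rule inj_on_inverseI[of _ u']) (rule homeomorphism_apply1[OF u])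
    then have "u (cis (2 * pi * s)) = u (cis (2 * pi * t)) \<longleftrightarrow> cis (2 * pi * s) = cis (2 * pi * t)"
      by (rule inj_on_eq_iff) auto
    then show ?thesis by (simp add: cis_eq_cis_iff)
  qed
  ultimately have "circle_param (\<lambda>t. u (cis (2 * pi * t))) C" unfolding circle_param_def by blast
  then show ?thesis by (rule that)
qed

lemma circle_param_shift:
  assumes "circle_param c C"
  shows "circle_param (\<lambda>t. c (a + t)) C"
  unfolding circle_param_def
proof (intro conjI allI)
  have c: "continuous_on UNIV c" "range c = C" "\<And>s t. c s = c t \<longleftrightarrow> s - t \<in> \<int>"
    using assms by (auto simp: circle_param_def)
  show "continuous_on UNIV (\<lambda>t. c (a + t))"
    by (rule continuous_on_compose2[OF c(1)]) (auto intro!: continuous_intros)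
  have "range (\<lambda>t. a + t) = UNIV" by (rule surjI[of _ "\<lambda>t. t - a"]) simp
  then show "range (\<lambda>t. c (a + t)) = C" using c(2) by (metis image_image)
  show "c (a + s) = c (a + t) \<longleftrightarrow> s - t \<in> \<int>" for s t by (simp add: c(3))
qed

lemma circle_param_reflect:
  assumes "circle_param c C"
  shows "circle_param (\<lambda>t. c (- t)) C"
  unfolding circle_param_def
proof (intro conjI allI)
  have c: "continuous_on UNIV c" "range c = C" "\<And>s t. c s = c t \<longleftrightarrow> s - t \<in> \<int>"
    using assms by (auto simp: circle_param_def)
  show "continuous_on UNIV (\<lambda>t. c (- t))"
    by (rule continuous_on_compose2[OF c(1)]) (auto intro!: continuous_intros)
  have "range (\<lambda>t::real. - t) = UNIV" by (rule surjI[of _ uminus]) simp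
  then show "range (\<lambda>t. c (- t)) = C" using c(2) by (metis image_image)
  show "c (- s) = c (- t) \<longleftrightarrow> s - t \<in> \<int>" for s t
    using c(3)[of "- t" "- s"] by auto
qed

lemma circle_param_add_1: "circle_param c C \<Longrightarrow> c (t + 1) = c t"
  by (simp add: circle_param_def)

lemma circle_param_neq:
  assumes "circle_param c C" "0 < s - t" "s - t < 1"
  shows "c s \<noteq> c t"
proof
  assume "c s = c t"
  then have "s - t \<in> \<int>" using assms(1) by (simp add: circle_param_def)
  then obtain n :: int where "s - t = of_int n" by (rule Ints_cases)
  then have "0 < n" "n < 1" using assms(2,3) by simp_all
  then show False by simp
qed

text \<open>
  Two points cut the circle into two arcs; a geodesic between them is connected, so it covers one of
  the arcs.
\<close>

lemma geodesic_covers_arc: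
  assumes c: "circle_param c C" and C: "geodesic_space C" and ab: "a < b" "b < a + 1"
  shows "(\<forall>m\<in>{a..b}. dist (c a) (c m) + dist (c m) (c b) = dist (c a) (c b)) \<or>
    (\<forall>m\<in>{b..a + 1}. dist (c a) (c m) + dist (c m) (c b) = dist (c a) (c b))"
proof (rule ccontr)
  assume neg: "\<not> ?thesis"
  \<comment> \<open>The points metrically between \<open>c a\<close> and \<open>c b\<close>; every
    geodesic joining the two lies in B. If each of the two arcs contained a point outside B, these
    points would cut the circle into two closed pieces that disconnect the geodesic.\<close>
  define B where "B = {p. dist (c a) p + dist p (c b) = dist (c a) (c b)}"
  obtain u v where u: "a \<le> u" "u \<le> b" "c u \<notin> B" and v: "b \<le> v" "v \<le> a + 1" "c v \<notin> B"
    using neg unfolding B_def by auto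
  have cont: "continuous_on UNIV c" and rng: "range c = C" and per: "\<And>s t. c s = c t \<longleftrightarrow> s - t \<in> \<int>"
    using c by (auto simp: circle_param_def)
  have aB: "c a \<in> B" and bB: "c b \<in> B" by (auto simp: B_def)
  have ne: "u \<noteq> a" "u \<noteq> b" "v \<noteq> b" "v \<noteq> a + 1" using u v aB bB circle_param_add_1[OF c, of a] by auto
  have "c a \<noteq> c b" using circle_param_neq[OF c, of b a] ab by simp
  moreover have "c a \<in> C" "c b \<in> C" using rng by auto
  ultimately obtain \<gamma> where g: "\<gamma> ` {0..dist (c a) (c b)} \<subseteq> C" "\<gamma> 0 = c a" "\<gamma> (dist (c a) (c b)) = c b"
    "\<forall>s\<in>{0..dist (c a) (c b)}. \<forall>t\<in>{0..dist (c a) (c b)}. dist (\<gamma> s) (\<gamma> t) = \<bar>s - t\<bar>"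
    using C unfolding geodesic_space_def by blast
  let ?\<Gamma> = "\<gamma> ` {0..dist (c a) (c b)}"
  have "continuous_on {0..dist (c a) (c b)} \<gamma>"
    unfolding continuous_on_iff using g(4) by (metis dist_real_def)
  then have conn: "connected ?\<Gamma>" by (rule connected_continuous_image) simp
  have \<Gamma>B: "?\<Gamma> \<subseteq> B"
  proof
    fix p assume "p \<in> ?\<Gamma>"
    then obtain t where t: "t \<in> {0..dist (c a) (c b)}" "p = \<gamma> t" by blast
    then show "p \<in> B"
      using g(4)[rule_format, of 0 t] g(4)[rule_format, of t "dist (c a) (c b)"] g(2,3) by (auto simp: B_def)
  qed
  have "compact (c ` {v - 1..u})" "compact (c ` {u..v})"
    using cont by (auto intro!: compact_continuous_image intro: continuous_on_subset)
  then have closed: "closed (c ` {v - 1..u})" "closed (c ` {u..v})" by (auto intro: compact_imp_closed)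
  have cover: "C \<subseteq> c ` {v - 1..u} \<union> c ` {u..v}"
  proof
    fix p assume "p \<in> C"
    then obtain t where t: "p = c t" using rng by blast
    define k where "k = \<lfloor>t - (v - 1)\<rfloor>"
    have "c t = c (t - of_int k)" by (simp add: per)
    moreover have "v - 1 \<le> t - of_int k" "t - of_int k \<le> v" unfolding k_def by linarith+
    ultimately have "p \<in> c ` {v - 1..v}" using t by auto
    moreover have "{v - 1..v} \<subseteq> {v - 1..u} \<union> {u..v}" by auto
    ultimately show "p \<in> c ` {v - 1..u} \<union> c ` {u..v}" by blast
  qed
  have inter: "c ` {v - 1..u} \<inter> c ` {u..v} \<subseteq> {c u, c v}"
  proof
    fix p assume "p \<in> c ` {v - 1..u} \<inter> c ` {u..v}"
    then obtain s t where "p = c s" "p = c t" "s \<in> {v - 1..u}" "t \<in> {u..v}" by blast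
    then have st: "p = c s" "p = c t" "v - 1 \<le> s" "s \<le> u" "u \<le> t" "t \<le> v" by simp_all
    then have "t - s \<in> \<int>" using per[of t s] by simp
    then obtain n :: int where n: "t - s = of_int n" by (rule Ints_cases)
    have "0 \<le> n" "n \<le> 1" using n st(3-6) by linarith+
    then consider "n = 0" | "n = 1" by linarith
    then show "p \<in> {c u, c v}"
    proof cases
      case 1
      then have "t = u" using n st by simp
      then show ?thesis using st(2) by simp
    next
      case 2
      then have "t = v" using n st by simp
      then show ?thesis using st(2) by simp
    qed
  qed
  have disj: "c ` {v - 1..u} \<inter> c ` {u..v} \<inter> ?\<Gamma> = {}"
  proof (rule equals0I)
    fix p assume p: "p \<in> c ` {v - 1..u} \<inter> c ` {u..v} \<inter> ?\<Gamma>"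
    have "p \<in> {c u, c v}" by (rule subsetD[OF inter]) (use p in simp)
    moreover have "p \<in> B" by (rule subsetD[OF \<Gamma>B]) (use p in simp)
    ultimately show False using u(3) v(3) by auto
  qed
  have sub: "?\<Gamma> \<subseteq> c ` {v - 1..u} \<union> c ` {u..v}" using g(1) cover by (rule order_trans)
  have ends: "c a \<in> ?\<Gamma>" "c b \<in> ?\<Gamma>"
    using imageI[of 0 "{0..dist (c a) (c b)}" \<gamma>] imageI[of "dist (c a) (c b)" "{0..dist (c a) (c b)}" \<gamma>]
    by (simp_all add: g(2,3))
  have "c a \<in> c ` {v - 1..u}" "c b \<in> c ` {u..v}" using u v by auto
  with ends have "c ` {v - 1..u} \<inter> ?\<Gamma> \<noteq> {}" "c ` {u..v} \<inter> ?\<Gamma> \<noteq> {}" by (metis IntI empty_iff)+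
  then have "\<not> connected ?\<Gamma>"
    unfolding connected_closed not_not
    by (intro exI[of _ "c ` {v - 1..u}"] exI[of _ "c ` {u..v}"] conjI closed sub disj)
  then show False using conn by contradiction
qed

text \<open>From a point strictly inside the arc, a geodesic to one end cannot run through the other
  end: it would contain a stretch of the maximal length M and have positive length left over. So it
  follows the arc, and distances along the arc add up.\<close>

lemma arc_between_antipodes:
  assumes c: "circle_param c C" and C: "geodesic_space C" and \<tau>: "0 < \<tau>" "\<tau> < 1"
    and M: "dist (c 0) (c \<tau>) = M" "\<And>s t. dist (c s) (c t) \<le> M" and s: "\<tau> \<le> s" "s \<le> 1"
  shows "dist (c \<tau>) (c s) + dist (c s) (c 0) = M"
    and "s \<le> m \<Longrightarrow> m \<le> 1 \<Longrightarrow> dist (c s) (c m) = dist (c s) (c 0) - dist (c m) (c 0)"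
proof -
  have cont: "continuous_on UNIV c" using c by (auto simp: circle_param_def)
  have c1: "c 1 = c 0" using circle_param_add_1[OF c, of 0] by simp
  have to0: "dist (c s) (c m) + dist (c m) (c 0) = dist (c s) (c 0)" if s: "\<tau> < s" "s < 1" and m: "s \<le> m" "m \<le> 1" for s m
  proof -
    have "\<not> (\<forall>m\<in>{1..s + 1}. dist (c s) (c m) + dist (c m) (c 1) = dist (c s) (c 1))"
    proof
      assume "\<forall>m\<in>{1..s + 1}. dist (c s) (c m) + dist (c m) (c 1) = dist (c s) (c 1)"
      then have "dist (c s) (c (\<tau> + 1)) + dist (c (\<tau> + 1)) (c 1) = dist (c s) (c 1)" using \<tau> s by auto
      then have "dist (c s) (c \<tau>) + M \<le> M"
        using M(1) M(2)[of s 0] circle_param_add_1[OF c, of \<tau>] c1 by (simp add: dist_commute)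
      then have "c s = c \<tau>" by simp
      then show False using circle_param_neq[OF c, of s \<tau>] s \<tau> by simp
    qed
    then have "\<forall>m\<in>{s..1}. dist (c s) (c m) + dist (c m) (c 1) = dist (c s) (c 1)"
      using geodesic_covers_arc[OF c C, of s 1] s \<tau> by auto
    then show ?thesis using m c1 by auto
  qed
  have to\<tau>: "dist (c \<tau>) (c m) + dist (c m) (c s) = dist (c \<tau>) (c s)" if s: "\<tau> < s" "s < 1" and m: "\<tau> \<le> m" "m \<le> s" for s m
  proof -
    have "\<not> (\<forall>m\<in>{s..\<tau> + 1}. dist (c \<tau>) (c m) + dist (c m) (c s) = dist (c \<tau>) (c s))"
    proof
      assume "\<forall>m\<in>{s..\<tau> + 1}. dist (c \<tau>) (c m) + dist (c m) (c s) = dist (c \<tau>) (c s)"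
      then have "dist (c \<tau>) (c 1) + dist (c 1) (c s) = dist (c \<tau>) (c s)" using \<tau> s by auto
      then have "M + dist (c 0) (c s) \<le> M" using M(1) M(2)[of \<tau> s] c1 by (simp add: dist_commute)
      then have "c s = c 0" by simp
      then show False using circle_param_neq[OF c, of s 0] s \<tau> by simp
    qed
    then have "\<forall>m\<in>{\<tau>..s}. dist (c \<tau>) (c m) + dist (c m) (c s) = dist (c \<tau>) (c s)"
      using geodesic_covers_arc[OF c C, of \<tau> s] s \<tau> by auto
    then show ?thesis using m by auto
  qed
  \<comment> \<open>By the two additivity statements the sum of the distances to both ends is
    constant along the open arc. Letting the point tend to \<open>c \<tau>\<close>, continuity of c
    identifies the constant as M.\<close>
  have inner: "dist (c \<tau>) (c s) + dist (c s) (c 0) = M" if s: "\<tau> < s" "s < 1" for s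
  proof -
    let ?h = "\<lambda>s. dist (c \<tau>) (c s) + dist (c s) (c 0)"
    have const: "?h s' = ?h s" if "\<tau> < s'" "s' \<le> s" for s'
      using to0[of s' s] to\<tau>[of s s'] that s by simp
    have "\<bar>?h s - M\<bar> \<le> \<epsilon>" if e: "0 < \<epsilon>" for \<epsilon>
    proof -
      obtain d where d: "d > 0" "\<And>t. dist t \<tau> < d \<Longrightarrow> dist (c t) (c \<tau>) < \<epsilon> / 2"
        using cont e unfolding continuous_on_iff by (metis UNIV_I half_gt_zero)
      define s' where "s' = min s (\<tau> + d / 2)"
      have s': "\<tau> < s'" "s' \<le> s" using s d(1) by (auto simp: s'_def)
      have "dist s' \<tau> < d" using s' d(1) by (auto simp: s'_def dist_real_def)
      then have "dist (c s') (c \<tau>) < \<epsilon> / 2" by (rule d(2))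
      moreover have "\<bar>?h s' - M\<bar> \<le> 2 * dist (c s') (c \<tau>)"
        using dist_triangle[of "c s'" "c 0" "c \<tau>"] dist_triangle[of "c \<tau>" "c 0" "c s'"] M(1)
        by (simp add: dist_commute abs_le_iff)
      ultimately show ?thesis using const[OF s'] by simp
    qed
    then have "\<bar>?h s - M\<bar> \<le> 0" by (rule field_le_epsilon[where y = 0, simplified])
    then show ?thesis by simp
  qed
  have h: "dist (c \<tau>) (c s) + dist (c s) (c 0) = M" if "\<tau> \<le> s" "s \<le> 1" for s
    using inner[of s] that M(1) c1 by (cases "s = \<tau>"; cases "s = 1") (auto simp: dist_commute)
  show "dist (c \<tau>) (c s) + dist (c s) (c 0) = M" by (rule h) fact+
  assume m: "s \<le> m" "m \<le> 1"
  show "dist (c s) (c m) = dist (c s) (c 0) - dist (c m) (c 0)"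
  proof (cases "s = \<tau> \<or> s = 1")
    case True
    then show ?thesis
    proof
      assume "s = \<tau>"
      then show ?thesis using h[of m] m s M(1) by (simp add: dist_commute)
    next
      assume "s = 1"
      then have "m = 1" using m by simp
      then show ?thesis using \<open>s = 1\<close> by simp
    qed
  next
    case False
    then show ?thesis using to0[of s m] s m by simp
  qed
qed

lemma nint_eq_min:
  assumes "\<bar>d\<bar> < 1"
  shows "nint d = min \<bar>d\<bar> (1 - \<bar>d\<bar>)"
proof -
  consider "\<bar>d\<bar> \<le> 1 / 2" | "1 / 2 < d" | "d < - 1 / 2" by linarith
  then show ?thesis
  proof cases
    case 1
    then show ?thesis by (simp add: nint_eq_abs min_def)
  next
    case 2
    then have "nint d = \<bar>d - 1\<bar>"
      using nint_add_int[of "d - 1" 1] nint_eq_abs[of "d - 1"] assms by simp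
    then show ?thesis using 2 assms by (simp add: min_def)
  next
    case 3
    then have "nint d = \<bar>d + 1\<bar>"
      using nint_add_int[of "d + 1" "-1"] nint_eq_abs[of "d + 1"] assms by simp
    then show ?thesis using 3 assms by (simp add: min_def)
  qed
qed

text \<open>
  Points at maximal distance \<open>M\<close> cut a geodesic circle into two geodesics of length \<open>M\<close>; arc length
  along them is an isometric parametrization by a circle of circumference \<open>2 M\<close>.
\<close>

theorem geodesic_circle_metric_circle:
  assumes "geodesic_circle C"
  obtains e L where "metric_circle e L" "range e = C"
proof -
  have C: "geodesic_space C" "topological_circle C" using assms by (simp_all add: geodesic_circle_def)
  obtain c0 where c0: "circle_param c0 C" using circle_param_exists[OF C(2)] .
  have "compact C"
    using C(2) homeomorphic_compactness compact_sphere unfolding topological_circle_def by blast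
  moreover have "C \<noteq> {}" using c0 by (auto simp: circle_param_def)
  ultimately obtain p q where pq: "p \<in> C" "q \<in> C" "dist p q = diameter C"
    using diameter_compact_attained by blast
  define M where "M = diameter C"
  have bound: "dist x y \<le> M" if "x \<in> C" "y \<in> C" for x y
    unfolding M_def using that \<open>compact C\<close> by (intro diameter_bounded_bound compact_imp_bounded)
  obtain t0 where t0: "p = c0 t0" using pq(1) c0 by (auto simp: circle_param_def)
  define c where "c t = c0 (t0 + t)" for t
  have c: "circle_param c C" unfolding c_def by (rule circle_param_shift[OF c0])
  have rng: "range c = C" and cont: "continuous_on UNIV c" and per: "\<And>s t. c s = c t \<longleftrightarrow> s - t \<in> \<int>"
    using c by (auto simp: circle_param_def)
  have bnd: "dist (c s) (c t) \<le> M" for s t using bound rng by blast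
  have "c (1/2) \<noteq> c 0" by (rule circle_param_neq[OF c]) auto
  then have M0: "0 < M" using bnd[of "1/2" 0] zero_less_dist_iff[of "c (1/2)" "c 0"] by linarith
  have reduce: "\<exists>s. 0 \<le> s \<and> s < 1 \<and> c s = c t" for t
    by (intro exI[of _ "t - of_int \<lfloor>t\<rfloor>"]) (simp add: per, linarith)
  obtain t1 where "q = c t1" using pq(2) rng by blast
  then obtain \<tau> where \<tau>0: "0 \<le> \<tau>" "\<tau> < 1" "c \<tau> = q" using reduce[of t1] by metis
  have dM: "dist (c 0) (c \<tau>) = M" using pq(3) t0 \<tau>0 by (simp add: c_def M_def)
  then have "\<tau> \<noteq> 0" using M0 by auto
  then have \<tau>: "0 < \<tau>" "\<tau> < 1" using \<tau>0 by auto
  have c1: "c 1 = c 0" using circle_param_add_1[OF c, of 0] by simp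
  define g where "g t = dist (c t) (c 0)" for t
  have upper: "dist (c \<tau>) (c s) + g s = M" "s \<le> m \<Longrightarrow> m \<le> 1 \<Longrightarrow> dist (c s) (c m) = g s - g m"
    if "\<tau> \<le> s" "s \<le> 1" for s m
    using arc_between_antipodes[OF c C(1) \<tau> dM bnd that] unfolding g_def by auto
  \<comment> \<open>The other arc is of the kind already treated after reversing the
    parametrization, where the point \<open>c t\<close> has parameter 1 - t and the far end has
    parameter 1 - \<tau>.\<close>
  have lower: "dist (c \<tau>) (c s) + g s = M" "0 \<le> m \<Longrightarrow> m \<le> s \<Longrightarrow> dist (c s) (c m) = g s - g m"
    if s: "0 \<le> s" "s \<le> \<tau>" for s m
  proof -
    have cr: "circle_param (\<lambda>t. c (- t)) C" by (rule circle_param_reflect[OF c])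
    have refl: "c (- (1 - t)) = c t" for t using circle_param_add_1[OF c, of "t - 1"] by simp
    have \<tau>': "0 < 1 - \<tau>" "1 - \<tau> < 1" using \<tau> by auto
    have s': "1 - \<tau> \<le> 1 - s" "1 - s \<le> 1" using s by auto
    have dM': "dist (c (- 0)) (c (- (1 - \<tau>))) = M" using dM by (simp only: refl minus_zero)
    note * = arc_between_antipodes[OF cr C(1) \<tau>' dM' bnd s']
    show "dist (c \<tau>) (c s) + g s = M" using *(1) unfolding refl minus_zero g_def .
    show "dist (c s) (c m) = g s - g m" if "0 \<le> m" "m \<le> s"
      using *(2)[of "1 - m"] that unfolding refl minus_zero g_def by simp
  qed
  have g0: "g 0 = 0" "g 1 = 0" "g \<tau> = M" "\<And>t. 0 \<le> g t" "\<And>t. g t \<le> M"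
    using dM c1 bnd by (auto simp: g_def dist_commute)
  \<comment> \<open>Arc length measured from \<open>c 0\<close>: it equals the distance to
    \<open>c 0\<close> up to the antipode \<open>c \<tau>\<close>, and 2 M minus that distance on
    the way back.\<close>
  define l where "l t = (if t \<le> \<tau> then g t else 2 * M - g t)" for t
  have l_dist: "l s \<le> l t \<and> dist (c s) (c t) = min (l t - l s) (2 * M - (l t - l s))"
    if st: "0 \<le> s" "s \<le> t" "t \<le> 1" for s t
  proof -
    consider "t \<le> \<tau>" | "\<tau> < s" | "s \<le> \<tau>" "\<tau> < t" by linarith
    then show ?thesis
    proof cases
      case 1
      then have "dist (c t) (c s) = g t - g s" using lower(2)[of t s] st by simp
      then show ?thesis using 1 st g0(4)[of s] g0(5)[of t] zero_le_dist[of "c t" "c s"]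
        by (simp add: l_def min_def dist_commute)
    next
      case 2
      then have "dist (c s) (c t) = g s - g t" using upper(2)[of s t] st by simp
      then show ?thesis using 2 st g0(4)[of t] g0(5)[of s] zero_le_dist[of "c s" "c t"]
        by (simp add: l_def min_def)
    next
      \<comment> \<open>The points lie on different arcs, so a geodesic between them passes through
        \<open>c \<tau>\<close> or through \<open>c 0\<close>. The triangle inequality at both
        points shows that the shorter way is taken.\<close>
      case 3
      have a: "dist (c \<tau>) (c s) = M - g s" using lower(1)[of s] 3 st by simp
      have b: "dist (c \<tau>) (c t) = M - g t" using upper(1)[of t] 3 st by simp
      have ub: "dist (c s) (c t) \<le> 2 * M - g t - g s" "dist (c s) (c t) \<le> g s + g t"
        using dist_triangle[of "c s" "c t" "c \<tau>"] dist_triangle[of "c s" "c t" "c 0"] a b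
        by (simp_all add: dist_commute g_def)
      have "dist (c s) (c t) = 2 * M - g t - g s \<or> dist (c s) (c t) = g s + g t"
      proof (cases "t < s + 1")
        case True
        have "(\<forall>m\<in>{s..t}. dist (c s) (c m) + dist (c m) (c t) = dist (c s) (c t)) \<or>
            (\<forall>m\<in>{t..s + 1}. dist (c s) (c m) + dist (c m) (c t) = dist (c s) (c t))"
          by (rule geodesic_covers_arc[OF c C(1)]) (use 3 True in auto)
        then show ?thesis
        proof
          assume "\<forall>m\<in>{s..t}. dist (c s) (c m) + dist (c m) (c t) = dist (c s) (c t)"
          then have "dist (c s) (c \<tau>) + dist (c \<tau>) (c t) = dist (c s) (c t)" using 3 by auto
          then show ?thesis using a b by (simp add: dist_commute)
        next
          assume "\<forall>m\<in>{t..s + 1}. dist (c s) (c m) + dist (c m) (c t) = dist (c s) (c t)"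
          then have "dist (c s) (c 1) + dist (c 1) (c t) = dist (c s) (c t)" using st by auto
          then show ?thesis by (simp add: c1 g_def dist_commute)
        qed
      next
        case False
        then have "s = 0" "t = 1" using st by auto
        then show ?thesis using g0 by (simp add: c1)
      qed
      then show ?thesis using ub 3 g0(5)[of s] g0(5)[of t] by (auto simp: l_def min_def)
    qed
  qed
  have l_onto: "\<exists>t. 0 \<le> t \<and> t \<le> 1 \<and> l t = v" if v: "0 \<le> v" "v \<le> 2 * M" for v
  proof -
    have cg: "continuous_on S g" for S
      unfolding g_def by (intro continuous_intros continuous_on_subset[OF cont]) auto
    show ?thesis
    proof (cases "v \<le> M")
      case True
      then obtain t where "0 \<le> t" "t \<le> \<tau>" "g t = v"
        using IVT'[of g 0 v \<tau>] v g0 \<tau> cg by auto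
      then show ?thesis using \<tau> by (intro exI[of _ t]) (simp add: l_def)
    next
      case False
      then obtain t where t: "\<tau> \<le> t" "t \<le> 1" "g t = 2 * M - v"
        using IVT2'[of g 1 "2 * M - v" \<tau>] v g0 \<tau> cg by auto
      then have "t \<noteq> \<tau>" using False g0(3) by auto
      then show ?thesis using t \<tau> by (intro exI[of _ t]) (simp add: l_def)
    qed
  qed
  define T where "T v = (SOME t. 0 \<le> t \<and> t \<le> 1 \<and> l t = v)" for v
  have T: "0 \<le> T v" "T v \<le> 1" "l (T v) = v" if "0 \<le> v" "v \<le> 2 * M" for v
    using someI_ex[OF l_onto[OF that]] unfolding T_def by blast+
  have l_dist': "dist (c s) (c t) = min \<bar>l s - l t\<bar> (2 * M - \<bar>l s - l t\<bar>)"
    if "0 \<le> s" "s \<le> 1" "0 \<le> t" "t \<le> 1" for s t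
  proof (cases "s \<le> t")
    case True
    then show ?thesis using l_dist[of s t] that by (simp add: abs_minus_commute)
  next
    case False
    then show ?thesis using l_dist[of t s] that by (simp add: dist_commute)
  qed
  define e where "e s = c (T (2 * M * frac s))" for s
  have fr: "0 \<le> 2 * M * frac s" "2 * M * frac s \<le> 2 * M" for s
    using M0 frac_lt_1[of s] by (simp_all add: mult_left_le less_imp_le)
  have "metric_circle e (2 * M)"
  proof
    show "0 < 2 * M" using M0 by simp
    fix s t :: real
    define d where "d = frac s - frac t"
    have d1: "\<bar>d\<bar> < 1" using frac_lt_1[of s] frac_lt_1[of t] frac_ge_0[of s] frac_ge_0[of t] unfolding d_def by linarith
    have "s - t = d + of_int (\<lfloor>s\<rfloor> - \<lfloor>t\<rfloor>)" by (simp add: d_def frac_def)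
    then have n: "nint (s - t) = min \<bar>d\<bar> (1 - \<bar>d\<bar>)" using nint_add_int[of d] nint_eq_min[OF d1] by metis
    have "dist (e s) (e t) = min \<bar>2 * M * frac s - 2 * M * frac t\<bar> (2 * M - \<bar>2 * M * frac s - 2 * M * frac t\<bar>)"
      unfolding e_def using l_dist'[of "T (2 * M * frac s)" "T (2 * M * frac t)"] T[OF fr] by simp
    also have "2 * M * frac s - 2 * M * frac t = 2 * M * d" by (simp add: d_def algebra_simps)
    also have "\<bar>2 * M * d\<bar> = 2 * M * \<bar>d\<bar>" using M0 by (simp add: abs_mult)
    also have "min (2 * M * \<bar>d\<bar>) (2 * M - 2 * M * \<bar>d\<bar>) = 2 * M * min \<bar>d\<bar> (1 - \<bar>d\<bar>)"
      using M0 by (simp add: min_mult_distrib_left algebra_simps)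
    finally show "dist (e s) (e t) = 2 * M * nint (s - t)" by (simp add: n)
  qed
  moreover have "range e = C"
  proof (intro equalityI subsetI)
    fix x assume "x \<in> C"
    then obtain t where t: "0 \<le> t" "t < 1" "x = c t" using rng reduce by (metis imageE)
    have l_range: "0 \<le> l t" "l t \<le> 2 * M"
      using g0(4)[of t] g0(5)[of t] M0 by (auto simp: l_def)
    have "\<exists>s. dist (e s) x = 0"
    proof (cases "l t = 2 * M")
      \<comment> \<open>\<open>frac\<close> stays below 1, so the value 2 M of the arc length is
        represented by the parameter 0.\<close>
      case True
      have "dist (c (T 0)) (c t) = 0"
        using l_dist'[of "T 0" t] T[of 0] M0 t True by simp
      then show ?thesis using t(3) by (intro exI[of _ 0]) (simp add: e_def)
    next
      case False
      define s where "s = l t / (2 * M)"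
      have "0 \<le> s" "s < 1" using l_range False M0 by (simp_all add: s_def field_simps)
      then have "frac s = s" by (simp add: frac_eq)
      then have "2 * M * frac s = l t" using M0 by (simp add: s_def)
      then have "e s = c (T (l t))" by (simp add: e_def)
      moreover have "dist (c (T (l t))) (c t) = 0"
        using l_dist'[of "T (l t)" t] T[OF l_range] M0 t by simp
      ultimately show ?thesis using t(3) by (intro exI[of _ s]) simp
    qed
    then show "x \<in> range e" by auto
  qed (use rng in \<open>auto simp: e_def\<close>)
  ultimately show ?thesis by (rule that)
qed

text \<open>The group that should be a summand is zero, so the complement is the whole second
  homology of the ambient complex and V consists of all cycles.\<close>

lemma direct_summand_degree_2:
  fixes \<alpha> :: "'a::metric_space set" and G :: "'g::ab_group_add itself"
  assumes "geodesic_circle \<alpha>"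
  shows "direct_summand_via {0<..D} (Rips_persistence G 2 \<alpha>) (Rips_persistence G 2 (UNIV :: 'a set))
           (\<lambda>r. homology_inclusion G 2 (Rips \<alpha> r) (Rips UNIV r))"
  unfolding Rips_persistence_def
proof (rule direct_summand_viaI[where V = "\<lambda>r. cycles (Suc 2) (Rips UNIV r)"])
  show "cycles (Suc 2) (Rips UNIV p) \<subseteq> cycles (Suc 2) (Rips (UNIV :: 'a set) q)" if "p < q" for p q
    by (rule cycles_mono[OF Rips_mono]) (use that in auto)
  show "Rips \<alpha> r \<subseteq> Rips UNIV r" for r by (rule Rips_mono) auto
  show "Rips \<alpha> p \<subseteq> Rips \<alpha> q" if "p < q" for p q by (rule Rips_mono) (use that in auto)
  show "Rips (UNIV :: 'a set) p \<subseteq> Rips UNIV q" if "p < q" for p q by (rule Rips_mono) (use that in auto)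
  show "\<exists>a\<in>cycles (Suc 2) (Rips \<alpha> r). \<exists>w\<in>cycles (Suc 2) (Rips UNIV r).
      \<exists>y\<in>alt_chains (Suc (Suc 2)) (Rips UNIV r). z = a + w + bd y"
    if "z \<in> cycles (Suc 2) (Rips UNIV r)" for r and z :: "'a list \<Rightarrow>\<^sub>0 'g"
    by (rule bexI[of _ 0], rule bexI[of _ z], rule bexI[of _ 0]) (use that in auto)
  show "a \<in> bd ` alt_chains (Suc (Suc 2)) (Rips \<alpha> r)"
    if "r \<in> {0<..D}" "a \<in> cycles (Suc 2) (Rips \<alpha> r)" for r and a :: "'a list \<Rightarrow>\<^sub>0 'g"
  proof -
    obtain e :: "real \<Rightarrow> 'a" and L where e: "metric_circle e L" "range e = \<alpha>"
      using geodesic_circle_metric_circle[OF assms] .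
    have "alt_chains 3 (Rips\<^sub>0 \<alpha> r) = (alt_chains 3 (Rips \<alpha> r) :: ('a list \<Rightarrow>\<^sub>0 'g) set)"
      using alt_chains_Rips\<^sub>0[of 2 \<alpha> r] by simp
    then have a: "a \<in> alt_chains 3 (Rips\<^sub>0 (range e) r)" "bd a = 0"
      using that(2) by (simp_all add: cycles_def e(2))
    have "homologous 3 (Rips\<^sub>0 (range e) r) a 0"
      by (rule metric_circle.second_homology_vanishes[OF e(1) _ a]) (use that(1) in auto)
    then obtain y where y: "y \<in> alt_chains (Suc 3) (Rips\<^sub>0 \<alpha> r)" "bd y = a"
      unfolding e(2) by (rule homologous_0D)
    from y(1) have "y \<in> alt_chains (Suc 3) (Rips \<alpha> r)" unfolding alt_chains_Rips\<^sub>0 .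
    then have "y \<in> alt_chains (Suc (Suc 2)) (Rips \<alpha> r)" by simp
    then show ?thesis using y(2) by blast
  qed
qed (auto intro: simplicial_complex_Rips cycles_add cycles_uminus)

theorem theorem4p5:
  fixes \<alpha> :: "'a::metric_space set"
    and D :: real
    and k :: nat
    and G :: "'g::ab_group_add itself"
  assumes "geodesic_space (UNIV :: 'a set)"
    and "surface (UNIV :: 'a set)"
    and "0 < D"
    and "geodesic_circle \<alpha>"
    and "DC_isolated D D \<alpha>"
    and "2 \<le> k"
  shows "direct_summand_via {0<..D}
           (Rips_persistence G k \<alpha>)
           (Rips_persistence G k (UNIV :: 'a set))
           (\<lambda>r. homology_inclusion G k (Rips \<alpha> r) (Rips UNIV r))"
proof (cases "k = 2")
  case True
  then show ?thesis using direct_summand_degree_2[OF assms(4)] by simp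
next
  case False
  then have k: "3 \<le> k" using assms(6) by simp
  obtain N\<^sub>1 N\<^sub>2 \<alpha>\<^sub>1 \<alpha>\<^sub>2 where "closed N\<^sub>1" "N\<^sub>1 \<subseteq> N\<^sub>2" "(\<Union>x\<in>N\<^sub>1. ball x D) \<subseteq> N\<^sub>2"
    "surface_boundary N\<^sub>1 = \<alpha>\<^sub>1 \<union> \<alpha>\<^sub>2" "\<forall>x\<in>\<alpha>\<^sub>1. \<forall>y\<in>\<alpha>\<^sub>2. D \<le> dist x y"
    "\<forall>r. 0 < r \<and> r < D \<longrightarrow>
       geometric_realization (Rips \<alpha>\<^sub>1 r) homotopy_equivalent_space top_of_set (sphere (0::complex) 1) \<and>
       geometric_realization (Rips \<alpha>\<^sub>2 r) homotopy_equivalent_space top_of_set (sphere (0::complex) 1)"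
    "deformation_contraction (N\<^sub>2 - surface_interior N\<^sub>1) (surface_boundary N\<^sub>1)" "deformation_contraction N\<^sub>1 \<alpha>"
    using assms(5)[unfolded DC_isolated_def] by (elim conjE exE) (rule that; assumption)
  then interpret isolated_circle \<alpha> N\<^sub>1 N\<^sub>2 \<alpha>\<^sub>1 \<alpha>\<^sub>2 D
    using assms(1-3) by unfold_locales simp_all
  show ?thesis by (rule direct_summand_high_degree[OF k])
qed

end
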